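(* Let $F_{\mathbb{Z}}$ be the free group on generators $\ldots,g_{-1},g_0,g_1,\ldots$ indexed by $\mathbb{Z}$, let $C_r^*(F_{\mathbb{Z}})$ be its reduced group C$^*$-algebra, and let $\alpha$ be the automorphism of $C_r^*(F_{\mathbb{Z}})$ such that $\alpha(g_i)=g_{i+1}$ for all $i\in\mathbb{Z}$. Then the Möbius function $\mu$ is linearly disjoint from $(C_r^*(F_{\mathbb{Z}}),\alpha)$, and the Voiculescu–Brown entropy of $\alpha$ is $ht(\alpha)=0$.
   Context: $\mu$ is the Möbius function: $\mu(1)=1$, $\mu(n)=0$ if $n$ is not square-free, and $\mu(n)=(-1)^t$ if $n$ is a product of $t$ distinct primes. Group elements are identified with the corresponding unitaries of the left regular representation in $C_r^*(F_{\mathbb{Z}})$. For a C$^*$-algebra $\mathfrak{A}$ and an automorphism $\alpha$ of $\mathfrak{A}$, $\mu$ is linearly disjoint from $(\mathfrak{A},\alpha)$ if $\frac1N\sum_{n=1}^N\mu(n)\rho(\alpha^n(A))\to0$ as $N\to\infty$ for every state $\rho$ on $\mathfrak{A}$ and every $A\in\mathfrak{A}$. Voiculescu–Brown entropy: let $\mathfrak{A}$ be exact (equivalently, nuclearly embeddable), $\alpha$ an automorphism of $\mathfrak{A}$, and $\pi:\mathfrak{A}\to\mathcal{B}(\mathcal{H})$ a faithful $*$-representation. For a finite set $\Omega\subset\mathfrak{A}$ and $\delta>0$ let $CPA(\pi,\Omega,\delta)$ be the collection of triples $(\varphi,\psi,\mathfrak{B})$ where $\mathfrak{B}$ is a finite-dimensional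 C$^*$-algebra and $\varphi:\mathfrak{A}\to\mathfrak{B}$, $\psi:\mathfrak{B}\to\mathcal{B}(\mathcal{H})$ are contractive completely positive maps with $\|(\psi\circ\varphi)(a)-\pi(a)\|<\delta$ for all $a\in\Omega$. Let $rcp(\Omega,\delta)$ be the infimum of $\operatorname{rank}\mathfrak{B}$ over all such triples, where rank is the dimension of a maximal abelian C$^*$-subalgebra. Set $ht(\alpha,\Omega,\delta)=\limsup_{n\to\infty}\frac1n\log rcp(\Omega\cup\alpha\Omega\cup\cdots\cup\alpha^{n-1}\Omega,\delta)$, $ht(\alpha,\Omega)=\sup_{\delta>0}ht(\alpha,\Omega,\delta)$, and $ht(\alpha)=\sup_\Omega ht(\alpha,\Omega)$, the last supremum over all finite $\Omega\subset\mathfrak{A}$. (This does not depend on $\pi$.) *)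

theory Defs
  imports
    "HOL-Analysis.Analysis"
    "HOL-Computational_Algebra.Squarefree"
begin

section \<open>Complex Hilbert spaces\<close>

class scaleC = scaleR +
  fixes scaleC :: "complex \<Rightarrow> 'a \<Rightarrow> 'a" (infixr \<open>*\<^sub>C\<close> 75)

class complex_vector = real_vector + scaleC +
  assumes scaleC_add_right: "c *\<^sub>C (x + y) = c *\<^sub>C x + c *\<^sub>C y"
    and scaleC_add_left: "(c + d) *\<^sub>C x = c *\<^sub>C x + d *\<^sub>C x"
    and scaleC_scaleC: "c *\<^sub>C d *\<^sub>C x = (c * d) *\<^sub>C x"
    and scaleC_of_real: "of_real r *\<^sub>C x = r *\<^sub>R x"

global_interpretation complex_vector: vector_space "scaleC :: complex \<Rightarrow> 'a \<Rightarrow> 'a::complex_vector"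
  defines csubspace = "module.subspace (scaleC :: complex \<Rightarrow> 'a \<Rightarrow> 'a)"
    and cspan = "module.span (scaleC :: complex \<Rightarrow> 'a \<Rightarrow> 'a)"
    and cdim = "vector_space.dim (scaleC :: complex \<Rightarrow> 'a \<Rightarrow> 'a)"
proof
  show "1 *\<^sub>C x = x" for x :: 'a
    using scaleC_of_real [of 1 x] by simp
qed (simp_all add: scaleC_add_right scaleC_add_left scaleC_scaleC)

instantiation complex :: complex_vector
begin
definition scaleC_complex :: "complex \<Rightarrow> complex \<Rightarrow> complex" where
  "scaleC_complex c x = c * x"
instance
  by standard (auto simp: scaleC_complex_def algebra_simps scaleR_conv_of_real)
end

text \<open>The inner product is linear in the second argument. The topology, the norm and the
  real inner product are those of the underlying real Hilbert space.\<close>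

class chilbert_space = complex_vector + real_inner + complete_space +
  fixes cinner :: "'a \<Rightarrow> 'a \<Rightarrow> complex"
  assumes cinner_commute: "cinner x y = cnj (cinner y x)"
    and cinner_add_right: "cinner x (y + z) = cinner x y + cinner x z"
    and cinner_scaleC_right: "cinner x (c *\<^sub>C y) = c * cinner x y"
    and Re_cinner: "Re (cinner x y) = x \<bullet> y"

lemma norm_scaleC: "norm (c *\<^sub>C x) = cmod c * norm (x :: 'a::chilbert_space)"
proof -
  have self: "cinner y y = of_real ((norm y)\<^sup>2)" for y :: 'a
    using cinner_commute [of y y] Re_cinner [of y y]
    by (simp add: complex_eq_iff power2_norm_eq_inner)
  have "cinner (c *\<^sub>C x) (c *\<^sub>C x) = c * cnj c * cinner x x"
    by (metis (no_types, lifting) cinner_commute cinner_scaleC_right complex_cnj_mult mult.assoc)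
  also have "\<dots> = of_real ((cmod c * norm x)\<^sup>2)"
    by (simp add: self complex_norm_square [symmetric] power_mult_distrib)
  finally have "(norm (c *\<^sub>C x))\<^sup>2 = (cmod c * norm x)\<^sup>2"
    unfolding self of_real_eq_iff .
  then show ?thesis
    by (simp add: power2_eq_iff_nonneg)
qed

section \<open>The Hilbert space of square-summable families\<close>

typedef 'a ell2 = "{f :: 'a \<Rightarrow> complex. (\<lambda>x. (cmod (f x))\<^sup>2) summable_on UNIV}"
  by (rule exI [of _ "\<lambda>_. 0"]) simp

setup_lifting type_definition_ell2

lemma square_summable_add:
  assumes "(\<lambda>x. (cmod (f x))\<^sup>2) summable_on UNIV" "(\<lambda>x. (cmod (g x))\<^sup>2) summable_on UNIV"
  shows "(\<lambda>x. (cmod (f x + g x))\<^sup>2) summable_on UNIV"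
proof -
  have "(cmod (a + b))\<^sup>2 \<le> 2 * ((cmod a)\<^sup>2 + (cmod b)\<^sup>2)" for a b
  proof -
    have "(cmod (a + b))\<^sup>2 \<le> (cmod a + cmod b)\<^sup>2"
      by (simp add: norm_triangle_ineq power_mono)
    also have "\<dots> \<le> 2 * ((cmod a)\<^sup>2 + (cmod b)\<^sup>2)"
      using sum_squares_bound [of "cmod a" "cmod b"] by (simp add: power2_sum)
    finally show ?thesis .
  qed
  moreover have "(\<lambda>x. 2 * ((cmod (f x))\<^sup>2 + (cmod (g x))\<^sup>2)) summable_on UNIV"
    by (intro summable_on_cmult_right summable_on_add assms)
  ultimately show ?thesis
    by (rule_tac summable_on_comparison_test) auto
qed

lemma square_summable_scale:
  assumes "(\<lambda>x. (cmod (f x))\<^sup>2) summable_on UNIV"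
  shows "(\<lambda>x. (cmod (c * f x))\<^sup>2) summable_on UNIV"
  by (simp add: norm_mult power_mult_distrib summable_on_cmult_right assms)

lemma square_summable_prod:
  assumes "(\<lambda>x. (cmod (f x))\<^sup>2) summable_on UNIV" "(\<lambda>x. (cmod (g x))\<^sup>2) summable_on UNIV"
  shows "(\<lambda>x. cnj (f x) * g x) summable_on UNIV"
proof (rule abs_summable_summable [OF Infinite_Sum.abs_summable_on_comparison_test'])
  show "(\<lambda>x. (cmod (f x))\<^sup>2 + (cmod (g x))\<^sup>2) summable_on UNIV"
    by (intro summable_on_add assms)
  show "cmod (cnj (f x) * g x) \<le> (cmod (f x))\<^sup>2 + (cmod (g x))\<^sup>2" for x
    using sum_squares_bound [of "cmod (f x)" "cmod (g x)"]
      mult_nonneg_nonneg [OF norm_ge_zero [of "f x"] norm_ge_zero [of "g x"]]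
    unfolding norm_mult complex_mod_cnj by linarith
qed

instantiation ell2 :: (type) complex_vector
begin
lift_definition zero_ell2 :: "'a ell2" is "\<lambda>_. 0" by simp
lift_definition plus_ell2 :: "'a ell2 \<Rightarrow> 'a ell2 \<Rightarrow> 'a ell2" is "\<lambda>f g x. f x + g x"
  by (rule square_summable_add)
lift_definition uminus_ell2 :: "'a ell2 \<Rightarrow> 'a ell2" is "\<lambda>f x. - f x" by simp
lift_definition minus_ell2 :: "'a ell2 \<Rightarrow> 'a ell2 \<Rightarrow> 'a ell2" is "\<lambda>f g x. f x - g x"
  using square_summable_add [of _ "\<lambda>x. - _ x"] by simp
lift_definition scaleC_ell2 :: "complex \<Rightarrow> 'a ell2 \<Rightarrow> 'a ell2" is "\<lambda>c f x. c * f x"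
  by (rule square_summable_scale)
lift_definition scaleR_ell2 :: "real \<Rightarrow> 'a ell2 \<Rightarrow> 'a ell2" is "\<lambda>r f x. of_real r * f x"
  by (rule square_summable_scale)
instance
  by standard (transfer; simp add: algebra_simps fun_eq_iff)+
end

instantiation ell2 :: (type) real_inner
begin
lift_definition inner_ell2 :: "'a ell2 \<Rightarrow> 'a ell2 \<Rightarrow> real"
  is "\<lambda>f g. Re (\<Sum>\<^sub>\<infinity>x. cnj (f x) * g x)" .
definition norm_ell2 :: "'a ell2 \<Rightarrow> real" where
  "norm_ell2 f = sqrt (f \<bullet> f)"
definition sgn_ell2 :: "'a ell2 \<Rightarrow> 'a ell2" where
  "sgn_ell2 f = f /\<^sub>R norm f"
definition dist_ell2 :: "'a ell2 \<Rightarrow> 'a ell2 \<Rightarrow> real" where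
  "dist_ell2 f g = norm (f - g)"
definition uniformity_ell2 :: "('a ell2 \<times> 'a ell2) filter" where
  "uniformity_ell2 = (INF e\<in>{0 <..}. principal {(f, g). dist f g < e})"
definition open_ell2 :: "'a ell2 set \<Rightarrow> bool" where
  "open_ell2 U \<longleftrightarrow> (\<forall>f\<in>U. eventually (\<lambda>(f', g). f' = f \<longrightarrow> g \<in> U) uniformity)"

lemma inner_self_ell2:
  "f \<bullet> f = (\<Sum>\<^sub>\<infinity>x. (cmod (Rep_ell2 f x))\<^sup>2)"
proof -
  have "(\<lambda>x. cnj (Rep_ell2 f x) * Rep_ell2 f x) summable_on UNIV"
    using Rep_ell2 [of f] by (intro square_summable_prod) auto
  then have "f \<bullet> f = (\<Sum>\<^sub>\<infinity>x. Re (cnj (Rep_ell2 f x) * Rep_ell2 f x))"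
    by (simp only: inner_ell2.rep_eq infsum_Re)
  also have "\<dots> = (\<Sum>\<^sub>\<infinity>x. (cmod (Rep_ell2 f x))\<^sup>2)"
    unfolding cmod_power2 by (simp add: power2_eq_square)
  finally show ?thesis .
qed

instance
proof
  fix f g h :: "'a ell2" and r :: real
  show "f \<bullet> g = g \<bullet> f"
  proof transfer
    fix f g :: "'a \<Rightarrow> complex"
    have "(\<Sum>\<^sub>\<infinity>x. cnj (f x) * g x) = cnj (\<Sum>\<^sub>\<infinity>x. cnj (g x) * f x)"
      unfolding infsum_cnj [symmetric] by (simp add: mult.commute)
    then show "Re (\<Sum>\<^sub>\<infinity>x. cnj (f x) * g x) = Re (\<Sum>\<^sub>\<infinity>x. cnj (g x) * f x)"
      by simp
  qed
  show "(f + g) \<bullet> h = f \<bullet> h + g \<bullet> h"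
    by transfer (simp add: distrib_right infsum_add square_summable_prod)
  show "(r *\<^sub>R f) \<bullet> g = r * (f \<bullet> g)"
    by transfer (simp add: mult.assoc infsum_cmult_right')
  show "0 \<le> f \<bullet> f"
    unfolding inner_self_ell2 by (intro infsum_nonneg) simp
  show "(f \<bullet> f = 0) \<longleftrightarrow> (f = 0)"
  proof
    assume *: "f \<bullet> f = 0"
    have "(cmod (Rep_ell2 f x))\<^sup>2 = 0" for x
      by (rule nonneg_infsum_le_0D [where A = UNIV])
        (use * Rep_ell2 [of f] in \<open>auto simp: inner_self_ell2\<close>)
    then show "f = 0"
      by (simp add: Rep_ell2_inject [symmetric] zero_ell2.rep_eq fun_eq_iff)
  next
    assume "f = 0" then show "f \<bullet> f = 0"
      by (simp add: inner_self_ell2 zero_ell2.rep_eq)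
  qed
qed (simp_all add: norm_ell2_def sgn_ell2_def dist_ell2_def uniformity_ell2_def open_ell2_def)
end

lemma norm_ell2_square: "(norm f)\<^sup>2 = (\<Sum>\<^sub>\<infinity>x. (cmod (Rep_ell2 f x))\<^sup>2)"
  by (simp add: power2_norm_eq_inner inner_self_ell2)

lemma sum_le_norm_ell2_square:
  assumes "finite F"
  shows "(\<Sum>x\<in>F. (cmod (Rep_ell2 f x))\<^sup>2) \<le> (norm f)\<^sup>2"
  unfolding norm_ell2_square using Rep_ell2 [of f] assms
  by (intro finite_sum_le_infsum) auto

instance ell2 :: (type) complete_space
proof
  fix X :: "nat \<Rightarrow> 'a ell2" assume X: "Cauchy X"
  have "convergent (\<lambda>n. Rep_ell2 (X n) x)" for x
  proof -
    have "cmod (Rep_ell2 (X m) x - Rep_ell2 (X n) x) \<le> norm (X m - X n)" for m n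
      using sum_le_norm_ell2_square [of "{x}" "X m - X n"]
      by (simp add: minus_ell2.rep_eq power2_le_iff_abs_le)
    then have "Cauchy (\<lambda>n. Rep_ell2 (X n) x)"
      using X unfolding Cauchy_iff by (meson order_le_less_trans)
    then show ?thesis
      by (rule Cauchy_convergent)
  qed
  then obtain l where l: "\<And>x. (\<lambda>n. Rep_ell2 (X n) x) \<longlonglongrightarrow> l x"
    unfolding convergent_def by metis
  have bound: "\<exists>N. \<forall>n\<ge>N. \<forall>F. finite F \<longrightarrow> (\<Sum>x\<in>F. (cmod (Rep_ell2 (X n) x - l x))\<^sup>2) \<le> e\<^sup>2"
    if "e > 0" for e :: real
  proof -
    obtain N where N: "\<And>m n. m \<ge> N \<Longrightarrow> n \<ge> N \<Longrightarrow> norm (X m - X n) < e"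
      using X \<open>e > 0\<close> unfolding Cauchy_iff by blast
    have "(\<Sum>x\<in>F. (cmod (Rep_ell2 (X n) x - l x))\<^sup>2) \<le> e\<^sup>2" if "n \<ge> N" "finite F" for n F
    proof (rule LIMSEQ_le_const2)
      show "(\<lambda>m. \<Sum>x\<in>F. (cmod (Rep_ell2 (X n) x - Rep_ell2 (X m) x))\<^sup>2)
          \<longlonglongrightarrow> (\<Sum>x\<in>F. (cmod (Rep_ell2 (X n) x - l x))\<^sup>2)"
        by (intro tendsto_intros l)
      show "\<exists>M. \<forall>m\<ge>M. (\<Sum>x\<in>F. (cmod (Rep_ell2 (X n) x - Rep_ell2 (X m) x))\<^sup>2) \<le> e\<^sup>2"
      proof (intro exI [of _ N] allI impI)
        fix m assume "m \<ge> N"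
        have "(\<Sum>x\<in>F. (cmod (Rep_ell2 (X n) x - Rep_ell2 (X m) x))\<^sup>2) \<le> (norm (X n - X m))\<^sup>2"
          using sum_le_norm_ell2_square [OF \<open>finite F\<close>, of "X n - X m"]
          by (simp add: minus_ell2.rep_eq)
        also have "\<dots> \<le> e\<^sup>2"
          using N [OF \<open>n \<ge> N\<close> \<open>m \<ge> N\<close>] by (intro power_mono) auto
        finally show "(\<Sum>x\<in>F. (cmod (Rep_ell2 (X n) x - Rep_ell2 (X m) x))\<^sup>2) \<le> e\<^sup>2" .
      qed
    qed
    then show ?thesis
      by blast
  qed
  have diff: "(\<lambda>x. (cmod (Rep_ell2 (X n) x - l x))\<^sup>2) summable_on UNIV"
    if "\<forall>F. finite F \<longrightarrow> (\<Sum>x\<in>F. (cmod (Rep_ell2 (X n) x - l x))\<^sup>2) \<le> e\<^sup>2" for n and e :: real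
    using that by (intro nonneg_bdd_above_summable_on bdd_aboveI2 [where M = "e\<^sup>2"]) auto
  obtain n where n: "(\<lambda>x. (cmod (Rep_ell2 (X n) x - l x))\<^sup>2) summable_on UNIV"
    using bound [of 1] diff [where e = 1] by auto
  have "(\<lambda>x. (cmod (l x - Rep_ell2 (X n) x + Rep_ell2 (X n) x))\<^sup>2) summable_on UNIV"
    using n Rep_ell2 [of "X n"] by (intro square_summable_add) (auto simp: norm_minus_commute)
  then have "(\<lambda>x. (cmod (l x))\<^sup>2) summable_on UNIV"
    by simp
  then obtain L where L: "Rep_ell2 L = l"
    by (metis Abs_ell2_inverse mem_Collect_eq)
  have "X \<longlonglongrightarrow> L"
  proof (rule LIMSEQ_I)
    fix r :: real assume "r > 0"
    then obtain N where N: "\<And>n F. n \<ge> N \<Longrightarrow> finite F \<Longrightarrow>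
        (\<Sum>x\<in>F. (cmod (Rep_ell2 (X n) x - l x))\<^sup>2) \<le> (r / 2)\<^sup>2"
      using bound [of "r / 2"] by auto
    have "norm (X n - L) < r" if "n \<ge> N" for n
    proof -
      have "(norm (X n - L))\<^sup>2 \<le> (r / 2)\<^sup>2"
        unfolding norm_ell2_square using N [OF that] Rep_ell2 [of "X n - L"]
        by (intro infsum_le_finite_sums) (auto simp: minus_ell2.rep_eq L)
      then have "norm (X n - L) \<le> r / 2"
        using \<open>r > 0\<close> by (simp add: power2_le_iff_abs_le)
      then show ?thesis
        using \<open>r > 0\<close> by simp
    qed
    then show "\<exists>N. \<forall>n\<ge>N. norm (X n - L) < r"
      by blast
  qed
  then show "convergent X"
    by (auto simp: convergent_def)
qed

instantiation ell2 :: (type) chilbert_space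
begin
lift_definition cinner_ell2 :: "'a ell2 \<Rightarrow> 'a ell2 \<Rightarrow> complex"
  is "\<lambda>f g. \<Sum>\<^sub>\<infinity>x. cnj (f x) * g x" .
instance
proof
  fix f g h :: "'a ell2" and c :: complex
  show "cinner f g = cnj (cinner g f)"
    by transfer (simp add: infsum_cnj [symmetric] mult.commute del: infsum_cnj)
  show "cinner f (g + h) = cinner f g + cinner f h"
    by transfer (simp add: distrib_left infsum_add square_summable_prod)
  show "cinner f (c *\<^sub>C g) = c * cinner f g"
    by transfer (simp add: mult.left_commute infsum_cmult_right')
  show "Re (cinner f g) = f \<bullet> g"
    by transfer simp
qed
end

section \<open>C*-algebras of operators\<close>

text \<open>The library type \<open>'h \<Rightarrow>\<^sub>L 'h\<close> consists of the bounded real-linear operators, with the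
  operator norm; bounded operators on the complex Hilbert space are its complex-linear members.\<close>

definition clinear_op :: "('h::chilbert_space \<Rightarrow>\<^sub>L 'h) \<Rightarrow> bool" where
  "clinear_op T \<longleftrightarrow> (\<forall>c x. blinfun_apply T (c *\<^sub>C x) = c *\<^sub>C blinfun_apply T x)"

lemma bounded_linear_scaleC: "bounded_linear (\<lambda>x :: 'a::chilbert_space. c *\<^sub>C x)"
proof (rule bounded_linear_intro [where K = "cmod c"])
  show "c *\<^sub>C r *\<^sub>R x = r *\<^sub>R c *\<^sub>C x" for r and x :: 'a
    by (metis mult.commute scaleC_of_real scaleC_scaleC)
qed (simp_all add: scaleC_add_right norm_scaleC mult.commute)

instantiation blinfun :: (real_normed_vector, chilbert_space) complex_vector
begin
lift_definition scaleC_blinfun :: "complex \<Rightarrow> ('a \<Rightarrow>\<^sub>L 'b) \<Rightarrow> 'a \<Rightarrow>\<^sub>L 'b" is "\<lambda>c T x. c *\<^sub>C T x"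
  by (rule bounded_linear_compose [OF bounded_linear_scaleC])
instance
  by standard
    (transfer; simp add: fun_eq_iff scaleC_add_right scaleC_add_left scaleC_scaleC scaleC_of_real)+
end

text \<open>The adjoint; by the Riesz representation theorem it exists for every complex-linear \<open>T\<close>.\<close>

definition adj :: "('h::chilbert_space \<Rightarrow>\<^sub>L 'h) \<Rightarrow> ('h \<Rightarrow>\<^sub>L 'h)" where
  "adj T = (THE S. \<forall>x y. cinner (blinfun_apply S x) y = cinner x (blinfun_apply T y))"

text \<open>A C*-algebra is represented concretely, as a norm-closed *-algebra of operators on a
  complex Hilbert space.\<close>

definition cstar_algebra :: "('h::chilbert_space \<Rightarrow>\<^sub>L 'h) set \<Rightarrow> bool" where
  "cstar_algebra A \<longleftrightarrow>
     (\<forall>T\<in>A. clinear_op T) \<and> csubspace A \<and> closed A \<and>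
     (\<forall>S\<in>A. \<forall>T\<in>A. S o\<^sub>L T \<in> A) \<and> (\<forall>T\<in>A. adj T \<in> A)"

definition clinear_on :: "'a::complex_vector set \<Rightarrow> ('a \<Rightarrow> 'b::complex_vector) \<Rightarrow> bool" where
  "clinear_on A f \<longleftrightarrow>
     (\<forall>x\<in>A. \<forall>y\<in>A. f (x + y) = f x + f y) \<and> (\<forall>c. \<forall>x\<in>A. f (c *\<^sub>C x) = c *\<^sub>C f x)"

definition star_hom ::
  "('h::chilbert_space \<Rightarrow>\<^sub>L 'h) set \<Rightarrow> (('h \<Rightarrow>\<^sub>L 'h) \<Rightarrow> ('k::chilbert_space \<Rightarrow>\<^sub>L 'k)) \<Rightarrow> bool" where
  "star_hom A f \<longleftrightarrow> clinear_on A f \<and>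
     (\<forall>S\<in>A. \<forall>T\<in>A. f (S o\<^sub>L T) = f S o\<^sub>L f T) \<and> (\<forall>T\<in>A. f (adj T) = adj (f T))"

definition cstar_automorphism ::
  "('h::chilbert_space \<Rightarrow>\<^sub>L 'h) set \<Rightarrow> (('h \<Rightarrow>\<^sub>L 'h) \<Rightarrow> ('h \<Rightarrow>\<^sub>L 'h)) \<Rightarrow> bool" where
  "cstar_automorphism A \<alpha> \<longleftrightarrow> star_hom A \<alpha> \<and> bij_betw \<alpha> A A"

definition faithful_rep ::
  "('h::chilbert_space \<Rightarrow>\<^sub>L 'h) set \<Rightarrow> (('h \<Rightarrow>\<^sub>L 'h) \<Rightarrow> ('k::chilbert_space \<Rightarrow>\<^sub>L 'k)) \<Rightarrow> bool" where
  "faithful_rep A \<pi> \<longleftrightarrow> star_hom A \<pi> \<and> (\<forall>T\<in>A. clinear_op (\<pi> T)) \<and> inj_on \<pi> A"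

text \<open>A state is a positive linear functional of norm one.\<close>

definition is_state ::
  "('h::chilbert_space \<Rightarrow>\<^sub>L 'h) set \<Rightarrow> (('h \<Rightarrow>\<^sub>L 'h) \<Rightarrow> complex) \<Rightarrow> bool" where
  "is_state A \<rho> \<longleftrightarrow> clinear_on A \<rho> \<and>
     (\<forall>T\<in>A. \<rho> (adj T o\<^sub>L T) \<in> \<real>\<^sub>\<ge>\<^sub>0) \<and>
     (\<forall>T\<in>A. cmod (\<rho> T) \<le> norm T) \<and>
     (\<forall>K. (\<forall>T\<in>A. cmod (\<rho> T) \<le> K * norm T) \<longrightarrow> 1 \<le> K)"

section \<open>Linear disjointness from the Moebius function\<close>

definition moebius :: "nat \<Rightarrow> int" where
  "moebius n = (if squarefree n then (-1) ^ card (prime_factors n) else 0)"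

definition moebius_linearly_disjoint ::
  "('h::chilbert_space \<Rightarrow>\<^sub>L 'h) set \<Rightarrow> (('h \<Rightarrow>\<^sub>L 'h) \<Rightarrow> ('h \<Rightarrow>\<^sub>L 'h)) \<Rightarrow> bool" where
  "moebius_linearly_disjoint A \<alpha> \<longleftrightarrow>
     (\<forall>\<rho>. is_state A \<rho> \<longrightarrow> (\<forall>T\<in>A.
        (\<lambda>N. 1 / of_nat N * (\<Sum>n = 1..N. of_int (moebius n) * \<rho> ((\<alpha> ^^ n) T))) \<longlonglongrightarrow> 0))"

section \<open>Voiculescu--Brown entropy\<close>

text \<open>Positivity of the \<open>n \<times> n\<close> operator matrix \<open>X\<close> acting on the \<open>n\<close>-fold direct sum of the
  Hilbert space; for entries from a C*-algebra of operators this is positivity in the matrix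
  algebra over it.\<close>

definition positive_matrix :: "nat \<Rightarrow> (nat \<Rightarrow> nat \<Rightarrow> ('h::chilbert_space \<Rightarrow>\<^sub>L 'h)) \<Rightarrow> bool" where
  "positive_matrix n X \<longleftrightarrow>
     (\<forall>\<xi>. (\<Sum>i<n. \<Sum>j<n. cinner (\<xi> i) (blinfun_apply (X i j) (\<xi> j))) \<in> \<real>\<^sub>\<ge>\<^sub>0)"

definition completely_positive ::
  "('h::chilbert_space \<Rightarrow>\<^sub>L 'h) set \<Rightarrow> (('h \<Rightarrow>\<^sub>L 'h) \<Rightarrow> ('k::chilbert_space \<Rightarrow>\<^sub>L 'k)) \<Rightarrow> bool" where
  "completely_positive A \<phi> \<longleftrightarrow> clinear_on A \<phi> \<and>
     (\<forall>n X. (\<forall>i<n. \<forall>j<n. X i j \<in> A) \<and> positive_matrix n X \<longrightarrow>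
        positive_matrix n (\<lambda>i j. \<phi> (X i j)))"

definition ccp_map ::
  "('h::chilbert_space \<Rightarrow>\<^sub>L 'h) set \<Rightarrow> ('k::chilbert_space \<Rightarrow>\<^sub>L 'k) set \<Rightarrow>
    (('h \<Rightarrow>\<^sub>L 'h) \<Rightarrow> ('k \<Rightarrow>\<^sub>L 'k)) \<Rightarrow> bool" where
  "ccp_map A B \<phi> \<longleftrightarrow>
     completely_positive A \<phi> \<and> (\<forall>T\<in>A. \<phi> T \<in> B \<and> norm (\<phi> T) \<le> norm T)"

text \<open>Every finite-dimensional C*-algebra is isomorphic to an algebra of operators on
  \<open>\<ell>\<^sup>2(\<nat>)\<close>, so it is no restriction to let \<open>B\<close> range over such algebras only.\<close>

definition fin_dim_cstar_algebra :: "(nat ell2 \<Rightarrow>\<^sub>L nat ell2) set \<Rightarrow> bool" where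
  "fin_dim_cstar_algebra B \<longleftrightarrow> cstar_algebra B \<and> (\<exists>S. finite S \<and> B = cspan S)"

definition abelian_cstar_subalgebra ::
  "('h::chilbert_space \<Rightarrow>\<^sub>L 'h) set \<Rightarrow> ('h \<Rightarrow>\<^sub>L 'h) set \<Rightarrow> bool" where
  "abelian_cstar_subalgebra B D \<longleftrightarrow>
     cstar_algebra D \<and> D \<subseteq> B \<and> (\<forall>S\<in>D. \<forall>T\<in>D. S o\<^sub>L T = T o\<^sub>L S)"

definition maximal_abelian_cstar_subalgebra ::
  "('h::chilbert_space \<Rightarrow>\<^sub>L 'h) set \<Rightarrow> ('h \<Rightarrow>\<^sub>L 'h) set \<Rightarrow> bool" where
  "maximal_abelian_cstar_subalgebra B D \<longleftrightarrow> abelian_cstar_subalgebra B D \<and>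
     (\<forall>D'. abelian_cstar_subalgebra B D' \<and> D \<subseteq> D' \<longrightarrow> D' = D)"

text \<open>A relation rather than a function: the maximal abelian C*-subalgebras of a
  finite-dimensional C*-algebra all have the same dimension.\<close>

definition has_rank :: "(nat ell2 \<Rightarrow>\<^sub>L nat ell2) set \<Rightarrow> nat \<Rightarrow> bool" where
  "has_rank B r \<longleftrightarrow> (\<exists>D. maximal_abelian_cstar_subalgebra B D \<and> cdim D = r)"

definition CPA ::
  "('h::chilbert_space \<Rightarrow>\<^sub>L 'h) set \<Rightarrow> (('h \<Rightarrow>\<^sub>L 'h) \<Rightarrow> ('k::chilbert_space \<Rightarrow>\<^sub>L 'k)) \<Rightarrow>
    ('h \<Rightarrow>\<^sub>L 'h) set \<Rightarrow> real \<Rightarrow>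
    ((('h \<Rightarrow>\<^sub>L 'h) \<Rightarrow> (nat ell2 \<Rightarrow>\<^sub>L nat ell2)) \<times>
     ((nat ell2 \<Rightarrow>\<^sub>L nat ell2) \<Rightarrow> ('k \<Rightarrow>\<^sub>L 'k)) \<times> (nat ell2 \<Rightarrow>\<^sub>L nat ell2) set) set" where
  "CPA A \<pi> \<Omega> \<delta> = {(\<phi>, \<psi>, B).
     fin_dim_cstar_algebra B \<and> ccp_map A B \<phi> \<and> ccp_map B {T. clinear_op T} \<psi> \<and>
     (\<forall>a\<in>\<Omega>. norm (\<psi> (\<phi> a) - \<pi> a) < \<delta>)}"

text \<open>The value is \<open>\<infinity>\<close> when there is no approximation, as may happen if \<open>A\<close> is not exact.\<close>

definition rcp ::
  "('h::chilbert_space \<Rightarrow>\<^sub>L 'h) set \<Rightarrow> (('h \<Rightarrow>\<^sub>L 'h) \<Rightarrow> ('k::chilbert_space \<Rightarrow>\<^sub>L 'k)) \<Rightarrow>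
    ('h \<Rightarrow>\<^sub>L 'h) set \<Rightarrow> real \<Rightarrow> enat" where
  "rcp A \<pi> \<Omega> \<delta> = Inf {enat r | \<phi> \<psi> B r. (\<phi>, \<psi>, B) \<in> CPA A \<pi> \<Omega> \<delta> \<and> has_rank B r}"

definition log_enat :: "enat \<Rightarrow> ereal" where
  "log_enat r = (case r of enat n \<Rightarrow> if n = 0 then -\<infinity> else ereal (ln (real n)) | \<infinity> \<Rightarrow> \<infinity>)"

definition ht_fin_delta ::
  "('h::chilbert_space \<Rightarrow>\<^sub>L 'h) set \<Rightarrow> (('h \<Rightarrow>\<^sub>L 'h) \<Rightarrow> ('k::chilbert_space \<Rightarrow>\<^sub>L 'k)) \<Rightarrow>
    (('h \<Rightarrow>\<^sub>L 'h) \<Rightarrow> ('h \<Rightarrow>\<^sub>L 'h)) \<Rightarrow> ('h \<Rightarrow>\<^sub>L 'h) set \<Rightarrow> real \<Rightarrow> ereal" where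
  "ht_fin_delta A \<pi> \<alpha> \<Omega> \<delta> =
     limsup (\<lambda>n. ereal (1 / real n) * log_enat (rcp A \<pi> (\<Union>k<n. (\<alpha> ^^ k) ` \<Omega>) \<delta>))"

definition ht_fin ::
  "('h::chilbert_space \<Rightarrow>\<^sub>L 'h) set \<Rightarrow> (('h \<Rightarrow>\<^sub>L 'h) \<Rightarrow> ('k::chilbert_space \<Rightarrow>\<^sub>L 'k)) \<Rightarrow>
    (('h \<Rightarrow>\<^sub>L 'h) \<Rightarrow> ('h \<Rightarrow>\<^sub>L 'h)) \<Rightarrow> ('h \<Rightarrow>\<^sub>L 'h) set \<Rightarrow> ereal" where
  "ht_fin A \<pi> \<alpha> \<Omega> = (SUP \<delta>\<in>{0<..}. ht_fin_delta A \<pi> \<alpha> \<Omega> \<delta>)"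

definition ht_rep ::
  "('h::chilbert_space \<Rightarrow>\<^sub>L 'h) set \<Rightarrow> (('h \<Rightarrow>\<^sub>L 'h) \<Rightarrow> ('k::chilbert_space \<Rightarrow>\<^sub>L 'k)) \<Rightarrow>
    (('h \<Rightarrow>\<^sub>L 'h) \<Rightarrow> ('h \<Rightarrow>\<^sub>L 'h)) \<Rightarrow> ereal" where
  "ht_rep A \<pi> \<alpha> = (SUP \<Omega>\<in>{\<Omega>. finite \<Omega> \<and> \<Omega> \<subseteq> A}. ht_fin A \<pi> \<alpha> \<Omega>)"

text \<open>The entropy is independent of the faithful representation used to compute it; for a
  concrete C*-algebra we take the identity representation.\<close>

definition ht ::
  "('h::chilbert_space \<Rightarrow>\<^sub>L 'h) set \<Rightarrow> (('h \<Rightarrow>\<^sub>L 'h) \<Rightarrow> ('h \<Rightarrow>\<^sub>L 'h)) \<Rightarrow> ereal" where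
  "ht A \<alpha> = ht_rep A (\<lambda>T. T) \<alpha>"

lemma faithful_rep_identity: "cstar_algebra A \<Longrightarrow> faithful_rep A (\<lambda>T. T)"
  by (simp add: faithful_rep_def star_hom_def clinear_on_def cstar_algebra_def inj_on_def)

section \<open>Free groups\<close>

text \<open>The letter \<open>(a, True)\<close> is the generator \<open>a\<close> and \<open>(a, False)\<close> its inverse. Elements of the
  free group are the reduced words. The group operation is concatenation followed by
  cancellation; as the library's type class of not necessarily commutative groups is
  \<open>group_add\<close>, it is written additively.\<close>

definition inv_letter :: "'a \<times> bool \<Rightarrow> 'a \<times> bool" where
  "inv_letter l = (fst l, \<not> snd l)"

fun reduced_word :: "('a \<times> bool) list \<Rightarrow> bool" where
  "reduced_word (l # m # w) \<longleftrightarrow> m \<noteq> inv_letter l \<and> reduced_word (m # w)"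
| "reduced_word _ \<longleftrightarrow> True"

fun cons_red :: "'a \<times> bool \<Rightarrow> ('a \<times> bool) list \<Rightarrow> ('a \<times> bool) list" where
  "cons_red l [] = [l]"
| "cons_red l (m # w) = (if m = inv_letter l then w else l # m # w)"

abbreviation append_red :: "('a \<times> bool) list \<Rightarrow> ('a \<times> bool) list \<Rightarrow> ('a \<times> bool) list" where
  "append_red v w \<equiv> foldr cons_red v w"

abbreviation inv_word :: "('a \<times> bool) list \<Rightarrow> ('a \<times> bool) list" where
  "inv_word w \<equiv> rev (map inv_letter w)"

lemma inv_letter_inv_letter [simp]: "inv_letter (inv_letter l) = l"
  by (simp add: inv_letter_def)

lemma inv_letter_neq [simp]: "inv_letter l \<noteq> l" "l \<noteq> inv_letter l"
  by (cases l; simp add: inv_letter_def)+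

lemma reduced_ConsD: "reduced_word (l # w) \<Longrightarrow> reduced_word w"
  by (cases w) auto

lemma reduced_cons_red: "reduced_word w \<Longrightarrow> reduced_word (cons_red l w)"
  by (cases w) (auto dest: reduced_ConsD)

lemma reduced_append_red: "reduced_word w \<Longrightarrow> reduced_word (append_red v w)"
  by (induction v) (simp_all add: reduced_cons_red)

lemma cons_red_inverse: "reduced_word w \<Longrightarrow> cons_red (inv_letter l) (cons_red l w) = w"
  by (cases w rule: reduced_word.cases) auto

lemma cons_red_inverse': "reduced_word w \<Longrightarrow> cons_red l (cons_red (inv_letter l) w) = w"
  using cons_red_inverse [of w "inv_letter l"] by simp

lemma append_red_cons_red:
  "reduced_word w \<Longrightarrow> append_red (cons_red l v) w = cons_red l (append_red v w)"
  by (cases v) (auto simp: cons_red_inverse' reduced_append_red)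

lemma append_red_assoc:
  "reduced_word w \<Longrightarrow> append_red (append_red u v) w = append_red u (append_red v w)"
  by (induction u) (simp_all add: append_red_cons_red)

lemma append_red_Nil: "reduced_word w \<Longrightarrow> append_red w [] = w"
proof (induction w)
  case (Cons l w)
  then show ?case
    by (cases w) (auto dest: reduced_ConsD)
qed simp

lemma append_red_inverse: "reduced_word w \<Longrightarrow> append_red (inv_word v) (append_red v w) = w"
  by (induction v) (simp_all add: cons_red_inverse reduced_append_red)

lemma reduced_append_single:
  "reduced_word (w @ [l]) \<longleftrightarrow> reduced_word w \<and> (w = [] \<or> l \<noteq> inv_letter (last w))"
  by (induction w rule: reduced_word.induct) auto

lemma reduced_inv_word: "reduced_word w \<Longrightarrow> reduced_word (inv_word w)"
proof (induction w rule: reduced_word.induct)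
  case (1 l m w)
  then show ?case
    by (auto simp: reduced_append_single simp del: append_assoc)
qed simp_all

typedef 'a free_group = "{w :: ('a \<times> bool) list. reduced_word w}"
  by (rule exI [of _ "[]"]) simp

setup_lifting type_definition_free_group

instantiation free_group :: (type) group_add
begin
lift_definition zero_free_group :: "'a free_group" is "[]" by simp
lift_definition plus_free_group :: "'a free_group \<Rightarrow> 'a free_group \<Rightarrow> 'a free_group"
  is append_red by (rule reduced_append_red)
lift_definition uminus_free_group :: "'a free_group \<Rightarrow> 'a free_group"
  is inv_word by (rule reduced_inv_word)
definition minus_free_group :: "'a free_group \<Rightarrow> 'a free_group \<Rightarrow> 'a free_group" where
  "minus_free_group v w = v + - w"
instance
proof
  fix u v w :: "'a free_group"
  show "u + v + w = u + (v + w)"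
    by transfer (rule append_red_assoc)
  show "0 + w = w"
    by transfer simp
  show "w + 0 = w"
    by transfer (rule append_red_Nil)
  show "- w + w = 0"
  proof transfer
    fix w :: "('a \<times> bool) list" assume "reduced_word w"
    then show "append_red (inv_word w) w = []"
      using append_red_inverse [of "[]" w] by (simp add: append_red_Nil)
  qed
  show "v + - w = v - w"
    by (simp add: minus_free_group_def)
qed
end

lift_definition generator :: "'a \<Rightarrow> 'a free_group" is "\<lambda>a. [(a, True)]" by simp

section \<open>Reduced group C*-algebras\<close>

lift_definition translate_ell2 :: "'g::group_add \<Rightarrow> 'g ell2 \<Rightarrow> 'g ell2"
  is "\<lambda>s f x. f (- s + x)"
proof -
  fix s :: 'g and f :: "'g \<Rightarrow> complex"
  assume "(\<lambda>x. (cmod (f x))\<^sup>2) summable_on UNIV"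
  moreover have "bij_betw ((+) (- s)) UNIV UNIV"
    by (simp add: bij_plus)
  ultimately show "(\<lambda>x. (cmod (f (- s + x)))\<^sup>2) summable_on UNIV"
    using summable_on_reindex_bij_betw [of "(+) (- s)" UNIV UNIV "\<lambda>x. (cmod (f x))\<^sup>2"] by simp
qed

lemma norm_translate_ell2: "norm (translate_ell2 s f) = norm f"
proof -
  have "bij_betw ((+) (- s)) UNIV UNIV"
    by (simp add: bij_plus)
  then have "(norm (translate_ell2 s f))\<^sup>2 = (norm f)\<^sup>2"
    unfolding norm_ell2_square translate_ell2.rep_eq
    by (rule infsum_reindex_bij_betw)
  then show ?thesis
    by simp
qed

lift_definition left_regular :: "'g::group_add \<Rightarrow> ('g ell2 \<Rightarrow>\<^sub>L 'g ell2)" is translate_ell2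
proof (rule bounded_linear_intro [where K = 1])
  fix s :: 'g and f g :: "'g ell2" and r :: real
  show "translate_ell2 s (f + g) = translate_ell2 s f + translate_ell2 s g"
    by transfer simp
  show "translate_ell2 s (r *\<^sub>R f) = r *\<^sub>R translate_ell2 s f"
    by transfer simp
  show "norm (translate_ell2 s f) \<le> norm f * 1"
    by (simp add: norm_translate_ell2)
qed

definition reduced_group_cstar :: "('g::group_add ell2 \<Rightarrow>\<^sub>L 'g ell2) set" where
  "reduced_group_cstar = closure (cspan (range left_regular))"

end

theory Submission
  imports Defs "HOL-Complex_Analysis.Conformal_Mappings" "HOL-Number_Theory.Prime_Powers"
begin

text \<open>The automorphism \<open>\<alpha>\<close> permutes the group elements by the shift of the generators. It is
contractive, like every unital *-homomorphism, so all claims reduce by density to estimates for linear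
combinations of group elements.

Disjointness from the Moebius function has two sources. On the unit, which \<open>\<alpha>\<close> fixes, it says
that the mean of the Moebius function tends to \<open>0\<close> (\<open>moebius_mean_tendsto\<close>). This is the prime
number theorem in disguise, and it is obtained from the absence of zeros of zeta on the line \<open>Re s = 1\<close>
(\<open>reg_zeta_nonzero_on_line\<close>) by Newman's contour argument (\<open>newman_tauberian\<close>). For a reduced word
\<open>g\<close> other than the unit, the shifts of \<open>g\<close> have pairwise different first letters and pairwise different
last letters. Their translations therefore have nearly orthogonal ranges, and any combination of
\<open>N\<close> of them with coefficients bounded by \<open>1\<close> has norm at most \<open>2 sqrt N\<close>
(\<open>norm_sum_distinct_ends_le\<close>). The averages tend to \<open>0\<close> in norm, whatever the coefficients are.

For the entropy, finitely many words and their first \<open>n\<close> shifts involve a number of generators that is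
linear in \<open>n\<close>, while their lengths stay bounded by some \<open>L\<close>. The Cayley graph of a free group is a
tree. Cut it into blocks by descending along letters from this finite set of generators and cutting at
every \<open>N\<close>-th level. All blocks embed into the finite set of words of length less than \<open>N\<close>.
Compressing to this set and then repeating the resulting matrix in every block reproduces a word
except where it crosses a cut; averaged over the \<open>N\<close> possible positions of the cuts, the error
is at most \<open>L / N\<close> (\<open>free_group_block_approximation\<close>). With \<open>N\<close> fixed, the matrix size is a polynomial
in \<open>n\<close>, and its logarithm divided by \<open>n\<close> tends to \<open>0\<close>. The entropy is not negative, since the unit
cannot be approximated through the zero algebra.\<close>

section \<open>Dirichlet series and the Moebius function\<close>

lemma moebius_prime_mult:
  assumes "prime p" "\<not> p dvd d" "d > 0"
  shows "moebius (p * d) = - moebius d"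
proof -
  have co: "coprime p d" using assms by (simp add: prime_imp_coprime)
  have sq: "squarefree (p * d) \<longleftrightarrow> squarefree d"
    using squarefree_mult_coprime[OF co] squarefree_prime[OF assms(1)] squarefree_multD(2)
    by blast
  have "prime_factors (p * d) = insert p (prime_factors d)"
    using assms by (simp add: prime_factors_product prime_prime_factors)
  moreover have "p \<notin> prime_factors d" using assms by auto
  ultimately have "card (prime_factors (p * d)) = Suc (card (prime_factors d))"
    by simp
  then show ?thesis by (simp add: moebius_def sq)
qed

text \<open>Only squarefree divisors count. For a prime \<open>p\<close> dividing \<open>n\<close>, multiplication by \<open>p\<close> pairs the
squarefree divisors prime to \<open>p\<close> with those divisible by \<open>p\<close> and flips the sign.\<close>

lemma sum_moebius_divisors:
  assumes "n > 0"
  shows "(\<Sum>d | d dvd n. moebius d) = (if n = 1 then 1 else 0)"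
proof (cases "n = 1")
  case True
  then show ?thesis by (simp add: moebius_def)
next
  case False
  then obtain p where p: "prime p" "p dvd n"
    using prime_factor_nat by blast
  have fin: "finite {d. d dvd n}" using assms by simp
  let ?A = "{d. d dvd n \<and> squarefree d \<and> \<not> p dvd d}"
  let ?B = "{d. d dvd n \<and> squarefree d \<and> p dvd d}"
  have "(\<Sum>d | d dvd n. moebius d) = (\<Sum>d\<in>?A \<union> ?B. moebius d)"
    using fin by (intro sum.mono_neutral_right) (auto simp: moebius_def)
  also have "\<dots> = sum moebius ?A + sum moebius ?B"
    using fin by (intro sum.union_disjoint) auto
  also have "sum moebius ?B = (\<Sum>d\<in>?A. - moebius d)"
  proof (rule sum.reindex_bij_witness[where i = "\<lambda>d. p * d" and j = "\<lambda>d. d div p"])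
    fix d assume d: "d \<in> ?B"
    then obtain e where e: "d = p * e" by auto
    have sq: "squarefree d" using d by auto
    have npe: "\<not> p dvd e"
    proof
      assume "p dvd e"
      then have "p\<^sup>2 dvd d" using e by (simp add: power2_eq_square)
      with sq have "p dvd 1" by (rule squarefreeD)
      with p show False by simp
    qed
    have e0: "e > 0" using d e assms by (auto intro: Nat.gr0I)
    have p0: "p > 0" using p prime_gt_0_nat by blast
    show "p * (d div p) = d" using e p0 by simp
    show "d div p \<in> ?A"
      using d e npe p0 sq squarefree_multD(2) dvd_mult_right by fastforce
    show "- moebius (d div p) = moebius d"
      using moebius_prime_mult[OF p(1) npe e0] e p0 by simp
  next
    fix d assume d: "d \<in> ?A"
    have p0: "p > 0" using p prime_gt_0_nat by blast
    show "p * d div p = d" using p0 by simp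
    have co: "coprime p d" using d p by (simp add: prime_imp_coprime)
    have "p * d dvd n" using p d co by (simp add: divides_mult)
    moreover have "squarefree (p * d)"
      using squarefree_mult_coprime[OF co] squarefree_prime[OF p(1)] d by auto
    ultimately show "p * d \<in> ?B" by simp
  qed
  finally show ?thesis using False by (simp add: sum_negf)
qed

lemma abs_moebius_le_1: "\<bar>moebius n\<bar> \<le> 1"
  by (simp add: moebius_def)

lemma norm_of_nat_powr: "n > 0 \<Longrightarrow> norm ((of_nat n :: complex) powr s) = real n powr Re s"
  using norm_powr_real_powr[of "of_nat n" s] by simp

text \<open>Absolute convergence permits summing the product over all pairs \<open>(m, n)\<close> of positive integers
in any order; grouping the pairs by \<open>m * n\<close> gives the convolution. The term at \<open>0\<close> is harmless
because \<open>0 powr s = 0\<close>.\<close>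

lemma dirichlet_series_mult:
  fixes a b :: "nat \<Rightarrow> complex"
  assumes a: "summable (\<lambda>n. norm (a n * of_nat n powr s))"
    and b: "summable (\<lambda>n. norm (b n * of_nat n powr s))"
  shows "(\<lambda>n. (\<Sum>d | d dvd n. a d * b (n div d)) * of_nat n powr s) sums
    ((\<Sum>n. a n * of_nat n powr s) * (\<Sum>n. b n * of_nat n powr s))"
proof -
  let ?P = "{0<..} :: nat set"
  let ?u = "\<lambda>n. a n * of_nat n powr s" and ?v = "\<lambda>n. b n * of_nat n powr s"
  let ?f = "\<lambda>(m, n). ?u m * ?v n"
  let ?S = "\<lambda>n. {d. d dvd n} :: nat set"
  have pos: "(f has_sum x) UNIV \<longleftrightarrow> (f has_sum x) ?P" if "f 0 = 0" for f :: "nat \<Rightarrow> complex" and x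
    using that by (intro has_sum_cong_neutral) auto
  have U: "(?u has_sum suminf ?u) ?P"
    using norm_summable_imp_has_sum[OF a summable_sums[OF summable_norm_cancel[OF a]]]
    by (simp add: pos)
  have V: "(?v has_sum suminf ?v) ?P"
    using norm_summable_imp_has_sum[OF b summable_sums[OF summable_norm_cancel[OF b]]]
    by (simp add: pos)
  have absu: "(\<lambda>n. norm (?u n)) summable_on ?P" and absv: "(\<lambda>n. norm (?v n)) summable_on ?P"
    using norm_summable_imp_summable_on[of "\<lambda>n. norm (?u n)"] norm_summable_imp_summable_on[of "\<lambda>n. norm (?v n)"] a b
    by (auto intro: summable_on_subset_banach)
  have "(\<lambda>x. norm (?f x)) summable_on (?P \<times> ?P)"
  proof -
    have "(\<lambda>m. norm (?u m) * (\<Sum>\<^sub>\<infinity>n\<in>?P. norm (?v n))) summable_on ?P"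
      using absu by (rule summable_on_cmult_left)
    moreover have "norm (norm (?u m) * (\<Sum>\<^sub>\<infinity>n\<in>?P. norm (?v n)))
        = norm (?u m) * (\<Sum>\<^sub>\<infinity>n\<in>?P. norm (?v n))" for m
      by (simp add: infsum_nonneg)
    moreover have "(\<lambda>n. norm (?f (m, n))) summable_on ?P" for m
      using summable_on_cmult_right[OF absv, of "norm (?u m)"] by (simp add: norm_mult mult.assoc)
    ultimately show ?thesis
      unfolding Infinite_Sum.abs_summable_on_Sigma_iff
      by (simp only: prod.case norm_mult[of "?u _" "?v _"] infsum_cmult_right') simp
  qed
  then have sf: "?f summable_on (?P \<times> ?P)"
    by (rule Infinite_Sum.abs_summable_summable)
  have F: "(?f has_sum (suminf ?u * suminf ?v)) (?P \<times> ?P)"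
    by (rule has_sum_SigmaI[where g = "\<lambda>m. ?u m * suminf ?v"])
      (use U V sf in \<open>auto intro!: has_sum_cmult_left has_sum_cmult_right\<close>)
  let ?g = "\<lambda>(n, d). a d * b (n div d) * of_nat n powr s"
  have G: "(?g has_sum (suminf ?u * suminf ?v)) (Sigma ?P ?S)"
  proof -
    have "(?g has_sum (suminf ?u * suminf ?v)) (Sigma ?P ?S) \<longleftrightarrow>
          (?f has_sum (suminf ?u * suminf ?v)) (?P \<times> ?P)"
    proof (rule has_sum_reindex_bij_witness[where j = "\<lambda>(n, d). (d, n div d)" and i = "\<lambda>(m, n). (m * n, m)"])
      fix x assume "x \<in> Sigma ?P ?S"
      then obtain n d where x: "x = (n, d)" "n > 0" "d dvd n" by auto
      then obtain e where e: "n = d * e" by blast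
      then have de: "d > 0" "e > 0" using x by auto
      show "(case case x of (n, d) \<Rightarrow> (d, n div d) of (m, n) \<Rightarrow> (m * n, m)) = x"
        using x by simp
      show "(case x of (n, d) \<Rightarrow> (d, n div d)) \<in> ?P \<times> ?P" using x e de by simp
      show "?f (case x of (n, d) \<Rightarrow> (d, n div d)) = ?g x"
        using x e de by (simp add: powr_times_real)
    qed auto
    then show ?thesis using F by simp
  qed
  have "((\<lambda>n. (\<Sum>d\<in>?S n. a d * b (n div d)) * of_nat n powr s) has_sum (suminf ?u * suminf ?v)) ?P"
  proof (rule has_sum_SigmaD[OF G])
    fix n :: nat assume "n \<in> ?P"
    then have "finite (?S n)" by simp
    then show "((\<lambda>d. ?g (n, d)) has_sum (\<Sum>d\<in>?S n. a d * b (n div d)) * of_nat n powr s) (?S n)"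
      by (simp add: sum_distrib_right has_sum_finite)
  qed
  then show ?thesis
    by (intro has_sum_imp_sums) (simp add: pos)
qed

section \<open>The function \<open>(s - 1) \<zeta>(s)\<close> and its zeros\<close>

lemma norm_nat_powr_minus: "norm ((of_nat n :: complex) powr (- s)) = real n powr (- Re s)"
  using norm_powr_real_powr[of "of_nat n" "- s"] by (cases "n = 0") auto

lemma summable_nat_powr_minus:
  assumes "Re s > 1"
  shows "summable (\<lambda>n. norm ((of_nat n :: complex) powr (- s)))"
  using assms unfolding norm_nat_powr_minus summable_real_powr_iff by simp

text \<open>The logarithm is bounded by a multiple of \<open>n powr e\<close> with \<open>e\<close> half the distance of \<open>c\<close> from \<open>1\<close>.\<close>

lemma summable_ln_nat_powr_minus:
  assumes "c > 1"
  shows "summable (\<lambda>n. ln (real n) * real n powr (- c))"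
proof (rule summable_comparison_test_ev)
  define e where "e = (c - 1) / 2"
  have e: "e > 0" using assms by (simp add: e_def)
  show "\<forall>\<^sub>F n in sequentially. norm (ln (real n) * real n powr (- c)) \<le> real n powr (e - c) / e"
    using eventually_gt_at_top[of 0]
  proof eventually_elim
    case (elim n)
    have "ln (real n) \<le> real n powr e / e"
      using elim e by (intro ln_powr_bound) auto
    then have "ln (real n) * real n powr (- c) \<le> real n powr e / e * real n powr (- c)"
      by (intro mult_right_mono) auto
    also have "\<dots> = real n powr (e - c) / e"
      by (simp add: powr_diff powr_minus divide_simps)
    finally show ?case using elim by (simp add: abs_mult)
  qed
  show "summable (\<lambda>n. real n powr (e - c) / e)"
    using assms by (intro summable_divide) (simp add: summable_real_powr_iff e_def field_simps)
qed

text \<open>This is \<open>s - 1\<close> times the error made when \<open>n powr (- s)\<close> is replaced by its integral over the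
interval from \<open>n\<close> to \<open>n + 1\<close>.\<close>

definition zeta_corr :: "nat \<Rightarrow> complex \<Rightarrow> complex" where
  "zeta_corr n s = (s - 1) * of_nat n powr (- s) - of_nat n powr (1 - s) + of_nat (Suc n) powr (1 - s)"

text \<open>The value is \<open>(s - 1) \<zeta>(s)\<close>. Comparing the sum with the integral subtracts the pole of zeta, and
the series of errors still converges for \<open>Re s > 0\<close>, which is enough to reach a neighbourhood of the
line \<open>Re s = 1\<close>.\<close>

definition reg_zeta :: "complex \<Rightarrow> complex" where
  "reg_zeta s = 1 + (\<Sum>n. zeta_corr (Suc n) s)"

text \<open>The correction is the remainder of the first-order Taylor expansion of \<open>x powr (1 - s)\<close> at \<open>n\<close>,
evaluated at \<open>n + 1\<close>. This gains one power of \<open>n\<close> over the terms of the zeta series.\<close>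

lemma norm_zeta_corr_le:
  assumes n: "n > 0" and s: "Re s > - 1"
  shows "norm (zeta_corr n s) \<le> norm (1 - s) * norm s * real n powr (- 1 - Re s)"
proof -
  define S where "S = closed_segment (of_nat n) (of_nat n + 1 :: complex)"
  have S: "\<exists>t. x = of_real t \<and> real n \<le> t" if x: "x \<in> S" for x
  proof -
    obtain u where u: "0 \<le> u" "u \<le> 1" "x = (1 - u) *\<^sub>R of_nat n + u *\<^sub>R (of_nat n + 1)"
      using x unfolding S_def in_segment by blast
    then have "x = of_real (real n + u)"
      by (simp add: scaleR_conv_of_real algebra_simps)
    then show ?thesis using u(1) by (intro exI[of _ "real n + u"] conjI) auto
  qed
  define f :: "nat \<Rightarrow> complex \<Rightarrow> complex" where
    "f i x = (if i = 0 then x powr (1 - s) else if i = 1 then (1 - s) * x powr (- s)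
              else (1 - s) * (- s) * x powr (- s - 1))" for i x
  have "norm (f 0 (of_nat n + 1) - (\<Sum>i\<le>1. f i (of_nat n) * ((of_nat n + 1) - of_nat n) ^ i / fact i))
      \<le> (norm (1 - s) * norm s * real n powr (- 1 - Re s)) * norm ((of_nat n + 1) - (of_nat n :: complex)) ^ Suc 1 / fact 1"
  proof (rule complex_Taylor[where S = S])
    fix i :: nat and x assume x: "x \<in> S" and i: "i \<le> 1"
    then obtain t where t: "x = of_real t" "real n \<le> t" using S by blast
    then have nr: "x \<notin> \<real>\<^sub>\<le>\<^sub>0" using n by auto
    show "(f i has_field_derivative f (Suc i) x) (at x within S)"
    proof (cases "i = 0")
      case True
      have "((\<lambda>x. x powr (1 - s)) has_field_derivative (1 - s) * x powr (- s)) (at x within S)"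
        using nr by (auto intro!: derivative_eq_intros)
      then show ?thesis using True unfolding f_def by simp
    next
      case False
      then have "i = 1" using i by simp
      moreover have "((\<lambda>x. (1 - s) * x powr (- s)) has_field_derivative (1 - s) * (- s) * x powr (- s - 1)) (at x within S)"
        using nr by (auto intro!: derivative_eq_intros)
      ultimately show ?thesis unfolding f_def by simp
    qed
  next
    fix x assume x: "x \<in> S"
    then obtain t where t: "x = of_real t" "real n \<le> t" using S by blast
    have "norm (x powr (- s - 1)) = t powr (- Re s - 1)"
      using t n norm_powr_real_powr[of x "- s - 1"] by simp
    also have "\<dots> \<le> real n powr (- Re s - 1)"
      using t n s by (intro powr_mono2') auto
    finally have "norm (1 - s) * norm s * norm (x powr (- s - 1)) \<le> norm (1 - s) * norm s * real n powr (- Re s - 1)"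
      by (intro mult_left_mono) auto
    moreover have "- Re s - 1 = - 1 - Re s" by simp
    ultimately show "norm (f (Suc 1) x) \<le> norm (1 - s) * norm s * real n powr (- 1 - Re s)"
      unfolding f_def by (simp add: norm_mult)
  qed (simp_all add: S_def)
  also have "f 0 (of_nat n + 1) - (\<Sum>i\<le>1. f i (of_nat n) * ((of_nat n + 1) - of_nat n) ^ i / fact i) = zeta_corr n s"
    by (simp add: f_def zeta_corr_def add.commute algebra_simps)
  finally show ?thesis by simp
qed

lemma holomorphic_reg_zeta: "reg_zeta holomorphic_on {s. Re s > 0}"
proof (rule holomorphic_uniform_sequence)
  show "open {s. Re s > 0}" by (rule open_halfspace_Re_gt)
  show "(\<lambda>s. 1 + (\<Sum>i<n. zeta_corr (Suc i) s)) holomorphic_on {s. Re s > 0}" for n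
    unfolding zeta_corr_def by (intro holomorphic_intros)
  fix x :: complex assume x: "x \<in> {s. Re s > 0}"
  define d where "d = Re x / 2"
  have d: "d > 0" using x by (simp add: d_def)
  have re: "Re y \<ge> d" if "y \<in> cball x d" for y
  proof -
    have "\<bar>Re x - Re y\<bar> \<le> d" using that abs_Re_le_cmod[of "x - y"] by (simp add: dist_norm)
    then show ?thesis unfolding d_def by linarith
  qed
  define K where "K = norm x + d"
  have K: "K \<ge> 0" using d by (simp add: K_def)
  have nrm: "norm y \<le> K" if "y \<in> cball x d" for y
    using that norm_triangle_ineq2[of y x] by (simp add: dist_norm norm_minus_commute K_def)
  have "uniform_limit (cball x d) (\<lambda>n y. \<Sum>i<n. zeta_corr (Suc i) y) (\<lambda>y. \<Sum>i. zeta_corr (Suc i) y) sequentially"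
  proof (rule Weierstrass_m_test)
    fix n y assume y: "y \<in> cball x d"
    have "norm (1 - y) \<le> 1 + K" using nrm[OF y] norm_triangle_ineq4[of 1 y] by simp
    moreover have "real (Suc n) powr (- 1 - Re y) \<le> real (Suc n) powr (- 1 - d)"
      using re[OF y] by (intro powr_mono) auto
    ultimately have "norm (1 - y) * norm y * real (Suc n) powr (- 1 - Re y) \<le> (1 + K) * K * real (Suc n) powr (- 1 - d)"
      using nrm[OF y] K by (intro mult_mono) auto
    then show "norm (zeta_corr (Suc n) y) \<le> (1 + K) * K * real (Suc n) powr (- 1 - d)"
      using norm_zeta_corr_le[of "Suc n" y] re[OF y] d by linarith
  next
    have "summable (\<lambda>n. real n powr (- 1 - d))" using d by (simp add: summable_real_powr_iff)
    then have "summable (\<lambda>n. real (Suc n) powr (- 1 - d))" by (rule summable_ignore_initial_segment[of _ 1, simplified])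
    then show "summable (\<lambda>n. (1 + K) * K * real (Suc n) powr (- 1 - d))" by (rule summable_mult)
  qed
  then have "uniform_limit (cball x d) (\<lambda>n y. 1 + (\<Sum>i<n. zeta_corr (Suc i) y)) reg_zeta sequentially"
    unfolding reg_zeta_def by (intro uniform_limit_intros)
  moreover have "cball x d \<subseteq> {s. Re s > 0}" using re d by force
  ultimately show "\<exists>d>0. cball x d \<subseteq> {s. Re s > 0} \<and>
      uniform_limit (cball x d) (\<lambda>n s. 1 + (\<Sum>i<n. zeta_corr (Suc i) s)) reg_zeta sequentially"
    using d by blast
qed

lemma reg_zeta_1: "reg_zeta 1 = 1"
proof -
  have "zeta_corr (Suc n) 1 = 0" for n
    unfolding zeta_corr_def by (simp del: of_nat_Suc)
  then show ?thesis by (simp add: reg_zeta_def)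
qed

lemma reg_zeta_eq:
  assumes s: "Re s > 1"
  shows "reg_zeta s = (s - 1) * (\<Sum>n. of_nat n powr (- s))"
proof -
  have sm: "summable (\<lambda>n. (of_nat n :: complex) powr (- s))"
    using summable_nat_powr_minus[OF s] by (rule summable_norm_cancel)
  then have "(\<lambda>n. (of_nat (Suc n) :: complex) powr (- s)) sums ((\<Sum>n. of_nat n powr (- s)) - of_nat 0 powr (- s))"
    by (subst sums_Suc_iff) (simp add: summable_sums)
  then have 1: "(\<lambda>n. (s - 1) * (of_nat (Suc n) :: complex) powr (- s)) sums ((s - 1) * (\<Sum>n. of_nat n powr (- s)))"
    by (intro sums_mult) simp
  have "(\<lambda>n. (of_nat n :: complex) powr (1 - s)) \<longlonglongrightarrow> 0"
  proof (rule tendsto_norm_zero_cancel)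
    have "(\<lambda>n. real n powr (- (Re s - 1))) \<longlonglongrightarrow> 0"
      using s by (intro tendsto_neg_powr filterlim_real_sequentially) auto
    then show "(\<lambda>n. norm ((of_nat n :: complex) powr (1 - s))) \<longlonglongrightarrow> 0"
      using norm_nat_powr_minus[of _ "s - 1"] by simp
  qed
  then have "(\<lambda>n. (of_nat (Suc n) :: complex) powr (1 - s)) \<longlonglongrightarrow> 0"
    by (rule LIMSEQ_Suc)
  from telescope_sums[OF this]
  have 2: "(\<lambda>n. of_nat (Suc (Suc n)) powr (1 - s) - (of_nat (Suc n) :: complex) powr (1 - s)) sums (0 - 1)"
    by simp
  have "(\<lambda>n. zeta_corr (Suc n) s) sums ((s - 1) * (\<Sum>n. of_nat n powr (- s)) + (0 - 1))"
    using sums_add[OF 1 2] by (simp add: zeta_corr_def algebra_simps)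
  then show ?thesis
    by (simp add: reg_zeta_def sums_iff)
qed

text \<open>The Dirichlet convolution of the Moebius function with the constant \<open>1\<close> is the indicator of \<open>1\<close>,
so the Moebius series is the inverse of the zeta function.\<close>

lemma reg_zeta_mult_moebius:
  assumes s: "Re s > 1"
  shows "reg_zeta s * (\<Sum>n. of_int (moebius n) * of_nat n powr (- s)) = s - 1"
proof -
  have 1: "summable (\<lambda>n. norm (of_int (moebius n) * (of_nat n :: complex) powr (- s)))"
  proof (rule summable_comparison_test'[OF summable_nat_powr_minus[OF s]])
    show "norm (norm (of_int (moebius n) * (of_nat n :: complex) powr (- s))) \<le> norm ((of_nat n :: complex) powr (- s))" for n
    proof -
      have "real_of_int \<bar>moebius n\<bar> \<le> 1" using abs_moebius_le_1[of n] by linarith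
      then show ?thesis by (simp add: norm_mult mult_left_le_one_le)
    qed
  qed
  have 2: "summable (\<lambda>n. norm ((1 :: complex) * (of_nat n :: complex) powr (- s)))"
    using summable_nat_powr_minus[OF s] by simp
  have eq: "(\<Sum>d | d dvd n. of_int (moebius d) * (1 :: complex)) * of_nat n powr (- s) = (if n = 1 then 1 else 0)" for n
  proof (cases "n = 0")
    case False
    have "(\<Sum>d | d dvd n. of_int (moebius d) * (1 :: complex)) = of_int (\<Sum>d | d dvd n. moebius d)" by simp
    also have "\<dots> = (if n = 1 then 1 else 0)" using False by (simp add: sum_moebius_divisors)
    finally show ?thesis by simp
  qed simp
  have "(\<lambda>n. if n = 1 then 1 else 0 :: complex) sums
      ((\<Sum>n. of_int (moebius n) * of_nat n powr (- s)) * (\<Sum>n. of_nat n powr (- s)))"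
    using dirichlet_series_mult[OF 1 2] unfolding eq by simp
  moreover have "(\<lambda>n. if n = 1 then 1 else 0 :: complex) sums 1"
    using sums_single[of 1 "\<lambda>_. 1 :: complex"] by simp
  ultimately have "(\<Sum>n. of_int (moebius n) * of_nat n powr (- s)) * (\<Sum>n. of_nat n powr (- s)) = (1 :: complex)"
    using sums_unique2 by blast
  then show ?thesis unfolding reg_zeta_eq[OF s]
    by (metis (no_types, lifting) mult.assoc mult.commute mult_1)
qed

lemma reg_zeta_nonzero: "Re s > 1 \<Longrightarrow> reg_zeta s \<noteq> 0"
  using reg_zeta_mult_moebius[of s] by auto

text \<open>The limit is the order \<open>k\<close> of the zero of \<open>f\<close> at \<open>\<xi>\<close>: writing \<open>f w = (w - \<xi>) ^ k * g w\<close> with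
\<open>g\<close> nonvanishing near \<open>\<xi>\<close>, the logarithmic derivative is \<open>k / (w - \<xi>)\<close> plus a bounded term.\<close>

lemma logarithmic_residue:
  fixes f :: "complex \<Rightarrow> complex"
  assumes hol: "f holomorphic_on S" and S: "open S" "connected S" "\<xi> \<in> S"
    and nz: "a \<in> S" "f a \<noteq> 0"
  obtains k :: nat where "((\<lambda>w. (w - \<xi>) * (deriv f w / f w)) \<longlongrightarrow> of_nat k) (at \<xi>)"
    "k = 0 \<Longrightarrow> f \<xi> \<noteq> 0"
proof (cases "f \<xi> = 0")
  case False
  have "isCont f \<xi>" "isCont (deriv f) \<xi>"
    using hol S holomorphic_deriv[OF hol S(1)]
    by (meson continuous_on_eq_continuous_at holomorphic_on_imp_continuous_on)+
  then have "((\<lambda>w. (w - \<xi>) * (deriv f w / f w)) \<longlongrightarrow> (\<xi> - \<xi>) * (deriv f \<xi> / f \<xi>)) (at \<xi>)"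
    using False by (intro tendsto_intros) (auto simp: isCont_def)
  then show ?thesis using that[of 0] False by simp
next
  case True
  have nc: "\<not> f constant_on S"
    using True nz S(3) unfolding constant_on_def by metis
  obtain g r n where n: "0 < n" and r: "0 < r" "ball \<xi> r \<subseteq> S"
    and g: "g holomorphic_on ball \<xi> r"
    and fg: "\<And>w. w \<in> ball \<xi> r \<Longrightarrow> f w = (w - \<xi>) ^ n * g w"
    and gnz: "\<And>w. w \<in> ball \<xi> r \<Longrightarrow> g w \<noteq> 0"
    by (rule holomorphic_factor_zero_nonconstant[OF hol S True nc]) (rule that)
  have \<xi>: "\<xi> \<in> ball \<xi> r" using r by simp
  have eq: "of_nat n + (w - \<xi>) * (deriv g w / g w) = (w - \<xi>) * (deriv f w / f w)"
    if w: "w \<in> ball \<xi> r - {\<xi>}" for w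
  proof -
    have dg: "(g has_field_derivative deriv g w) (at w)"
      using g w by (auto intro: holomorphic_derivI)
    have "((\<lambda>w. (w - \<xi>) ^ n * g w) has_field_derivative
        of_nat n * (w - \<xi>) ^ (n - 1) * g w + (w - \<xi>) ^ n * deriv g w) (at w)"
      by (auto intro!: derivative_eq_intros dg)
    then have "(f has_field_derivative
        of_nat n * (w - \<xi>) ^ (n - 1) * g w + (w - \<xi>) ^ n * deriv g w) (at w)"
      by (rule has_field_derivative_transform_within_open[where S = "ball \<xi> r"]) (use w fg in auto)
    then have d: "deriv f w = of_nat n * (w - \<xi>) ^ (n - 1) * g w + (w - \<xi>) ^ n * deriv g w"
      by (rule DERIV_imp_deriv)
    obtain m where m: "n = Suc m" using n by (cases n) auto
    have "w - \<xi> \<noteq> 0" "g w \<noteq> 0" using w gnz by auto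
    then show ?thesis
      using w unfolding d fg[of w, OF DiffD1[OF w]] m
      by (simp add: divide_simps) (simp add: algebra_simps)
  qed
  have "isCont g \<xi>" "isCont (deriv g) \<xi>"
    using g r \<xi> holomorphic_deriv[OF g]
    by (meson continuous_on_eq_continuous_at holomorphic_on_imp_continuous_on open_ball)+
  then have "((\<lambda>w. of_nat n + (w - \<xi>) * (deriv g w / g w)) \<longlongrightarrow> of_nat n + (\<xi> - \<xi>) * (deriv g \<xi> / g \<xi>)) (at \<xi>)"
    using gnz[OF \<xi>] by (intro tendsto_intros) (auto simp: isCont_def)
  then have "((\<lambda>w. (w - \<xi>) * (deriv f w / f w)) \<longlongrightarrow> of_nat n + (\<xi> - \<xi>) * (deriv g \<xi> / g \<xi>)) (at \<xi>)"
  proof (rule Lim_transform_eventually)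
    have "eventually (\<lambda>w. w \<in> ball \<xi> r - {\<xi>}) (at \<xi>)"
      using r by (intro eventually_at_in_open) auto
    then show "\<forall>\<^sub>F w in at \<xi>. of_nat n + (w - \<xi>) * (deriv g w / g w) = (w - \<xi>) * (deriv f w / f w)"
      by eventually_elim (rule eq)
  qed
  then show ?thesis using that[of n] n by simp
qed

lemma summable_mangoldt_nat_powr:
  assumes "Re s > 1"
  shows "summable (\<lambda>n. norm (mangoldt n * (of_nat n :: complex) powr (- s)))"
proof (rule summable_comparison_test'[OF summable_ln_nat_powr_minus[OF assms]])
  fix n :: nat assume "n \<ge> 1"
  then have "mangoldt n \<le> ln (real n)" by (intro mangoldt_le) auto
  then show "norm (norm (mangoldt n * (of_nat n :: complex) powr (- s))) \<le> ln (real n) * real n powr (- Re s)"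
    by (simp add: norm_mult norm_nat_powr_minus mult_right_mono abs_mult mangoldt_nonneg)
qed

text \<open>The convolution of the von Mangoldt function with \<open>1\<close> is the logarithm, and the Dirichlet series
of the logarithm is minus the derivative of the zeta series. Hence the von Mangoldt series is the
negative logarithmic derivative of zeta, written here without denominators.\<close>

lemma mangoldt_series_reg_zeta:
  assumes s: "Re s > 1"
  shows "(s - 1) * (\<Sum>n. mangoldt n * of_nat n powr (- s)) * reg_zeta s
    = reg_zeta s - (s - 1) * deriv reg_zeta s"
proof -
  define c where "c = (1 + Re s) / 2"
  have c: "c > 1" "c < Re s" using s by (auto simp: c_def field_simps)
  let ?S = "{s. Re s \<ge> c}"
  let ?D = "\<Sum>n. ln (real n) * of_nat n powr (- s)"
  have int: "s \<in> interior ?S"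
    using c interior_maximal[of "{s. Re s > c}" ?S] open_halfspace_Re_gt[of c] by fastforce
  have "((\<lambda>x. \<Sum>n. of_nat n powr (- x)) has_field_derivative
      (\<Sum>n. - (ln (real n) * of_nat n powr (- s)))) (at s)"
  proof (rule has_field_derivative_series'(2)[where S = ?S and ?x0.0 = s])
    show "convex ?S" by (rule convex_halfspace_Re_ge)
    fix n :: nat and x :: complex assume "x \<in> ?S"
    show "((\<lambda>x. of_nat n powr (- x)) has_field_derivative - (ln (real n) * of_nat n powr (- x))) (at x within ?S)"
    proof (cases "n = 0")
      case False
      then have ln: "Ln (of_nat n) = of_real (ln (real n))" using Ln_of_real[of "real n"] by simp
      have "((\<lambda>x. of_nat n powr (- x)) has_field_derivative (Ln (of_nat n) * of_nat n powr (- x)) * (- 1)) (at x within ?S)"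
        by (rule DERIV_chain'[where g = "\<lambda>x. of_nat n powr x"])
          (use False in \<open>auto intro!: derivative_eq_intros has_field_derivative_powr_right\<close>)
      then show ?thesis unfolding ln by simp
    qed simp
  next
    show "uniformly_convergent_on ?S (\<lambda>n x. \<Sum>i<n. - (ln (real i) * of_nat i powr (- x)))"
    proof (rule Weierstrass_m_test'[OF _ summable_ln_nat_powr_minus[OF c(1)]])
      fix n :: nat and x :: complex assume x: "x \<in> ?S"
      show "norm (- (ln (real n) * of_nat n powr (- x))) \<le> ln (real n) * real n powr (- c)"
      proof (cases "n = 0")
        case False
        then have "real n powr (- Re x) \<le> real n powr (- c)" using x by (intro powr_mono) auto
        then show ?thesis using False by (simp add: norm_mult norm_nat_powr_minus mult_left_mono)
      qed simp
    qed
    show "summable (\<lambda>n. (of_nat n :: complex) powr (- s))"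
      using summable_nat_powr_minus[OF s] by (rule summable_norm_cancel)
    show "s \<in> ?S" using c by simp
  qed (rule int)
  moreover have sD: "summable (\<lambda>n. ln (real n) * (of_nat n :: complex) powr (- s))"
  proof (rule summable_norm_cancel, rule summable_comparison_test'[OF summable_ln_nat_powr_minus[OF s]])
    fix n :: nat assume "n \<ge> 1"
    then show "norm (norm (ln (real n) * (of_nat n :: complex) powr (- s))) \<le> ln (real n) * real n powr (- Re s)"
      by (simp add: norm_mult norm_nat_powr_minus)
  qed
  ultimately have "((\<lambda>x. \<Sum>n. of_nat n powr (- x)) has_field_derivative - ?D) (at s)"
    by (simp add: suminf_minus)
  then have "((\<lambda>x. (x - 1) * (\<Sum>n. of_nat n powr (- x))) has_field_derivative
      (\<Sum>n. of_nat n powr (- s)) - (s - 1) * ?D) (at s)"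
    by (auto intro!: derivative_eq_intros)
  then have "(reg_zeta has_field_derivative (\<Sum>n. of_nat n powr (- s)) - (s - 1) * ?D) (at s)"
    by (rule has_field_derivative_transform_within_open[where S = "{s. Re s > 1}"])
      (use s in \<open>auto simp: reg_zeta_eq open_halfspace_Re_gt\<close>)
  then have d: "deriv reg_zeta s = (\<Sum>n. of_nat n powr (- s)) - (s - 1) * ?D"
    by (rule DERIV_imp_deriv)
  have "summable (\<lambda>n. norm ((1 :: complex) * (of_nat n :: complex) powr (- s)))"
    using summable_nat_powr_minus[OF s] by simp
  from dirichlet_series_mult[OF summable_mangoldt_nat_powr[OF s] this]
  have "(\<lambda>n. (\<Sum>d | d dvd n. mangoldt d :: complex) * of_nat n powr (- s)) sums
      ((\<Sum>n. mangoldt n * of_nat n powr (- s)) * (\<Sum>n. of_nat n powr (- s)))"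
    by simp
  also have "(\<lambda>n. (\<Sum>d | d dvd n. mangoldt d :: complex) * of_nat n powr (- s)) =
      (\<lambda>n. ln (real n) * of_nat n powr (- s))"
  proof
    fix n show "(\<Sum>d | d dvd n. mangoldt d :: complex) * of_nat n powr (- s) = ln (real n) * of_nat n powr (- s)"
      by (cases "n = 0") (simp_all add: mangoldt_sum)
  qed
  finally have "?D = (\<Sum>n. mangoldt n * of_nat n powr (- s)) * (\<Sum>n. of_nat n powr (- s))"
    by (simp add: sums_iff)
  then show ?thesis
    unfolding d reg_zeta_eq[OF s] by (simp add: algebra_simps)
qed

text \<open>The von Mangoldt function is nonnegative, and \<open>3 + 4 cos x + cos (2 x) = 2 (1 + cos x)\<^sup>2\<close> is
nonnegative for every real \<open>x\<close>; apply this to each term with \<open>x = t ln n\<close>.\<close>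

lemma mertens_inequality:
  assumes \<sigma>: "\<sigma> > 1"
  defines "L \<equiv> \<lambda>s. \<Sum>n. mangoldt n * (of_nat n :: complex) powr (- s)"
  shows "0 \<le> Re (3 * L (of_real \<sigma>) + 4 * L (Complex \<sigma> t) + L (Complex \<sigma> (2 * t)))"
proof -
  have sm: "(\<lambda>n. mangoldt n * (of_nat n :: complex) powr (- Complex \<sigma> u)) sums L (Complex \<sigma> u)" for u
    unfolding L_def using \<sigma>
    by (intro summable_sums summable_norm_cancel[OF summable_mangoldt_nat_powr]) simp
  have sr: "(\<lambda>n. mangoldt n * (real n powr (- \<sigma>) * cos (u * ln (real n)))) sums Re (L (Complex \<sigma> u))" for u
  proof -
    have eq: "Re (mangoldt n * (of_nat n :: complex) powr (- Complex \<sigma> u)) = mangoldt n * (real n powr (- \<sigma>) * cos (u * ln (real n)))" for n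
    proof (cases "n = 0")
      case False
      then have "Ln (of_nat n) = of_real (ln (real n))" using Ln_of_real[of "real n"] by simp
      then have "Re ((of_nat n :: complex) powr (- Complex \<sigma> u)) = real n powr (- \<sigma>) * cos (u * ln (real n))"
        using False by (simp add: powr_def Re_exp)
      then show ?thesis by simp
    qed simp
    show ?thesis using sums_Re[OF sm[of u]] unfolding eq .
  qed
  have "(\<lambda>n. 3 * (mangoldt n * (real n powr (- \<sigma>) * cos (0 * ln (real n))))
      + 4 * (mangoldt n * (real n powr (- \<sigma>) * cos (t * ln (real n))))
      + mangoldt n * (real n powr (- \<sigma>) * cos (2 * t * ln (real n)))) sums
      (3 * Re (L (Complex \<sigma> 0)) + 4 * Re (L (Complex \<sigma> t)) + Re (L (Complex \<sigma> (2 * t))))"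
    by (intro sums_add sums_mult sr)
  then have "0 \<le> 3 * Re (L (Complex \<sigma> 0)) + 4 * Re (L (Complex \<sigma> t)) + Re (L (Complex \<sigma> (2 * t)))"
  proof (rule sums_le[OF _ sums_zero, rotated])
    fix n
    define x where "x = t * ln (real n)"
    have "cos (2 * x) = 2 * (cos x)\<^sup>2 - 1" by (rule cos_double_cos)
    then have "3 + 4 * cos x + cos (2 * x) = 2 * (1 + cos x)\<^sup>2"
      by (simp add: power2_eq_square algebra_simps)
    then have "0 \<le> mangoldt n * real n powr (- \<sigma>) * (3 + 4 * cos x + cos (2 * x))"
      by (simp add: mangoldt_nonneg)
    then show "0 \<le> 3 * (mangoldt n * (real n powr (- \<sigma>) * cos (0 * ln (real n))))
      + 4 * (mangoldt n * (real n powr (- \<sigma>) * cos (t * ln (real n))))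
      + mangoldt n * (real n powr (- \<sigma>) * cos (2 * t * ln (real n)))"
      by (simp add: x_def algebra_simps)
  qed
  then show ?thesis
    by (simp add: complex_of_real_def)
qed

text \<open>Multiply the inequality of Mertens by \<open>e\<close> at \<open>\<sigma> = 1 + e\<close> and let \<open>e\<close> tend to \<open>0\<close>. The pole at \<open>1\<close>
contributes \<open>3\<close>, while zeros of orders \<open>k1\<close> at \<open>1 + i t\<close> and \<open>k2\<close> at \<open>1 + 2 i t\<close> contribute
\<open>- 4 k1 - k2\<close>. Therefore \<open>4 k1 + k2\<close> is at most \<open>3\<close>, which forces \<open>k1 = 0\<close>.\<close>

lemma reg_zeta_nonzero_on_line:
  assumes t: "t \<noteq> 0"
  shows "reg_zeta (Complex 1 t) \<noteq> 0"
proof -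
  define L where "L = (\<lambda>s. \<Sum>n. mangoldt n * (of_nat n :: complex) powr (- s))"
  let ?H = "{s. Re s > 0}"
  have H: "open ?H" "connected ?H"
    by (auto simp: open_halfspace_Re_gt convex_connected convex_halfspace_Re_gt)
  have Z0: "reg_zeta 2 \<noteq> 0" by (rule reg_zeta_nonzero) simp
  have lim: "\<exists>k::nat. ((\<lambda>e. of_real e * L (Complex (1 + e) u)) \<longlongrightarrow> (if u = 0 then 1 else 0) - of_nat k) (at_right 0)
      \<and> (k = 0 \<longrightarrow> reg_zeta (Complex 1 u) \<noteq> 0) \<and> (u = 0 \<longrightarrow> k = 0)" for u
  proof -
    let ?\<xi> = "Complex 1 u"
    let ?q = "\<lambda>w. (w - ?\<xi>) * (deriv reg_zeta w / reg_zeta w)"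
    obtain k where k: "(?q \<longlongrightarrow> of_nat k) (at ?\<xi>)" "k = 0 \<Longrightarrow> reg_zeta ?\<xi> \<noteq> 0"
      using logarithmic_residue[OF holomorphic_reg_zeta H, of ?\<xi> 2] Z0 by auto
    have k0: "k = 0" if "u = 0"
    proof -
      have \<xi>1: "?\<xi> = 1" using that by (simp add: complex_eq_iff)
      have "isCont reg_zeta 1" "isCont (deriv reg_zeta) 1"
        using holomorphic_reg_zeta holomorphic_deriv[OF holomorphic_reg_zeta H(1)] H(1)
        by (auto simp: continuous_on_eq_continuous_at dest!: holomorphic_on_imp_continuous_on)
      then have "(?q \<longlongrightarrow> (1 - 1) * (deriv reg_zeta 1 / reg_zeta 1)) (at 1)"
        unfolding \<xi>1 by (intro tendsto_intros) (auto simp: isCont_def reg_zeta_1)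
      with k(1) have "of_nat k = (0 :: complex)"
        unfolding \<xi>1 using tendsto_unique[OF trivial_limit_at] by force
      then show ?thesis by simp
    qed
    have line: "filterlim (\<lambda>e. Complex (1 + e) u) (at ?\<xi>) (at_right 0)"
    proof (rule filterlim_atI)
      have "((\<lambda>e. Complex (1 + e) u) \<longlongrightarrow> Complex (1 + 0) u) (at_right 0)"
        by (intro tendsto_intros)
      then show "((\<lambda>e. Complex (1 + e) u) \<longlongrightarrow> ?\<xi>) (at_right 0)" by simp
      show "\<forall>\<^sub>F e in at_right 0. Complex (1 + e) u \<noteq> ?\<xi>"
        using eventually_at_right_less[of "0 :: real"] by eventually_elim simp
    qed
    have 1: "((\<lambda>e. ?q (Complex (1 + e) u)) \<longlongrightarrow> of_nat k) (at_right 0)"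
      using filterlim_compose[OF k(1) line] .
    have 2: "((\<lambda>e. of_real e / (Complex (1 + e) u - 1)) \<longlongrightarrow> (if u = 0 then 1 else 0)) (at_right 0)"
    proof (cases "u = 0")
      case True
      have "\<forall>\<^sub>F e in at_right 0. 1 = of_real e / (Complex (1 + e) u - 1)"
        using eventually_at_right_less[of "0 :: real"]
      proof eventually_elim
        case (elim e)
        have "Complex (1 + e) u - 1 = of_real e" using True by (simp add: complex_eq_iff)
        then show ?case using elim by simp
      qed
      then show ?thesis using True by (auto intro: Lim_transform_eventually)
    next
      case False
      have "((\<lambda>e. of_real e / (Complex (1 + e) u - 1)) \<longlongrightarrow> of_real 0 / (Complex (1 + 0) u - 1)) (at_right 0)"
        using False by (intro tendsto_intros) (simp add: complex_eq_iff)
      then show ?thesis using False by simp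
    qed
    have "((\<lambda>e. of_real e * L (Complex (1 + e) u)) \<longlongrightarrow> (if u = 0 then 1 else 0) - of_nat k) (at_right 0)"
    proof (rule Lim_transform_eventually[OF tendsto_diff[OF 2 1]])
      show "\<forall>\<^sub>F e in at_right 0. of_real e / (Complex (1 + e) u - 1) - ?q (Complex (1 + e) u)
          = of_real e * L (Complex (1 + e) u)"
        using eventually_at_right_less[of "0 :: real"]
      proof eventually_elim
        case (elim e)
        define s where "s = Complex (1 + e) u"
        have s: "Re s > 1" "s \<noteq> 1" "s - ?\<xi> = of_real e" using elim by (auto simp: s_def complex_eq_iff)
        have "(s - 1) * L s * reg_zeta s = reg_zeta s - (s - 1) * deriv reg_zeta s"
          unfolding L_def by (rule mangoldt_series_reg_zeta[OF s(1)])
        then have "L s = 1 / (s - 1) - deriv reg_zeta s / reg_zeta s"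
          using reg_zeta_nonzero[OF s(1)] s(2) by (simp add: field_simps)
        then show ?case unfolding s_def[symmetric] s(3) by (simp add: right_diff_distrib)
      qed
    qed
    then show ?thesis using k(2) k0 by blast
  qed
  obtain k0 k1 k2 :: nat where
    0: "((\<lambda>e. of_real e * L (Complex (1 + e) 0)) \<longlongrightarrow> 1 - of_nat k0) (at_right 0)" "k0 = 0" and
    1: "((\<lambda>e. of_real e * L (Complex (1 + e) t)) \<longlongrightarrow> 0 - of_nat k1) (at_right 0)"
       "k1 = 0 \<longrightarrow> reg_zeta (Complex 1 t) \<noteq> 0" and
    2: "((\<lambda>e. of_real e * L (Complex (1 + e) (2 * t))) \<longlongrightarrow> 0 - of_nat k2) (at_right 0)"
    using lim[of 0] lim[of t] lim[of "2 * t"] t by auto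
  have "((\<lambda>e. Re (3 * (of_real e * L (Complex (1 + e) 0)) + 4 * (of_real e * L (Complex (1 + e) t))
      + of_real e * L (Complex (1 + e) (2 * t)))) \<longlongrightarrow>
      Re (3 * (1 - of_nat k0) + 4 * (0 - of_nat k1) + (0 - of_nat k2))) (at_right 0)"
    by (intro tendsto_intros 0 1 2)
  then have "0 \<le> Re (3 * (1 - of_nat k0) + 4 * (0 - of_nat k1) + (0 - of_nat k2))"
  proof (rule tendsto_lowerbound)
    show "\<forall>\<^sub>F e in at_right 0. 0 \<le> Re (3 * (of_real e * L (Complex (1 + e) 0)) + 4 * (of_real e * L (Complex (1 + e) t))
      + of_real e * L (Complex (1 + e) (2 * t)))"
      using eventually_at_right_less[of "0 :: real"]
    proof eventually_elim
      case (elim e)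
      have "0 \<le> Re (3 * L (of_real (1 + e)) + 4 * L (Complex (1 + e) t) + L (Complex (1 + e) (2 * t)))"
        unfolding L_def using elim by (intro mertens_inequality) simp
      then have "0 \<le> e * Re (3 * L (Complex (1 + e) 0) + 4 * L (Complex (1 + e) t) + L (Complex (1 + e) (2 * t)))"
        using elim by (simp add: complex_of_real_def)
      then show ?case by (simp add: algebra_simps)
    qed
  qed simp
  then have "real (4 * k1 + k2) \<le> real 3" using 0 by simp
  then have "k1 = 0" by (simp only: of_nat_le_iff)
  then show ?thesis using 1 by simp
qed

lemma reg_zeta_nonzero_closed:
  assumes "Re s \<ge> 1"
  shows "reg_zeta s \<noteq> 0"
proof (cases "Re s > 1 \<or> s = 1")
  case True
  then show ?thesis using reg_zeta_nonzero reg_zeta_1 by auto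
next
  case False
  then have "s = Complex 1 (Im s)" "Im s \<noteq> 0"
    using assms by (auto simp: complex_eq_iff)
  then show ?thesis using reg_zeta_nonzero_on_line by metis
qed

section \<open>Newman's Tauberian theorem\<close>

lemma tail_summand_le:
  assumes n: "n \<ge> 2" and x: "x > 0"
  shows "real n powr (- 1 - x) \<le> (real (n - 1) powr (- x) - real n powr (- x)) / x"
proof -
  have "\<exists>z>real (n - 1). z < real n \<and>
    real n powr (- x) - real (n - 1) powr (- x) = (real n - real (n - 1)) * ((- x) * z powr (- x - 1))"
  proof (rule MVT2[of "real (n - 1)" "real n" "\<lambda>t. t powr (- x)" "\<lambda>t. (- x) * t powr (- x - 1)"])
    show "real (n - 1) < real n" using n by simp
    fix t assume "real (n - 1) \<le> t" "t \<le> real n"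
    then have "t > 0" using n by linarith
    then show "((\<lambda>t. t powr (- x)) has_real_derivative (- x) * t powr (- x - 1)) (at t)"
      by (auto intro!: derivative_eq_intros simp: powr_diff)
  qed
  then obtain z where z: "real (n - 1) < z" "z < real n"
    "real n powr (- x) - real (n - 1) powr (- x) = (real n - real (n - 1)) * ((- x) * z powr (- x - 1))"
    by blast
  have zpos: "z > 0" using z(1) n by linarith
  have "real (n - 1) powr (- x) - real n powr (- x) = x * z powr (- x - 1)"
    using z(3) n by (simp add: of_nat_diff algebra_simps)
  moreover have "z powr (- x - 1) \<ge> real n powr (- x - 1)"
    using z(2) zpos x by (intro powr_mono2') auto
  moreover have "- x - 1 = - 1 - x" by simp
  ultimately show ?thesis using x by simp
qed

text \<open>The sum telescopes after a comparison of each term with the integral of the same power.\<close>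

lemma tail_sum_le:
  assumes N: "N \<ge> 1" and x: "x > 0"
  shows "(\<Sum>n=Suc N..M. real n powr (- 1 - x)) \<le> real N powr (- x) / x"
proof (cases "M \<ge> N")
  case True
  have "(\<Sum>n=Suc N..M. real n powr (- 1 - x)) \<le> (real N powr (- x) - real M powr (- x)) / x"
    using True
  proof (induction M rule: dec_induct)
    case (step M)
    have "(\<Sum>n=Suc N..Suc M. real n powr (- 1 - x)) = (\<Sum>n=Suc N..M. real n powr (- 1 - x)) + real (Suc M) powr (- 1 - x)"
      using step by simp
    also have "\<dots> \<le> (real N powr (- x) - real M powr (- x)) / x + (real M powr (- x) - real (Suc M) powr (- x)) / x"
      using step tail_summand_le[of "Suc M" x] N x by (intro add_mono) auto
    finally show ?case by (simp add: diff_divide_distrib)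
  qed simp
  also have "\<dots> \<le> real N powr (- x) / x" using x by (intro divide_right_mono) auto
  finally show ?thesis .
qed (use x in simp)

text \<open>The comparison with the integral goes in opposite directions for \<open>x \<le> 1\<close> (decreasing summands) and
\<open>x > 1\<close> (increasing summands). The term \<open>1 / N\<close> accounts for the last summand in the second case.\<close>

lemma initial_sum_le:
  assumes x: "x > 0" and N: "N \<ge> 1"
  shows "(\<Sum>n=1..N. real n powr (x - 1)) \<le> real N powr x * (1 / real N + 1 / x)"
proof -
  have mvt: "\<exists>z. real n < z \<and> z < real (Suc n) \<and> real (Suc n) powr x - real n powr x = x * z powr (x - 1)"
    if "n \<ge> 1" for n
  proof -
    have "\<exists>z>real n. z < real (Suc n) \<and>
      real (Suc n) powr x - real n powr x = (real (Suc n) - real n) * (x * z powr (x - 1))"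
    proof (rule MVT2[of "real n" "real (Suc n)" "\<lambda>t. t powr x" "\<lambda>t. x * t powr (x - 1)"])
      fix t assume "real n \<le> t" "t \<le> real (Suc n)"
      then have "t > 0" using that by linarith
      then show "((\<lambda>t. t powr x) has_real_derivative x * t powr (x - 1)) (at t)"
        by (auto intro!: derivative_eq_intros simp: powr_diff)
    qed simp
    then show ?thesis by auto
  qed
  have "x * (\<Sum>n=1..N. real n powr (x - 1)) \<le> x * real N powr (x - 1) + real N powr x"
  proof (cases "x \<le> 1")
    case True
    have "x * (\<Sum>n=1..N. real n powr (x - 1)) \<le> real N powr x"
      using N
    proof (induction N rule: dec_induct)
      case (step M)
      then obtain z where z: "real M < z" "z < real (Suc M)"
        "real (Suc M) powr x - real M powr x = x * z powr (x - 1)"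
        using mvt by blast
      have "real (Suc M) powr (x - 1) \<le> z powr (x - 1)"
        using z True by (intro powr_mono2') auto
      then have "x * real (Suc M) powr (x - 1) \<le> real (Suc M) powr x - real M powr x"
        unfolding z(3) using x by (intro mult_left_mono) auto
      then show ?case using step by (simp add: distrib_left)
    qed (use True in simp)
    then show ?thesis using x by (simp add: add_increasing)
  next
    case False
    show ?thesis using N
    proof (induction N rule: dec_induct)
      case (step M)
      then obtain z where z: "real M < z" "z < real (Suc M)"
        "real (Suc M) powr x - real M powr x = x * z powr (x - 1)"
        using mvt by blast
      have "real M powr (x - 1) \<le> z powr (x - 1)"
        using z False by (intro powr_mono2) auto
      then have "x * real M powr (x - 1) \<le> real (Suc M) powr x - real M powr x"
        unfolding z(3) using x by (intro mult_left_mono) auto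
      then show ?case using step by (simp add: distrib_left)
    qed (use x in simp)
  qed
  then have "(\<Sum>n=1..N. real n powr (x - 1)) \<le> (x * real N powr (x - 1) + real N powr x) / x"
    using x by (simp add: field_simps)
  also have "\<dots> = real N powr x * (1 / real N + 1 / x)"
    using x N by (simp add: powr_diff field_simps)
  finally show ?thesis .
qed

text \<open>Integration by parts along the imaginary axis: there \<open>N powr z\<close> has modulus \<open>1\<close> and an
antiderivative of modulus \<open>1 / ln N\<close>, so the integral is of order \<open>1 / ln N\<close>.\<close>

lemma oscillatory_segment_integral:
  assumes q: "q holomorphic_on U" and U: "open U" "closed_segment (\<i> * of_real R) (- \<i> * of_real R) \<subseteq> U"
  shows "(\<lambda>N. contour_integral (linepath (\<i> * of_real R) (- \<i> * of_real R)) (\<lambda>z. q z * of_nat N powr z)) \<longlonglongrightarrow> 0"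
proof -
  let ?a = "\<i> * of_real R" and ?b = "- \<i> * of_real R"
  let ?g = "linepath ?a ?b"
  let ?I = "closed_segment ?a ?b"
  have dq: "deriv q holomorphic_on U" by (rule holomorphic_deriv[OF q U(1)])
  have cq: "continuous_on ?I q" and cdq: "continuous_on ?I (deriv q)"
    using holomorphic_on_imp_continuous_on[OF holomorphic_on_subset[OF q U(2)]]
      holomorphic_on_imp_continuous_on[OF holomorphic_on_subset[OF dq U(2)]] by blast+
  have "bounded (q ` ?I)" "bounded (deriv q ` ?I)"
    using compact_imp_bounded[OF compact_continuous_image[OF cq compact_segment]]
      compact_imp_bounded[OF compact_continuous_image[OF cdq compact_segment]] by blast+
  then obtain B B' where B: "\<And>z. z \<in> ?I \<Longrightarrow> norm (q z) \<le> B" and B': "\<And>z. z \<in> ?I \<Longrightarrow> norm (deriv q z) \<le> B'"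
    unfolding bounded_iff by blast
  have B'0: "B' \<ge> 0" using B'[of ?a] norm_ge_zero order_trans by blast
  have Re0: "Re z = 0" if "z \<in> ?I" for z
    using that unfolding in_segment by auto
  have bound: "norm (contour_integral ?g (\<lambda>z. q z * of_nat N powr z)) \<le> (2 * B + B' * norm (?b - ?a)) / ln (real N)"
    if N: "N \<ge> 2" for N
  proof -
    define L where "L = ln (real N)"
    have L: "L > 0" using N by (simp add: L_def)
    have LnN: "Ln (of_nat N) = of_real L" using N Ln_of_real[of "real N"] by (simp add: L_def)
    have nrm: "norm ((of_nat N :: complex) powr z) = 1" if "z \<in> ?I" for z
      using Re0[OF that] N norm_of_nat_powr[of N z] by simp
    have der: "((\<lambda>z. q z * of_nat N powr z / of_real L) has_field_derivative
        (deriv q z * of_nat N powr z / of_real L + q z * of_nat N powr z)) (at z within U)" if z: "z \<in> U" for z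
    proof -
      have "(q has_field_derivative deriv q z) (at z within U)"
        using z q U(1) holomorphic_derivI by blast
      moreover have "((\<lambda>z. of_nat N powr z) has_field_derivative of_real L * of_nat N powr z) (at z within U)"
        using has_field_derivative_at_within[OF has_field_derivative_powr_right[of "of_nat N" z]] N
        by (simp add: LnN)
      ultimately have "((\<lambda>z. q z * of_nat N powr z / of_real L) has_field_derivative
        (deriv q z * of_nat N powr z + of_real L * of_nat N powr z * q z) / of_real L) (at z within U)"
        by (intro DERIV_cdivide DERIV_mult)
      then show ?thesis using L by (simp add: add_divide_distrib mult_ac)
    qed
    have 1: "((\<lambda>z. deriv q z * of_nat N powr z / of_real L + q z * of_nat N powr z) has_contour_integral
        q ?b * of_nat N powr ?b / of_real L - q ?a * of_nat N powr ?a / of_real L) ?g"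
      using contour_integral_primitive[OF der, of ?g] U(2) by simp
    have cont: "continuous_on ?I (\<lambda>z. deriv q z * of_nat N powr z / of_real L)"
      using N L by (intro continuous_intros cdq) auto
    then have ci: "(\<lambda>z. deriv q z * of_nat N powr z / of_real L) contour_integrable_on ?g"
      by (rule contour_integrable_continuous_linepath)
    have "((\<lambda>z. q z * of_nat N powr z) has_contour_integral
        q ?b * of_nat N powr ?b / of_real L - q ?a * of_nat N powr ?a / of_real L
         - contour_integral ?g (\<lambda>z. deriv q z * of_nat N powr z / of_real L)) ?g"
      using has_contour_integral_diff[OF 1 has_contour_integral_integral[OF ci]] by simp
    then have eq: "contour_integral ?g (\<lambda>z. q z * of_nat N powr z) =
        q ?b * of_nat N powr ?b / of_real L - q ?a * of_nat N powr ?a / of_real L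
         - contour_integral ?g (\<lambda>z. deriv q z * of_nat N powr z / of_real L)"
      by (rule contour_integral_unique)
    have e1: "norm (q z * of_nat N powr z / of_real L) \<le> B / L" if "z \<in> ?I" for z
      using B[OF that] nrm[OF that] L by (simp add: norm_mult norm_divide divide_right_mono)
    have e2: "norm (contour_integral ?g (\<lambda>z. deriv q z * of_nat N powr z / of_real L)) \<le> B' / L * norm (?b - ?a)"
    proof (rule contour_integral_bound_linepath[OF ci])
      show "norm (deriv q z * of_nat N powr z / of_real L) \<le> B' / L" if "z \<in> ?I" for z
        using B'[OF that] nrm[OF that] L by (simp add: norm_mult norm_divide divide_right_mono)
    qed (use B'0 L in simp)
    have ends: "?a \<in> ?I" "?b \<in> ?I" by auto
    have "norm (contour_integral ?g (\<lambda>z. q z * of_nat N powr z)) \<le> B / L + B / L + B' / L * norm (?b - ?a)"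
      unfolding eq using e1[OF ends(1)] e1[OF ends(2)] e2
      by (intro order_trans[OF norm_triangle_ineq4] add_mono) auto
    also have "\<dots> = (2 * B + B' * norm (?b - ?a)) / L"
      by (simp add: add_divide_distrib)
    finally show ?thesis unfolding L_def .
  qed
  show ?thesis
  proof (rule Lim_null_comparison)
    show "\<forall>\<^sub>F N in sequentially. norm (contour_integral ?g (\<lambda>z. q z * of_nat N powr z))
        \<le> (2 * B + B' * norm (?b - ?a)) / ln (real N)"
      using eventually_ge_at_top[of 2] by eventually_elim (rule bound)
    show "(\<lambda>N. (2 * B + B' * norm (?b - ?a)) / ln (real N)) \<longlonglongrightarrow> 0"
      by (intro tendsto_divide_0[OF tendsto_const] filterlim_at_top_imp_at_infinity
          filterlim_compose[OF ln_at_top filterlim_real_sequentially])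
  qed
qed

text \<open>The quotient \<open>(E z - E 0) / z\<close> is entire, so it integrates to \<open>0\<close> over the circle that the two half
circles form; what remains is \<open>E 0\<close> times the integral of \<open>1 / z\<close>, computed directly on each arc.\<close>

lemma cauchy_formula_two_arcs:
  assumes E: "E holomorphic_on UNIV" and R: "R > 0"
  shows "contour_integral (part_circlepath 0 R (- pi / 2) (pi / 2)) (\<lambda>z. E z / z)
     + contour_integral (part_circlepath 0 R (pi / 2) (3 * pi / 2)) (\<lambda>z. E z / z) = 2 * of_real pi * \<i> * E 0"
proof -
  let ?A = "part_circlepath 0 R (- pi / 2) (pi / 2)" and ?B = "part_circlepath 0 R (pi / 2) (3 * pi / 2)"
  define k where "k = (\<lambda>z. if z = 0 then deriv E 0 else (E z - E 0) / (z - 0))"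
  have k: "k holomorphic_on UNIV"
    unfolding k_def by (rule pole_lemma[OF E]) simp
  have fs: "pathfinish ?A = pathstart ?B" "pathfinish ?B = pathstart ?A"
  proof -
    have "3 * pi / 2 = - pi / 2 + 2 * pi" by simp
    then have "cis (3 * pi / 2) = cis (- pi / 2)"
      by (metis cis_mult cis_2pi mult.right_neutral)
    then show "pathfinish ?B = pathstart ?A"
      unfolding pathfinish_part_circlepath pathstart_part_circlepath by (simp only: cis_conv_exp)
    show "pathfinish ?A = pathstart ?B" by simp
  qed
  have "(k has_contour_integral 0) (?A +++ ?B)"
    by (rule Cauchy_theorem_convex_simple[OF k]) (use fs in auto)
  moreover have ci: "k contour_integrable_on part_circlepath 0 R a b" for a b
    by (intro contour_integrable_holomorphic_simple[OF k]) auto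
  ultimately have k0: "contour_integral ?A k + contour_integral ?B k = 0"
    using contour_integral_join[OF ci ci] fs contour_integral_unique by fastforce
  have inv: "((\<lambda>z. 1 / z) has_contour_integral \<i> * of_real (b - a)) (part_circlepath 0 R a b)" if "a < b" for a b
  proof -
    have "((\<lambda>t. \<i>) has_integral (b - a) *\<^sub>R \<i>) {a..b}"
      using has_integral_const_real[of \<i> a b] that by simp
    then have "((\<lambda>t. 1 / (0 + of_real R * cis t) * of_real R * \<i> * cis t) has_integral \<i> * of_real (b - a)) {a..b}"
      using R by (simp add: scaleR_conv_of_real mult.commute)
    then show ?thesis using has_contour_integral_part_circlepath_iff[OF that] by simp
  qed
  have nz: "z \<noteq> 0" if "z \<in> path_image (part_circlepath 0 R a b)" for z a b
    using path_image_part_circlepath_subset'[of R 0 a b] that R by auto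
  have main: "contour_integral (part_circlepath 0 R a b) (\<lambda>z. E z / z)
      = contour_integral (part_circlepath 0 R a b) k + E 0 * (\<i> * of_real (b - a))" if "a < b" for a b
  proof (rule contour_integral_unique)
    have "((\<lambda>z. k z + E 0 * (1 / z)) has_contour_integral
        contour_integral (part_circlepath 0 R a b) k + E 0 * (\<i> * of_real (b - a))) (part_circlepath 0 R a b)"
      by (intro has_contour_integral_add has_contour_integral_lmul inv that has_contour_integral_integral ci)
    then show "((\<lambda>z. E z / z) has_contour_integral
        contour_integral (part_circlepath 0 R a b) k + E 0 * (\<i> * of_real (b - a))) (part_circlepath 0 R a b)"
      by (rule has_contour_integral_eq) (auto simp: k_def diff_divide_distrib dest: nz)
  qed
  show ?thesis
    using k0 pi_gt_zero by (simp add: main algebra_simps)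
qed

text \<open>On the circle of radius \<open>R\<close> the inverse of \<open>z\<close> is \<open>cnj z / R\<^sup>2\<close>. Thus the kernel is
small near the imaginary axis, exactly where the bounds \<open>1 / Re z\<close> for the partial sums and the tails
of a Dirichlet series blow up.\<close>

lemma kernel_on_circle:
  assumes R: "R > 0" and z: "cmod z = R"
  shows "(1 + z\<^sup>2 / (of_real R)\<^sup>2) / z = of_real (2 * Re z / R\<^sup>2)"
proof -
  have z0: "z \<noteq> 0" using z R by auto
  have "of_real (R\<^sup>2) = z * cnj z" using z by (simp add: complex_norm_square[symmetric])
  then have R2: "(of_real R)\<^sup>2 = z * cnj z" by simp
  have c0: "cnj z \<noteq> 0" using z0 by simp
  have "(1 + z\<^sup>2 / (of_real R)\<^sup>2) / z = (cnj z + z) / (of_real R)\<^sup>2"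
    unfolding R2 using z0 c0 by (simp add: field_simps power2_eq_square)
  also have "cnj z + z = of_real (2 * Re z)" by (simp add: complex_eq_iff)
  finally show ?thesis by simp
qed

text \<open>Let \<open>f z = z * h z\<close> be the sum of the Dirichlet series at \<open>1 + z\<close>, and \<open>S N\<close> its partial sum, an entire
function with \<open>S N 0 = T N\<close>. Cauchy's formula expresses \<open>2 \<pi> i T N\<close> as the integral of
\<open>S N z * N powr z * (1 / z + z / R\<^sup>2)\<close> over the circle of radius \<open>R\<close>. On the right half of the circle,
\<open>S N\<close> is replaced by the tail \<open>S N - f\<close>; the price is the integral of \<open>f\<close> against the same kernel,
which Cauchy's theorem on the half-disc moves to the imaginary axis, where it is an oscillatory
integral tending to \<open>0\<close>. There is no pole at \<open>0\<close> to pass since \<open>f\<close> vanishes there. The two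
remaining integrals are of order \<open>1 / R\<close>: the factor \<open>N powr z\<close> balances the size of the tail on the
right and of the partial sum on the left. As \<open>R\<close> is arbitrary, \<open>T N\<close> tends to \<open>0\<close>.\<close>

theorem newman_tauberian:
  fixes a :: "nat \<Rightarrow> complex"
  assumes a: "\<And>n. norm (a n) \<le> 1"
    and h: "h holomorphic_on U" and U: "open U" "{z. Re z \<ge> 0} \<subseteq> U"
    and ah: "\<And>z. Re z > 0 \<Longrightarrow> (\<Sum>n. a n * of_nat n powr (- (1 + z))) = z * h z"
  shows "(\<lambda>N. \<Sum>n=1..N. a n / of_nat n) \<longlonglongrightarrow> 0"
proof -
  define S where "S N z = (\<Sum>n=1..N. a n * of_nat n powr (- (1 + z)))" for N :: nat and z
  define T where "T N = (\<Sum>n=1..N. a n / of_nat n)" for N :: nat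
  have S0: "S N 0 = T N" for N
    unfolding S_def T_def by (intro sum.cong) (auto simp: powr_minus divide_inverse)
  have norm_term: "norm (a n * of_nat n powr (- (1 + z))) \<le> real n powr (- 1 - Re z)" for n z
    using mult_right_mono[OF a[of n], of "norm ((of_nat n :: complex) powr (- (1 + z)))"]
      norm_nat_powr_minus[of n "1 + z"] by (simp add: norm_mult)
  have tail: "norm (z * h z - S N z) \<le> real N powr (- Re z) / Re z" if N: "N \<ge> 1" and z: "Re z > 0" for N z
  proof -
    have sm: "summable (\<lambda>n. a n * of_nat n powr (- (1 + z)))"
    proof (rule summable_comparison_test'[of "\<lambda>n. real n powr (- 1 - Re z)" 0])
      show "summable (\<lambda>n. real n powr (- 1 - Re z))" using z by (simp add: summable_real_powr_iff)
    qed (rule norm_term)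
    have "(\<lambda>M. (\<Sum>n\<le>M. a n * of_nat n powr (- (1 + z))) - S N z) \<longlonglongrightarrow> z * h z - S N z"
      using summable_LIMSEQ'[OF sm] unfolding ah[OF z] by (intro tendsto_intros)
    then show ?thesis
    proof (rule tendsto_norm[THEN LIMSEQ_le_const2])
      show "\<exists>M0. \<forall>M\<ge>M0. norm ((\<Sum>n\<le>M. a n * of_nat n powr (- (1 + z))) - S N z) \<le> real N powr (- Re z) / Re z"
      proof (intro exI[of _ N] allI impI)
        fix M assume M: "M \<ge> N"
        have "{..M} = insert 0 ({1..N} \<union> {Suc N..M})" using M by auto
        then have "(\<Sum>n\<le>M. a n * of_nat n powr (- (1 + z))) = S N z + (\<Sum>n=Suc N..M. a n * of_nat n powr (- (1 + z)))"
          unfolding S_def by (simp add: sum.union_disjoint)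
        then have "norm ((\<Sum>n\<le>M. a n * of_nat n powr (- (1 + z))) - S N z) \<le> (\<Sum>n=Suc N..M. real n powr (- 1 - Re z))"
          by (simp add: sum_norm_le norm_term del: minus_add_distrib)
        also have "\<dots> \<le> real N powr (- Re z) / Re z" by (rule tail_sum_le[OF N z])
        finally show "norm ((\<Sum>n\<le>M. a n * of_nat n powr (- (1 + z))) - S N z) \<le> real N powr (- Re z) / Re z" .
      qed
    qed
  qed
  have head: "norm (S N z) \<le> real N powr x * (1 / real N + 1 / x)" if N: "N \<ge> 1" and x: "Re z = - x" "x > 0" for N z x
  proof -
    have "norm (S N z) \<le> (\<Sum>n=1..N. real n powr (x - 1))"
      unfolding S_def using norm_term[of _ z] x(1) by (intro sum_norm_le) (simp add: algebra_simps)
    also have "\<dots> \<le> real N powr x * (1 / real N + 1 / x)" by (rule initial_sum_le[OF x(2) N])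
    finally show ?thesis .
  qed
  \<comment> \<open>The kernel vanishes at the points where the circle meets the imaginary axis.\<close>
  define K where "K R z = 1 + z\<^sup>2 / (of_real R)\<^sup>2" for R :: real and z :: complex
  define line where "line R N = contour_integral (linepath (\<i> * of_real R) (- \<i> * of_real R)) (\<lambda>z. (h z * K R z) * of_nat N powr z)" for R :: real and N :: nat
  have line0: "line R \<longlonglongrightarrow> 0" if R: "R > 0" for R
    unfolding line_def
  proof (rule oscillatory_segment_integral[OF _ U(1)])
    show "(\<lambda>z. h z * K R z) holomorphic_on U" unfolding K_def using R by (intro holomorphic_intros h) auto
    show "closed_segment (\<i> * of_real R) (- \<i> * of_real R) \<subseteq> U"
      using U(2) by (intro subset_trans[OF closed_segment_subset, of _ "{z. Re z \<ge> 0}"] convex_halfspace_Re_ge) auto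
  qed
  have bound: "norm (T N) \<le> 2 / R + 1 / real N + norm (line R N)" if N: "N \<ge> 1" and R: "R > 0" for N R
  proof -
    let ?A = "part_circlepath 0 R (- pi / 2) (pi / 2)" and ?B = "part_circlepath 0 R (pi / 2) (3 * pi / 2)"
    define E where "E z = S N z * of_nat N powr z * K R z" for z
    have E: "E holomorphic_on X" for X
      unfolding E_def S_def K_def using N R by (intro holomorphic_intros) auto
    have E0: "E 0 = T N" using N by (simp add: E_def K_def S0)
    define H where "H z = (h z * K R z) * of_nat N powr z" for z
    have H: "H holomorphic_on U"
      unfolding H_def K_def using N R by (intro holomorphic_intros h) auto
    have circ: "cmod z = R" if "z \<in> path_image (part_circlepath 0 R s t)" for z s t
      using that R path_image_part_circlepath_subset'[of R 0 s t] by auto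
    have arc: "\<exists>u\<in>{s..t}. z = of_real R * cis u" if "s \<le> t" "z \<in> path_image (part_circlepath 0 R s t)" for z s t
      using that by (auto simp: path_image_part_circlepath cis_conv_exp)
    have ReA: "Re z \<ge> 0" if "z \<in> path_image ?A" for z
    proof -
      have "\<exists>t\<in>{- pi / 2..pi / 2}. z = of_real R * cis t"
        by (rule arc[OF _ that]) simp
      then obtain t where t: "t \<in> {- pi / 2..pi / 2}" "z = of_real R * cis t" by blast
      have "cos t \<ge> 0" using t by (intro cos_ge_zero) auto
      then show ?thesis using t R by simp
    qed
    have ReB: "Re z \<le> 0" if "z \<in> path_image ?B" for z
    proof -
      have "\<exists>t\<in>{pi / 2..3 * pi / 2}. z = of_real R * cis t"
        by (rule arc[OF _ that]) simp
      then obtain t where t: "t \<in> {pi / 2..3 * pi / 2}" "z = of_real R * cis t" by blast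
      have "cos (t - pi) \<ge> 0" using t by (intro cos_ge_zero) auto
      then have "cos t \<le> 0" by simp
      then show ?thesis using t R by (simp add: mult_nonneg_nonpos)
    qed
    have cA: "continuous_on (path_image ?A) H"
      using ReA U(2) by (intro holomorphic_on_imp_continuous_on holomorphic_on_subset[OF H]) auto
    have nz: "z \<noteq> 0" if "z \<in> path_image (part_circlepath 0 R s t)" for z s t
      using circ[OF that] R by auto
    have ciH: "H contour_integrable_on ?A"
      using cA by (intro contour_integrable_continuous_part_circlepath) 
    have ciE: "(\<lambda>z. E z / z) contour_integrable_on part_circlepath 0 R s t" for s t
      by (intro contour_integrable_continuous_part_circlepath continuous_intros
          holomorphic_on_imp_continuous_on E) (use nz in auto)
    have "(H has_contour_integral 0) (?A +++ linepath (\<i> * of_real R) (- \<i> * of_real R))"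
    proof (rule Cauchy_theorem_convex[where S = "{z. Re z \<ge> 0}" and K = "{}"])
      show "continuous_on {z. Re z \<ge> 0} H"
        using U(2) by (intro holomorphic_on_imp_continuous_on holomorphic_on_subset[OF H]) auto
      show "convex {z. Re z \<ge> 0}" by (rule convex_halfspace_Re_ge)
      show "H field_differentiable at z" if "z \<in> interior {z. Re z \<ge> 0} - {}" for z
        using that U interior_subset H holomorphic_on_imp_differentiable_at by blast
      have ends: "pathfinish ?A = \<i> * of_real R" "pathstart ?A = - \<i> * of_real R"
        unfolding pathfinish_part_circlepath pathstart_part_circlepath cis_conv_exp[symmetric] by simp_all
      show "valid_path (?A +++ linepath (\<i> * of_real R) (- \<i> * of_real R))"
        using ends by (intro valid_path_join) auto
      have "closed_segment (\<i> * of_real R) (- \<i> * of_real R) \<subseteq> {z. Re z \<ge> 0}"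
        by (intro closed_segment_subset convex_halfspace_Re_ge) auto
      then show "path_image (?A +++ linepath (\<i> * of_real R) (- \<i> * of_real R)) \<subseteq> {z. Re z \<ge> 0}"
        using ReA ends by (subst path_image_join) auto
      show "pathfinish (?A +++ linepath (\<i> * of_real R) (- \<i> * of_real R)) = pathstart (?A +++ linepath (\<i> * of_real R) (- \<i> * of_real R))"
        using ends by simp
    qed simp
    moreover have ciL: "H contour_integrable_on linepath (\<i> * of_real R) (- \<i> * of_real R)"
    proof (rule contour_integrable_continuous_linepath)
      have "closed_segment (\<i> * of_real R) (- \<i> * of_real R) \<subseteq> {z. Re z \<ge> 0}"
        by (intro closed_segment_subset convex_halfspace_Re_ge) auto
      then show "continuous_on (closed_segment (\<i> * of_real R) (- \<i> * of_real R)) H"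
        using U(2) by (intro holomorphic_on_imp_continuous_on holomorphic_on_subset[OF H]) auto
    qed
    ultimately have half: "contour_integral ?A H + line R N = 0"
      using contour_integral_join[OF ciH ciL] contour_integral_unique
      unfolding line_def H_def by fastforce
    have cauchy: "contour_integral ?A (\<lambda>z. E z / z) + contour_integral ?B (\<lambda>z. E z / z) = 2 * of_real pi * \<i> * T N"
      using cauchy_formula_two_arcs[OF E R] unfolding E0 .
    have diff: "contour_integral ?A (\<lambda>z. E z / z - H z) = contour_integral ?A (\<lambda>z. E z / z) - contour_integral ?A H"
      by (rule contour_integral_diff[OF ciE ciH])
    have bA: "norm (contour_integral ?A (\<lambda>z. E z / z - H z)) \<le> 2 / R\<^sup>2 * R * \<bar>pi / 2 - (- pi / 2)\<bar>"
    proof (rule contour_integral_bound_part_circlepath)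
      show "(\<lambda>z. E z / z - H z) contour_integrable_on ?A"
        by (rule contour_integrable_diff[OF ciE ciH])
      fix z assume z: "z \<in> path_image ?A"
      have z0: "z \<noteq> 0" using nz[OF z] .
      have eq: "E z / z - H z = (S N z - z * h z) * of_nat N powr z * (K R z / z)"
        using z0 by (simp add: E_def H_def field_simps)
      have Kz: "K R z / z = of_real (2 * Re z / R\<^sup>2)"
        unfolding K_def by (rule kernel_on_circle[OF R circ[OF z]])
      show "norm (E z / z - H z) \<le> 2 / R\<^sup>2"
      proof (cases "Re z = 0")
        case True
        then show ?thesis unfolding eq Kz by simp
      next
        case False
        then have x: "Re z > 0" using ReA[OF z] by simp
        have "norm (E z / z - H z) = norm (z * h z - S N z) * real N powr Re z * (2 * Re z / R\<^sup>2)"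
          unfolding eq Kz norm_mult norm_of_real using x N by (simp add: norm_of_nat_powr norm_minus_commute)
        also have "\<dots> \<le> real N powr (- Re z) / Re z * real N powr Re z * (2 * Re z / R\<^sup>2)"
          using tail[OF N x] x by (intro mult_right_mono) auto
        also have "\<dots> = 2 / R\<^sup>2" using x N by (simp add: powr_minus field_simps)
        finally show ?thesis .
      qed
    qed (use R in auto)
    have bB: "norm (contour_integral ?B (\<lambda>z. E z / z)) \<le> (2 / R\<^sup>2 + 2 / (real N * R)) * R * \<bar>3 * pi / 2 - pi / 2\<bar>"
    proof (rule contour_integral_bound_part_circlepath[OF ciE])
      fix z assume z: "z \<in> path_image ?B"
      have eq: "E z / z = S N z * of_nat N powr z * (K R z / z)"
        by (simp add: E_def)
      have Kz: "K R z / z = of_real (2 * Re z / R\<^sup>2)"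
        unfolding K_def by (rule kernel_on_circle[OF R circ[OF z]])
      show "norm (E z / z) \<le> 2 / R\<^sup>2 + 2 / (real N * R)"
      proof (cases "Re z = 0")
        case True
        then show ?thesis unfolding eq Kz using R by simp
      next
        case False
        define x where "x = - Re z"
        have x: "x > 0" "Re z = - x" using False ReB[OF z] by (auto simp: x_def)
        have xR: "x \<le> R" using abs_Re_le_cmod[of z] circ[OF z] x by simp
        have "norm (E z / z) = norm (S N z) * real N powr (- x) * (2 * x / R\<^sup>2)"
          unfolding eq Kz norm_mult norm_of_real using x N by (simp add: norm_of_nat_powr)
        also have "\<dots> \<le> real N powr x * (1 / real N + 1 / x) * real N powr (- x) * (2 * x / R\<^sup>2)"
          using head[OF N x(2,1)] x by (intro mult_right_mono) auto
        also have "\<dots> = (1 / real N + 1 / x) * (2 * x / R\<^sup>2)" using N by (simp add: powr_minus)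
        also have "\<dots> = 2 / R\<^sup>2 + 2 / real N * (x / R\<^sup>2)" using x R N by (simp add: field_simps)
        also have "\<dots> \<le> 2 / R\<^sup>2 + 2 / real N * (R / R\<^sup>2)"
          using xR R by (intro add_left_mono mult_left_mono divide_right_mono) auto
        also have "\<dots> = 2 / R\<^sup>2 + 2 / (real N * R)" using R by (simp add: power2_eq_square)
        finally show ?thesis .
      qed
    qed (use R in auto)
    have "2 * of_real pi * \<i> * T N = contour_integral ?A (\<lambda>z. E z / z - H z) + contour_integral ?B (\<lambda>z. E z / z) - line R N"
      using half cauchy diff by (simp add: algebra_simps add_eq_0_iff)
    then have "norm (2 * of_real pi * \<i> * T N) \<le> norm (contour_integral ?A (\<lambda>z. E z / z - H z)) + norm (contour_integral ?B (\<lambda>z. E z / z)) + norm (line R N)"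
      using norm_triangle_ineq4[of "contour_integral ?A (\<lambda>z. E z / z - H z) + contour_integral ?B (\<lambda>z. E z / z)" "line R N"]
        norm_triangle_ineq[of "contour_integral ?A (\<lambda>z. E z / z - H z)" "contour_integral ?B (\<lambda>z. E z / z)"]
      by (simp only:)
    also have "\<dots> \<le> 2 / R\<^sup>2 * R * \<bar>pi / 2 - (- pi / 2)\<bar> + (2 / R\<^sup>2 + 2 / (real N * R)) * R * \<bar>3 * pi / 2 - pi / 2\<bar> + norm (line R N)"
      using bA bB by simp
    also have "\<dots> = 2 * pi * (2 / R + 1 / real N) + norm (line R N)"
    proof -
      have "\<bar>pi / 2 - (- pi / 2)\<bar> = pi" "\<bar>3 * pi / 2 - pi / 2\<bar> = pi" by (simp_all add: abs_if)
      then show ?thesis using R N by (simp add: field_simps power2_eq_square)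
    qed
    finally have "2 * pi * norm (T N) \<le> 2 * pi * (2 / R + 1 / real N) + norm (line R N)"
      by (simp add: norm_mult)
    also have "norm (line R N) \<le> 2 * pi * norm (line R N)"
      using pi_gt3 by (intro mult_le_cancel_right1[THEN iffD2]) auto
    finally have "2 * pi * norm (T N) \<le> 2 * pi * (2 / R + 1 / real N + norm (line R N))"
      by (simp add: distrib_left)
    then show ?thesis by simp
  qed
  have "T \<longlonglongrightarrow> 0"
  proof (rule LIMSEQ_I)
    fix e :: real assume e: "e > 0"
    \<comment> \<open>With this radius the term \<open>2 / R\<close> of the bound is half of \<open>e\<close>.\<close>
    define R where "R = 4 / e"
    have R: "R > 0" using e by (simp add: R_def)
    have "(\<lambda>N. 2 / R + 1 / real N + norm (line R N)) \<longlonglongrightarrow> 2 / R + 0 + 0"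
      by (intro tendsto_intros lim_1_over_n tendsto_norm_zero line0 R)
    moreover have "2 / R + 0 + 0 < e" using e by (simp add: R_def)
    ultimately have "\<forall>\<^sub>F N in sequentially. 2 / R + 1 / real N + norm (line R N) < e"
      by (rule order_tendstoD(2))
    then have "\<forall>\<^sub>F N in sequentially. norm (T N - 0) < e"
      using eventually_ge_at_top[of 1]
    proof eventually_elim
      case (elim N)
      then show ?case using bound[OF _ R, of N] by simp
    qed
    then show "\<exists>N0. \<forall>N\<ge>N0. norm (T N - 0) < e" by (simp add: eventually_sequentially)
  qed
  then show ?thesis unfolding T_def .
qed

lemma cesaro_means_tendsto:
  fixes x :: "nat \<Rightarrow> real"
  assumes "x \<longlonglongrightarrow> 0"
  shows "(\<lambda>N. (\<Sum>n<N. x n) / real N) \<longlonglongrightarrow> 0"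
proof (rule LIMSEQ_I)
  fix e :: real assume e: "e > 0"
  obtain M where M: "\<And>n. n \<ge> M \<Longrightarrow> \<bar>x n\<bar> < e / 2"
    using LIMSEQ_D[OF assms, of "e / 2"] e by auto
  define C where "C = (\<Sum>n<M. \<bar>x n\<bar>)"
  have "(\<lambda>N. C / real N) \<longlonglongrightarrow> 0" by (rule lim_const_over_n)
  then obtain N0 where N0: "\<And>N. N \<ge> N0 \<Longrightarrow> \<bar>C / real N\<bar> < e / 2"
    using LIMSEQ_D[of _ 0 "e / 2"] e by (metis half_gt_zero diff_zero real_norm_def)
  have "\<bar>(\<Sum>n<N. x n) / real N\<bar> < e" if N: "N \<ge> max (max N0 M) 1" for N
  proof -
    have "{..<N} = {..<M} \<union> {M..<N}" "{..<M} \<inter> {M..<N} = {}" using N by auto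
    then have "(\<Sum>n<N. x n) = (\<Sum>n<M. x n) + (\<Sum>n=M..<N. x n)"
      by (simp add: sum.union_disjoint)
    moreover have "\<bar>\<Sum>n<M. x n\<bar> \<le> C" unfolding C_def by (rule sum_abs)
    moreover have "\<bar>\<Sum>n=M..<N. x n\<bar> \<le> real (card {M..<N}) * (e / 2)"
      using M by (intro order_trans[OF sum_abs] sum_bounded_above) (simp add: less_imp_le)
    moreover have "real (card {M..<N}) * (e / 2) \<le> real N * (e / 2)"
      using e by (intro mult_right_mono) auto
    ultimately have "\<bar>\<Sum>n<N. x n\<bar> \<le> C + real N * (e / 2)" by linarith
    then have "\<bar>\<Sum>n<N. x n\<bar> / real N \<le> (C + real N * (e / 2)) / real N"
      by (rule divide_right_mono) simp
    also have "\<dots> = C / real N + e / 2" using N by (simp add: field_simps)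
    also have "\<dots> < e" using N0[of N] abs_ge_self[of "C / real N"] N by linarith
    finally show ?thesis by simp
  qed
  then show "\<exists>N0. \<forall>N\<ge>N0. norm ((\<Sum>n<N. x n) / real N - 0) < e"
    by (intro exI[of _ "max (max N0 M) 1"]) auto
qed

text \<open>The Dirichlet series of the Moebius function at \<open>1 + z\<close> is \<open>z\<close> divided by the regularized zeta
function, which is holomorphic up to and across the imaginary axis because zeta has no zeros on the
line \<open>Re s = 1\<close>.\<close>

theorem moebius_sum_over_n_tendsto:
  "(\<lambda>N. \<Sum>n=1..N. real_of_int (moebius n) / real n) \<longlonglongrightarrow> 0"
proof -
  let ?U = "{z. Re (1 + z) > 0} \<inter> (\<lambda>z. reg_zeta (1 + z)) -` (- {0})"
  have hol: "(\<lambda>z. reg_zeta (1 + z)) holomorphic_on {z. Re (1 + z) > 0}"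
  proof -
    have "(reg_zeta \<circ> (\<lambda>z. 1 + z)) holomorphic_on {z. Re (1 + z) > 0}"
      by (rule holomorphic_on_compose_gen[OF _ holomorphic_reg_zeta]) (auto intro!: holomorphic_intros)
    then show ?thesis by (simp add: o_def)
  qed
  have op: "open {z. Re (1 + z) > 0}"
    by (intro open_Collect_less continuous_intros)
  have "(\<lambda>N. \<Sum>n=1..N. of_int (moebius n) / (of_nat n :: complex)) \<longlonglongrightarrow> 0"
  proof (rule newman_tauberian)
    show "norm (of_int (moebius n) :: complex) \<le> 1" for n
      using abs_moebius_le_1[of n] by (simp flip: of_int_abs)
    show "(\<lambda>z. 1 / reg_zeta (1 + z)) holomorphic_on ?U"
      by (intro holomorphic_intros holomorphic_on_subset[OF hol]) auto
    show "open ?U"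
      by (rule continuous_open_preimage[OF holomorphic_on_imp_continuous_on[OF hol] op]) auto
    show "{z. Re z \<ge> 0} \<subseteq> ?U"
      using reg_zeta_nonzero_closed by auto
    fix z :: complex assume z: "Re z > 0"
    then have "reg_zeta (1 + z) * (\<Sum>n. of_int (moebius n) * of_nat n powr (- (1 + z))) = z"
      using reg_zeta_mult_moebius[of "1 + z"] by simp
    moreover have "reg_zeta (1 + z) \<noteq> 0" using z by (intro reg_zeta_nonzero) simp
    ultimately show "(\<Sum>n. of_int (moebius n) * of_nat n powr (- (1 + z))) = z * (1 / reg_zeta (1 + z))"
      by (simp add: field_simps)
  qed
  then have "(\<lambda>N. Re (\<Sum>n=1..N. of_int (moebius n) / (of_nat n :: complex))) \<longlonglongrightarrow> Re 0"
    by (rule tendsto_Re)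
  then show ?thesis by (simp add: Re_divide_of_nat)
qed

text \<open>Summation by parts expresses the mean of the Moebius function as \<open>T N\<close> minus the arithmetic mean of
the \<open>T n\<close> with \<open>n < N\<close>, and the sequence \<open>T\<close> tends to \<open>0\<close>. This statement is equivalent to the
prime number theorem.\<close>

theorem moebius_mean_tendsto:
  "(\<lambda>N. (\<Sum>n=1..N. real_of_int (moebius n)) / real N) \<longlonglongrightarrow> 0"
proof -
  define T where "T N = (\<Sum>n=1..N. real_of_int (moebius n) / real n)" for N :: nat
  have T: "T \<longlonglongrightarrow> 0" unfolding T_def by (rule moebius_sum_over_n_tendsto)
  have abel: "(\<Sum>n=1..N. real_of_int (moebius n)) = real N * T N - (\<Sum>n<N. T n)" for N
  proof (induction N)
    case (Suc N)
    have "T (Suc N) = T N + real_of_int (moebius (Suc N)) / real (Suc N)"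
      by (simp add: T_def)
    then have "real (Suc N) * T (Suc N) = real (Suc N) * T N + real_of_int (moebius (Suc N))"
      by (simp add: field_simps del: of_nat_Suc)
    then show ?case using Suc by (simp add: algebra_simps)
  qed simp
  have "(\<lambda>N. T N - (\<Sum>n<N. T n) / real N) \<longlonglongrightarrow> 0 - 0"
    by (intro tendsto_diff T cesaro_means_tendsto)
  then have "(\<lambda>N. T N - (\<Sum>n<N. T n) / real N) \<longlonglongrightarrow> 0" by simp
  then show ?thesis
  proof (rule Lim_transform_eventually)
    show "\<forall>\<^sub>F N in sequentially. T N - (\<Sum>n<N. T n) / real N = (\<Sum>n=1..N. real_of_int (moebius n)) / real N"
      using eventually_gt_at_top[of 0] unfolding abel by eventually_elim (simp add: field_simps)
  qed
qed

section \<open>Operators on the space of square-summable families\<close>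

instance ell2 :: (type) banach ..

lemma scaleC_zero_left [simp]: "0 *\<^sub>C (x :: 'a::complex_vector) = 0"
  by (rule complex_vector.scale_zero_left)
lemma scaleC_zero_right [simp]: "c *\<^sub>C (0 :: 'a::complex_vector) = 0"
  by (rule complex_vector.scale_zero_right)
lemma scaleC_one [simp]: "1 *\<^sub>C (x :: 'a::complex_vector) = x"
  by (rule complex_vector.scale_one)

lemma cinner_add_left: "cinner (x + y) z = cinner x z + cinner y (z :: 'a::chilbert_space)"
  by (metis cinner_add_right cinner_commute complex_cnj_add)
lemma cinner_scaleC_left: "cinner (c *\<^sub>C x) y = cnj c * cinner x (y :: 'a::chilbert_space)"
  by (metis cinner_scaleC_right cinner_commute complex_cnj_mult)
lemma cinner_zero_right [simp]: "cinner x (0 :: 'a::chilbert_space) = 0"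
  using cinner_scaleC_right[of x 0 0] by simp
lemma cinner_zero_left [simp]: "cinner (0 :: 'a::chilbert_space) x = 0"
  using cinner_scaleC_left[of 0 0 x] by simp
lemma cinner_minus_right: "cinner x (- y) = - cinner x (y :: 'a::chilbert_space)"
  using cinner_add_right[of x y "- y"] by (simp add: add_eq_0_iff)
lemma cinner_diff_right: "cinner x (y - z) = cinner x y - cinner x (z :: 'a::chilbert_space)"
  using cinner_add_right[of x y "- z"] by (simp add: cinner_minus_right)
lemma cinner_sum_right: "cinner x (\<Sum>i\<in>I. f i) = (\<Sum>i\<in>I. cinner x (f i :: 'a::chilbert_space))"
  by (induction I rule: infinite_finite_induct) (simp_all add: cinner_add_right)
lemma cinner_sum_left: "cinner (\<Sum>i\<in>I. f i) x = (\<Sum>i\<in>I. cinner (f i :: 'a::chilbert_space) x)"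
  by (induction I rule: infinite_finite_induct) (simp_all add: cinner_add_left)
lemma cinner_self: "cinner x x = of_real ((norm (x :: 'a::chilbert_space))\<^sup>2)"
  using cinner_commute [of x x] Re_cinner [of x x]
  by (simp add: complex_eq_iff power2_norm_eq_inner)

text \<open>The real Cauchy-Schwarz inequality applies after rotating \<open>y\<close> by a phase that makes the inner product a nonnegative real.\<close>

lemma norm_cinner_le: "cmod (cinner x y) \<le> norm x * norm (y :: 'a::chilbert_space)"
proof (cases "cinner x y = 0")
  case False
  define z where "z = cinner x y"
  define c where "c = cnj z / of_real (cmod z)"
  have z: "z \<noteq> 0" using False by (simp add: z_def)
  have "z * cnj z = of_real (cmod z) * of_real (cmod z)"
    using complex_norm_square[of z] by (simp add: power2_eq_square)
  then have "c * z = of_real (cmod z)" using z by (simp add: c_def mult.commute)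
  then have "cmod (cinner x y) = Re (c * cinner x y)" by (simp add: z_def)
  also have "\<dots> = x \<bullet> (c *\<^sub>C y)" by (simp add: cinner_scaleC_right flip: Re_cinner)
  also have "\<dots> \<le> norm x * norm (c *\<^sub>C y)" by (rule norm_cauchy_schwarz)
  also have "norm (c *\<^sub>C y) = norm y" using z by (simp add: norm_scaleC c_def norm_divide)
  finally show ?thesis .
qed simp

lemma cinner_ext: "(\<And>x. cinner x y = cinner x z) \<Longrightarrow> y = (z :: 'a::chilbert_space)"
  by (metis Re_cinner inner_commute vector_eq_ldot)

lemma bounded_linear_cinner_right: "bounded_linear (\<lambda>y :: 'a::chilbert_space. cinner x y)"
proof (rule bounded_linear_intro[where K = "norm x"])
  show "cinner x (r *\<^sub>R y) = r *\<^sub>R cinner x y" for r and y :: 'a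
    using cinner_scaleC_right[of x "of_real r" y] by (simp add: scaleC_of_real scaleR_conv_of_real)
  show "norm (cinner x y) \<le> norm y * norm x" for y :: 'a
    using norm_cinner_le[of x y] by (simp add: mult.commute)
qed (simp add: cinner_add_right)

lift_definition ket :: "'a \<Rightarrow> 'a ell2" is "\<lambda>k x. if x = k then 1 else 0"
proof -
  fix k :: 'a
  have "(\<lambda>x. (cmod (if x = k then 1 else 0))\<^sup>2) summable_on {k}" by simp
  then show "(\<lambda>x. (cmod (if x = k then 1 else 0))\<^sup>2) summable_on UNIV"
    by (rule summable_on_cong_neutral[THEN iffD1, rotated -1]) auto
qed

lemma cinner_ket: "cinner (ket k) f = Rep_ell2 f k"
proof -
  have "cinner (ket k) f = (\<Sum>\<^sub>\<infinity>x. cnj (if x = k then 1 else 0) * Rep_ell2 f x)"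
    by (simp add: cinner_ell2.rep_eq ket.rep_eq)
  also have "\<dots> = (\<Sum>\<^sub>\<infinity>x\<in>{k}. Rep_ell2 f x)"
    by (rule infsum_cong_neutral) auto
  finally show ?thesis by simp
qed

lemma Rep_ell2_zero [simp]: "Rep_ell2 0 x = 0" by (simp add: zero_ell2.rep_eq)
lemma Rep_ell2_sum: "Rep_ell2 (\<Sum>i\<in>I. f i) x = (\<Sum>i\<in>I. Rep_ell2 (f i) x)"
  by (induction I rule: infinite_finite_induct) (simp_all add: plus_ell2.rep_eq)

lemma ell2_eqI: "(\<And>x. Rep_ell2 f x = Rep_ell2 g x) \<Longrightarrow> f = g"
  by (metis Rep_ell2_inverse ext)

lemma ell2_summable: "(\<lambda>x. (cmod (Rep_ell2 f x))\<^sup>2) summable_on A"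
  using Rep_ell2[of f] summable_on_subset_banach by blast

lemma ell2_has_sum_norm: "((\<lambda>x. (cmod (Rep_ell2 f x))\<^sup>2) has_sum (norm f)\<^sup>2) UNIV"
  unfolding norm_ell2_square by (rule has_sum_infsum[OF ell2_summable])

lemma ell2_has_sum_ket: "((\<lambda>k. Rep_ell2 f k *\<^sub>C ket k) has_sum f) UNIV"
  unfolding has_sum_def
proof (rule tendstoI)
  fix e :: real assume e: "e > 0"
  have "((\<lambda>F. \<Sum>x\<in>F. (cmod (Rep_ell2 f x))\<^sup>2) \<longlongrightarrow> (norm f)\<^sup>2) (finite_subsets_at_top UNIV)"
    using ell2_has_sum_norm unfolding has_sum_def .
  then have "\<forall>\<^sub>F F in finite_subsets_at_top UNIV. (norm f)\<^sup>2 - e\<^sup>2 < (\<Sum>x\<in>F. (cmod (Rep_ell2 f x))\<^sup>2)"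
    using e by (intro order_tendstoD) auto
  moreover have "\<forall>\<^sub>F F in finite_subsets_at_top (UNIV :: 'a set). finite F"
    by (rule eventually_finite_subsets_at_top_weakI)
  ultimately show "\<forall>\<^sub>F F in finite_subsets_at_top UNIV. dist (\<Sum>k\<in>F. Rep_ell2 f k *\<^sub>C ket k) f < e"
  proof eventually_elim
    case (elim F)
    let ?s = "\<Sum>k\<in>F. Rep_ell2 f k *\<^sub>C ket k"
    have rep: "Rep_ell2 (f - ?s) x = (if x \<in> F then 0 else Rep_ell2 f x)" for x
    proof -
      have "Rep_ell2 ?s x = (\<Sum>k\<in>F. if k = x then Rep_ell2 f k else 0)"
        unfolding Rep_ell2_sum by (intro sum.cong) (auto simp: scaleC_ell2.rep_eq ket.rep_eq)
      then show ?thesis using elim(2) by (simp add: minus_ell2.rep_eq)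
    qed
    have "((\<lambda>x. (cmod (Rep_ell2 f x))\<^sup>2) has_sum (\<Sum>x\<in>F. (cmod (Rep_ell2 f x))\<^sup>2)) F"
      using elim(2) by (rule has_sum_finite)
    then have "((\<lambda>x. (cmod (Rep_ell2 f x))\<^sup>2) has_sum ((norm f)\<^sup>2 - (\<Sum>x\<in>F. (cmod (Rep_ell2 f x))\<^sup>2))) (UNIV - F)"
      by (intro has_sum_Diff ell2_has_sum_norm) auto
    also have "?this \<longleftrightarrow> ((\<lambda>x. (cmod (Rep_ell2 (f - ?s) x))\<^sup>2) has_sum ((norm f)\<^sup>2 - (\<Sum>x\<in>F. (cmod (Rep_ell2 f x))\<^sup>2))) UNIV"
      by (rule has_sum_cong_neutral) (auto simp: rep)
    finally have "(norm (f - ?s))\<^sup>2 = (norm f)\<^sup>2 - (\<Sum>x\<in>F. (cmod (Rep_ell2 f x))\<^sup>2)"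
      using ell2_has_sum_norm has_sum_unique by blast
    then have "(norm (f - ?s))\<^sup>2 < e\<^sup>2" using elim(1) by simp
    then show ?case using e by (simp add: dist_norm norm_minus_commute power2_less_imp_less)
  qed
qed

lemma ket_eq_cinner_sum:
  assumes "bounded_linear T" "\<And>c x. T (c *\<^sub>C x) = c *\<^sub>C T x"
  shows "((\<lambda>k. Rep_ell2 f k *\<^sub>C T (ket k)) has_sum T f) UNIV"
  using has_sum_bounded_linear[OF assms(1) ell2_has_sum_ket[of f]] by (simp add: assms(2) o_def)

text \<open>The finite linear combinations of the basis vectors are dense, and bounded complex-linear operators are determined by their values there.\<close>

lemma clinear_op_ext_ket:
  assumes "clinear_op S" "clinear_op T" "\<And>k. blinfun_apply S (ket k) = blinfun_apply T (ket k)"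
  shows "S = (T :: 'a ell2 \<Rightarrow>\<^sub>L 'a ell2)"
proof (rule blinfun_eqI)
  fix f
  show "blinfun_apply S f = blinfun_apply T f"
    using ket_eq_cinner_sum[of "blinfun_apply S" f] ket_eq_cinner_sum[of "blinfun_apply T" f] assms
    by (auto simp: clinear_op_def blinfun.bounded_linear_right dest: has_sum_unique)
qed

text \<open>The coordinates of the adjoint applied to \<open>x\<close> are forced: they are \<open>cinner (T (ket k)) x\<close>. Pairing
\<open>x\<close> with \<open>T v\<close>, where \<open>v\<close> is built from finitely many of these coordinates, bounds their sum of squares
by \<open>(norm T * norm x)\<^sup>2\<close>, so they define a vector.\<close>

lemma ex_adjoint_ell2:
  fixes T :: "'a ell2 \<Rightarrow>\<^sub>L 'a ell2"
  assumes T: "clinear_op T"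
  shows "\<exists>S. \<forall>x y. cinner (blinfun_apply S x) y = cinner x (blinfun_apply T y)"
proof -
  define g where "g x k = cinner (blinfun_apply T (ket k)) x" for x k
  have bd: "(\<Sum>k\<in>F. (cmod (g x k))\<^sup>2) \<le> (norm T * norm x)\<^sup>2" if F: "finite F" for F x
  proof -
    define v where "v = (\<Sum>k\<in>F. g x k *\<^sub>C ket k)"
    define s where "s = (\<Sum>k\<in>F. (cmod (g x k))\<^sup>2)"
    have s0: "s \<ge> 0" by (simp add: s_def sum_nonneg)
    have kk: "cinner (ket j) (ket k) = (if j = k then 1 else 0)" for j k :: 'a
      by (simp add: cinner_ket ket.rep_eq)
    have "cinner v v = (\<Sum>k\<in>F. g x k * (\<Sum>j\<in>F. cnj (g x j) * (if j = k then 1 else 0)))"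
      unfolding v_def by (simp add: cinner_sum_left cinner_sum_right cinner_scaleC_left cinner_scaleC_right kk)
    also have "\<dots> = (\<Sum>k\<in>F. of_real ((cmod (g x k))\<^sup>2))"
      using F by (intro sum.cong refl) (simp add: complex_norm_square if_distrib[of "\<lambda>x. _ * x"] cong: if_cong del: of_real_power)
    finally have "of_real ((norm v)\<^sup>2) = (of_real s :: complex)"
      unfolding cinner_self s_def by simp
    then have nv: "(norm v)\<^sup>2 = s" by (simp only: of_real_eq_iff)
    have "cinner (blinfun_apply T v) x = (\<Sum>k\<in>F. of_real ((cmod (g x k))\<^sup>2))"
      unfolding v_def using T
      by (simp add: blinfun.sum_right cinner_sum_left cinner_scaleC_left clinear_op_def complex_norm_square mult.commute del: of_real_power flip: g_def)
    then have "s = cmod (cinner (blinfun_apply T v) x)"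
      using s0 unfolding s_def by (simp flip: of_real_sum of_real_power)
    also have "\<dots> \<le> norm T * norm v * norm x"
      by (intro order_trans[OF norm_cinner_le] mult_right_mono norm_blinfun) simp
    finally have le: "(norm v)\<^sup>2 \<le> norm T * norm x * norm v" unfolding nv by (simp add: mult_ac)
    have "norm v \<le> norm T * norm x"
    proof (cases "norm v = 0")
      case False
      then show ?thesis using le by (simp add: power2_eq_square)
    qed simp
    then have "(norm v)\<^sup>2 \<le> (norm T * norm x)\<^sup>2" by (intro power_mono) auto
    then show ?thesis unfolding nv s_def .
  qed
  have sm: "(\<lambda>k. (cmod (g x k))\<^sup>2) summable_on UNIV" for x
    using bd[of _ x] by (intro nonneg_bdd_above_summable_on bdd_aboveI2[where M = "(norm T * norm x)\<^sup>2"]) auto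
  define S where "S x = Abs_ell2 (g x)" for x
  have RepS: "Rep_ell2 (S x) = g x" for x
    unfolding S_def using sm[of x] by (intro Abs_ell2_inverse) simp
  have nS: "norm (S x) \<le> norm x * norm T" for x
  proof -
    have "(norm (S x))\<^sup>2 \<le> (norm T * norm x)\<^sup>2"
      unfolding norm_ell2_square RepS using bd sm by (intro infsum_le_finite_sums) auto
    then show ?thesis by (simp add: power2_le_iff_abs_le mult.commute)
  qed
  have blS: "bounded_linear S"
  proof (rule bounded_linear_intro[where K = "norm T"])
    show "S (x + y) = S x + S y" for x y
      by (rule ell2_eqI) (simp add: RepS plus_ell2.rep_eq g_def cinner_add_right)
    show "S (r *\<^sub>R x) = r *\<^sub>R S x" for r x
      by (rule ell2_eqI) (simp add: RepS scaleC_ell2.rep_eq g_def cinner_scaleC_right flip: scaleC_of_real)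
  qed (rule nS)
  have "cinner (S x) y = cinner x (blinfun_apply T y)" for x y
  proof -
    have "((\<lambda>k. Rep_ell2 y k *\<^sub>C blinfun_apply T (ket k)) has_sum blinfun_apply T y) UNIV"
      using T by (intro ket_eq_cinner_sum blinfun.bounded_linear_right) (simp add: clinear_op_def)
    from has_sum_bounded_linear[OF bounded_linear_cinner_right[of x] this]
    have "((\<lambda>k. cnj (g x k) * Rep_ell2 y k) has_sum cinner x (blinfun_apply T y)) UNIV"
      by (simp add: o_def cinner_scaleC_right g_def mult.commute flip: cinner_commute)
    then show ?thesis by (simp add: cinner_ell2.rep_eq RepS infsumI)
  qed
  then show ?thesis
    using blS by (intro exI[of _ "Blinfun S"]) (simp add: bounded_linear_Blinfun_apply)
qed

lemma adj_eqI:
  fixes S T :: "'h::chilbert_space \<Rightarrow>\<^sub>L 'h"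
  assumes "\<And>x y. cinner (blinfun_apply S x) y = cinner x (blinfun_apply T y)"
  shows "adj T = S"
  unfolding adj_def
proof (rule the_equality)
  fix R assume R: "\<forall>x y. cinner (blinfun_apply R x) y = cinner x (blinfun_apply T y)"
  show "R = S"
  proof (intro blinfun_eqI cinner_ext)
    fix x y show "cinner y (blinfun_apply R x) = cinner y (blinfun_apply S x)"
      using R assms by (metis cinner_commute)
  qed
qed (use assms in auto)

lemma cinner_adj:
  fixes T :: "'a ell2 \<Rightarrow>\<^sub>L 'a ell2"
  assumes "clinear_op T"
  shows "cinner (blinfun_apply (adj T) x) y = cinner x (blinfun_apply T y)"
proof -
  obtain S where "\<And>x y. cinner (blinfun_apply S x) y = cinner x (blinfun_apply T y)"
    using ex_adjoint_ell2[OF assms] by blast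
  then show ?thesis using adj_eqI[of S T] by simp
qed

lemma cinner_adj':
  fixes T :: "'a ell2 \<Rightarrow>\<^sub>L 'a ell2"
  assumes "clinear_op T"
  shows "cinner x (blinfun_apply (adj T) y) = cinner (blinfun_apply T x) y"
  by (metis assms cinner_adj cinner_commute)

lemma clinear_op_adj: "clinear_op T \<Longrightarrow> clinear_op (adj T)" for T :: "'a ell2 \<Rightarrow>\<^sub>L 'a ell2"
  unfolding clinear_op_def[of "adj T"]
  by (intro allI cinner_ext) (simp add: cinner_adj' cinner_scaleC_right)

lemma adj_adj: "clinear_op T \<Longrightarrow> adj (adj T) = T" for T :: "'a ell2 \<Rightarrow>\<^sub>L 'a ell2"
  by (rule adj_eqI) (simp add: cinner_adj')

lemma clinear_op_add: "clinear_op S \<Longrightarrow> clinear_op T \<Longrightarrow> clinear_op (S + T)"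
  by (simp add: clinear_op_def blinfun.add_left scaleC_add_right)
lemma clinear_op_diff: "clinear_op S \<Longrightarrow> clinear_op T \<Longrightarrow> clinear_op (S - T)"
  by (simp add: clinear_op_def blinfun.diff_left complex_vector.scale_right_diff_distrib)
lemma clinear_op_scaleC: "clinear_op T \<Longrightarrow> clinear_op (c *\<^sub>C T)"
  by (simp add: clinear_op_def scaleC_blinfun.rep_eq scaleC_scaleC mult.commute)
lemma clinear_op_compose: "clinear_op S \<Longrightarrow> clinear_op T \<Longrightarrow> clinear_op (S o\<^sub>L T)"
  by (simp add: clinear_op_def)
lemma clinear_op_zero: "clinear_op 0"
  by (simp add: clinear_op_def)
lemma clinear_op_id: "clinear_op id_blinfun"
  by (simp add: clinear_op_def)

lemma adj_add: "clinear_op S \<Longrightarrow> clinear_op T \<Longrightarrow> adj (S + T) = adj S + adj T" for S T :: "'a ell2 \<Rightarrow>\<^sub>L 'a ell2"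
  by (rule adj_eqI) (simp add: blinfun.add_left cinner_add_left cinner_add_right cinner_adj)
lemma adj_scaleC: "clinear_op T \<Longrightarrow> adj (c *\<^sub>C T) = cnj c *\<^sub>C adj T" for T :: "'a ell2 \<Rightarrow>\<^sub>L 'a ell2"
  by (rule adj_eqI) (simp add: scaleC_blinfun.rep_eq cinner_scaleC_left cinner_scaleC_right cinner_adj)
lemma adj_diff: "clinear_op S \<Longrightarrow> clinear_op T \<Longrightarrow> adj (S - T) = adj S - adj T" for S T :: "'a ell2 \<Rightarrow>\<^sub>L 'a ell2"
  using adj_add[of "S - T" T] clinear_op_diff[of S T] by simp
lemma adj_compose: "clinear_op S \<Longrightarrow> clinear_op T \<Longrightarrow> adj (S o\<^sub>L T) = adj T o\<^sub>L adj S" for S T :: "'a ell2 \<Rightarrow>\<^sub>L 'a ell2"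
  by (rule adj_eqI) (simp add: cinner_adj)
lemma adj_id: "adj id_blinfun = id_blinfun"
  by (rule adj_eqI) simp
lemma adj_zero: "adj 0 = 0"
  by (rule adj_eqI) simp

lemma norm_adj_le: "clinear_op T \<Longrightarrow> norm (adj T) \<le> norm T" for T :: "'a ell2 \<Rightarrow>\<^sub>L 'a ell2"
proof (rule norm_blinfun_bound)
  fix x assume T: "clinear_op T"
  let ?y = "blinfun_apply (adj T) x"
  have "(norm ?y)\<^sup>2 = cmod (cinner ?y ?y)" unfolding cinner_self by (simp add: norm_power)
  also have "\<dots> = cmod (cinner x (blinfun_apply T ?y))" using T by (simp add: cinner_adj)
  also have "\<dots> \<le> norm x * (norm T * norm ?y)"
    by (intro order_trans[OF norm_cinner_le] mult_left_mono norm_blinfun) simp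
  finally have le: "norm ?y * norm ?y \<le> norm T * norm x * norm ?y" by (simp add: power2_eq_square mult_ac)
  show "norm ?y \<le> norm T * norm x"
  proof (cases "norm ?y = 0")
    case False
    then show ?thesis using le by simp
  qed simp
qed simp

lemma norm_adj: "clinear_op T \<Longrightarrow> norm (adj T) = norm T" for T :: "'a ell2 \<Rightarrow>\<^sub>L 'a ell2"
  using norm_adj_le[of T] norm_adj_le[of "adj T"] clinear_op_adj[of T] adj_adj[of T] by simp

lemma closed_clinear_op: "closed {T :: 'h::chilbert_space \<Rightarrow>\<^sub>L 'h. clinear_op T}"
proof -
  have "closed {T :: 'h \<Rightarrow>\<^sub>L 'h. blinfun_apply T (c *\<^sub>C x) = c *\<^sub>C blinfun_apply T x}" for c x
    by (intro closed_Collect_eq bounded_linear.continuous_on[OF blinfun.bounded_linear_left]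
        bounded_linear.continuous_on[OF bounded_linear_scaleC] continuous_on_id)
  then have "closed (\<Inter>c. \<Inter>x. {T :: 'h \<Rightarrow>\<^sub>L 'h. blinfun_apply T (c *\<^sub>C x) = c *\<^sub>C blinfun_apply T x})"
    by (intro closed_INT ballI)
  also have "(\<Inter>c. \<Inter>x. {T :: 'h \<Rightarrow>\<^sub>L 'h. blinfun_apply T (c *\<^sub>C x) = c *\<^sub>C blinfun_apply T x}) = {T. clinear_op T}"
    by (auto simp: clinear_op_def)
  finally show ?thesis .
qed

lemma norm_scaleC_blinfun: "norm (c *\<^sub>C T) = cmod c * norm (T :: 'h::chilbert_space \<Rightarrow>\<^sub>L 'h)"
proof -
  have le: "norm (c *\<^sub>C T) \<le> cmod c * norm T" for c and T :: "'h \<Rightarrow>\<^sub>L 'h"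
    by (rule norm_blinfun_bound)
      (simp_all add: scaleC_blinfun.rep_eq norm_scaleC mult.assoc mult_left_mono norm_blinfun)
  show ?thesis
  proof (cases "c = 0")
    case False
    have "norm T = norm (inverse c *\<^sub>C c *\<^sub>C T)" using False by (simp add: scaleC_scaleC)
    also have "\<dots> \<le> inverse (cmod c) * norm (c *\<^sub>C T)" using le[of "inverse c" "c *\<^sub>C T"] by (simp add: norm_inverse)
    finally have "cmod c * norm T \<le> norm (c *\<^sub>C T)" using False by (simp add: field_simps)
    then show ?thesis using le[of c T] by simp
  qed simp
qed

section \<open>Contractivity of homomorphisms\<close>

lemma clinear_on_diff:
  assumes "csubspace A" "clinear_on A f" "x \<in> A" "y \<in> A"
  shows "f (x - y) = f x - f y"
proof -
  have "(- 1) *\<^sub>C y \<in> A" using assms by (intro complex_vector.subspace_scale)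
  then have "f (x + (- 1) *\<^sub>C y) = f x + (- 1) *\<^sub>C f y"
    using assms unfolding clinear_on_def by metis
  then show ?thesis by simp
qed

lemma cstar_algebraD:
  assumes "cstar_algebra A"
  shows "csubspace A" "closed A" "T \<in> A \<Longrightarrow> clinear_op T" "S \<in> A \<Longrightarrow> T \<in> A \<Longrightarrow> S o\<^sub>L T \<in> A"
    "T \<in> A \<Longrightarrow> adj T \<in> A" "S \<in> A \<Longrightarrow> T \<in> A \<Longrightarrow> S + T \<in> A" "S \<in> A \<Longrightarrow> T \<in> A \<Longrightarrow> S - T \<in> A"
    "T \<in> A \<Longrightarrow> c *\<^sub>C T \<in> A" "0 \<in> A"
  using assms by (auto simp: cstar_algebra_def complex_vector.subspace_add complex_vector.subspace_diff
      complex_vector.subspace_scale complex_vector.subspace_0)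

lemma blinfun_compose_diff_left: "(S - T) o\<^sub>L R = (S o\<^sub>L R) - (T o\<^sub>L R)"
  by (rule blinfun_eqI) (simp add: blinfun.diff_left)
lemma blinfun_compose_diff_right: "R o\<^sub>L (S - T) = (R o\<^sub>L S) - (R o\<^sub>L T)"
  by (rule blinfun_eqI) (simp add: blinfun.diff_right blinfun.diff_left)
lemma blinfun_compose_id_left [simp]: "id_blinfun o\<^sub>L T = T"
  by (rule blinfun_eqI) simp
lemma blinfun_compose_id_right [simp]: "T o\<^sub>L id_blinfun = T"
  by (rule blinfun_eqI) simp

text \<open>Write \<open>R = 1 - Y\<close>; then \<open>R\<^sup>2 = 1 - X\<close> says that \<open>Y\<close> is a fixed point of \<open>Y \<mapsto> (X + Y\<^sup>2) / 2\<close>.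
This map preserves the self-adjoint elements of norm at most \<open>q = norm X\<close>, because \<open>q + q\<^sup>2 \<le> 2 q\<close>,
and contracts distances there by the factor \<open>q < 1\<close>.\<close>

lemma sqrt_one_minus_in_cstar_algebra:
  fixes A :: "('a ell2 \<Rightarrow>\<^sub>L 'a ell2) set"
  assumes A: "cstar_algebra A" and one: "id_blinfun \<in> A"
    and X: "X \<in> A" "adj X = X" "norm X < 1"
  obtains R where "R \<in> A" "adj R = R" "R o\<^sub>L R = id_blinfun - X"
proof -
  note AD = cstar_algebraD[OF A]
  define q where "q = norm X"
  have q: "0 \<le> q" "q < 1" using X by (auto simp: q_def)
  define D where "D = {Y \<in> A. adj Y = Y \<and> norm Y \<le> q}"
  define F where "F Y = (1/2 :: complex) *\<^sub>C (X + (Y o\<^sub>L Y))" for Y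
  \<comment> \<open>Self-adjointness is expressed by inner products to see that \<open>D\<close> is closed.\<close>
  have D_alt: "D = A \<inter> (\<Inter>x. \<Inter>y. {Y. cinner (blinfun_apply Y x) y = cinner x (blinfun_apply Y y)}) \<inter> cball 0 q"
  proof -
    have "adj Y = Y \<longleftrightarrow> (\<forall>x y. cinner (blinfun_apply Y x) y = cinner x (blinfun_apply Y y))" if "Y \<in> A" for Y
      using cinner_adj[OF AD(3)[OF that]] adj_eqI[of Y Y] by metis
    then show ?thesis by (auto simp: D_def)
  qed
  have cont: "continuous_on UNIV (\<lambda>Y :: 'a ell2 \<Rightarrow>\<^sub>L 'a ell2. blinfun_apply Y x)" for x
    by (intro bounded_linear.continuous_on[OF blinfun.bounded_linear_left] continuous_on_id)
  have "closed {Y :: 'a ell2 \<Rightarrow>\<^sub>L 'a ell2. cinner (blinfun_apply Y x) y = cinner x (blinfun_apply Y y)}" for x y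
  proof (rule closed_Collect_eq)
    show "continuous_on UNIV (\<lambda>Y :: 'a ell2 \<Rightarrow>\<^sub>L 'a ell2. cinner x (blinfun_apply Y y))"
      by (intro bounded_linear.continuous_on[OF bounded_linear_cinner_right] cont)
    have "continuous_on UNIV (\<lambda>Y :: 'a ell2 \<Rightarrow>\<^sub>L 'a ell2. cnj (cinner y (blinfun_apply Y x)))"
      by (intro continuous_on_cnj bounded_linear.continuous_on[OF bounded_linear_cinner_right] cont)
    then show "continuous_on UNIV (\<lambda>Y :: 'a ell2 \<Rightarrow>\<^sub>L 'a ell2. cinner (blinfun_apply Y x) y)"
      by (simp flip: cinner_commute)
  qed
  then have "closed D" unfolding D_alt by (intro closed_Int closed_INT ballI AD(2) closed_cball)
  then have "complete D" by (simp add: complete_eq_closed)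
  moreover have "0 \<in> D" using AD(9) q by (simp add: D_def adj_zero)
  then have "D \<noteq> {}" by blast
  moreover have "F ` D \<subseteq> D"
  proof (intro image_subsetI)
    fix Y assume Y: "Y \<in> D"
    have "Y \<in> A" "adj Y = Y" "norm Y \<le> q" using Y by (auto simp: D_def)
    moreover have "F Y \<in> A" using AD X \<open>Y \<in> A\<close> by (simp add: F_def)
    moreover have "adj (F Y) = F Y"
      using AD(3) X \<open>Y \<in> A\<close> \<open>adj Y = Y\<close>
      by (simp add: F_def adj_scaleC adj_add adj_compose clinear_op_add clinear_op_compose)
    moreover have "norm (F Y) \<le> q"
    proof -
      have "norm (Y o\<^sub>L Y) \<le> q * q"
        using norm_blinfun_compose[of Y Y] \<open>norm Y \<le> q\<close> q by (meson mult_mono norm_ge_zero order_trans)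
      also have "\<dots> \<le> q" using q by (simp add: mult_left_le)
      finally have "norm (X + (Y o\<^sub>L Y)) \<le> q + q" by (intro order_trans[OF norm_triangle_ineq] add_mono) (auto simp: q_def)
      then show ?thesis by (simp add: F_def norm_scaleC_blinfun norm_divide)
    qed
    ultimately show "F Y \<in> D" by (simp add: D_def)
  qed
  moreover have "dist (F Y) (F Z) \<le> q * dist Y Z" if YZ: "Y \<in> D" "Z \<in> D" for Y Z
  proof -
    have n: "norm Y \<le> q" "norm Z \<le> q" using YZ by (auto simp: D_def)
    have "F Y - F Z = (1/2 :: complex) *\<^sub>C ((Y o\<^sub>L (Y - Z)) + ((Y - Z) o\<^sub>L Z))"
      unfolding F_def by (simp add: blinfun_compose_diff_left blinfun_compose_diff_right
          flip: complex_vector.scale_right_diff_distrib)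
    also have "norm \<dots> = norm ((Y o\<^sub>L (Y - Z)) + ((Y - Z) o\<^sub>L Z)) / 2"
      by (simp add: norm_scaleC_blinfun norm_divide)
    also have "norm ((Y o\<^sub>L (Y - Z)) + ((Y - Z) o\<^sub>L Z)) \<le> q * norm (Y - Z) + norm (Y - Z) * q"
      using n q by (intro order_trans[OF norm_triangle_ineq] add_mono order_trans[OF norm_blinfun_compose] mult_mono) auto
    finally show ?thesis by (simp add: dist_norm mult.commute)
  qed
  ultimately obtain Y where Y: "Y \<in> D" "F Y = Y"
    using Banach_fix[of D q F] q by blast
  have YA: "Y \<in> A" "adj Y = Y" using Y by (auto simp: D_def)
  have "X + (Y o\<^sub>L Y) = (2 :: complex) *\<^sub>C F Y" by (simp add: F_def scaleC_scaleC)
  also have "\<dots> = Y + Y" unfolding Y(2) using scaleC_add_left[of 1 1 Y] by simp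
  finally have YY: "Y o\<^sub>L Y = Y + Y - X" by (simp add: algebra_simps)
  have "(id_blinfun - Y) o\<^sub>L (id_blinfun - Y) = id_blinfun - X"
    by (simp add: blinfun_compose_diff_left blinfun_compose_diff_right YY)
  moreover have "id_blinfun - Y \<in> A" using AD one YA by simp
  moreover have "adj (id_blinfun - Y) = id_blinfun - Y"
    using AD(3) YA by (simp add: adj_diff adj_id clinear_op_id)
  ultimately show ?thesis using that by blast
qed

text \<open>If \<open>norm T < 1\<close>, then \<open>1 - T\<^sup>* T = R\<^sup>2\<close> with \<open>R\<close> self-adjoint in the algebra. Applying \<open>f\<close> gives
\<open>norm (f T x)\<^sup>2 = norm x\<^sup>2 - norm (f R x)\<^sup>2 \<le> norm x\<^sup>2\<close>. The general case follows by scaling.\<close>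

lemma unital_star_hom_contractive:
  fixes A :: "('a ell2 \<Rightarrow>\<^sub>L 'a ell2) set" and f :: "_ \<Rightarrow> 'b ell2 \<Rightarrow>\<^sub>L 'b ell2"
  assumes A: "cstar_algebra A" and one: "id_blinfun \<in> A" "f id_blinfun = id_blinfun"
    and f: "star_hom A f" "\<And>T. T \<in> A \<Longrightarrow> clinear_op (f T)" and T: "T \<in> A"
  shows "norm (f T) \<le> norm T"
proof -
  note AD = cstar_algebraD[OF A]
  have lin: "clinear_on A f" using f by (simp add: star_hom_def)
  have unit: "norm (f T) \<le> 1" if T: "T \<in> A" "norm T < 1" for T
  proof -
    define X where "X = adj T o\<^sub>L T"
    have X: "X \<in> A" using AD T by (simp add: X_def)
    have sa: "adj X = X" using AD(3,5) T by (simp add: X_def adj_compose adj_adj clinear_op_adj)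
    have "norm X \<le> norm T * norm T"
      unfolding X_def using norm_blinfun_compose[of "adj T" T] AD(3)[OF T(1)] by (simp add: norm_adj)
    also have "\<dots> < 1" using T by (metis mult_less_cancel_right2 norm_ge_zero mult_strict_mono' mult_1)
    finally have "norm X < 1" .
    then obtain R where R: "R \<in> A" "adj R = R" "R o\<^sub>L R = id_blinfun - X"
      using sqrt_one_minus_in_cstar_algebra[OF A one(1) X sa] by blast
    have fR: "f R o\<^sub>L f R = id_blinfun - (adj (f T) o\<^sub>L f T)"
    proof -
      have "f R o\<^sub>L f R = f (R o\<^sub>L R)" using f(1) R(1) unfolding star_hom_def by metis
      also have "\<dots> = f id_blinfun - f X"
        unfolding R(3) by (rule clinear_on_diff[OF AD(1) lin one(1) X])
      also have "f X = adj (f T) o\<^sub>L f T"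
        unfolding X_def using f T AD(5) by (simp add: star_hom_def)
      finally show ?thesis using one by simp
    qed
    have adjfR: "adj (f R) = f R" using f R by (metis star_hom_def)
    have "norm (blinfun_apply (f T) x) \<le> norm x" for x
    proof -
      have "cinner (blinfun_apply (f R) x) (blinfun_apply (f R) x) = cinner x (blinfun_apply (f R o\<^sub>L f R) x)"
        using cinner_adj[OF f(2)[OF R(1)], of x] adjfR by simp
      also have "\<dots> = cinner x x - cinner (blinfun_apply (f T) x) (blinfun_apply (f T) x)"
        unfolding fR using f(2) T by (simp add: blinfun.diff_left cinner_diff_right cinner_adj')
      finally have "of_real ((norm (blinfun_apply (f R) x))\<^sup>2) = (of_real ((norm x)\<^sup>2 - (norm (blinfun_apply (f T) x))\<^sup>2) :: complex)"
        unfolding cinner_self by simp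
      then have "(norm (blinfun_apply (f R) x))\<^sup>2 = (norm x)\<^sup>2 - (norm (blinfun_apply (f T) x))\<^sup>2"
        by (simp only: of_real_eq_iff)
      then have "(norm (blinfun_apply (f T) x))\<^sup>2 \<le> (norm x)\<^sup>2"
        using zero_le_power2[of "norm (blinfun_apply (f R) x)"] by linarith
      then show ?thesis by (simp add: power2_le_iff_abs_le)
    qed
    then show ?thesis by (intro norm_blinfun_bound) auto
  qed
  show ?thesis
  proof (rule field_le_epsilon)
    fix e :: real assume e: "e > 0"
    define c where "c = 1 / (norm T + e)"
    have ne: "norm T + e > 0" using e by (simp add: add_nonneg_pos)
    then have c: "c > 0" by (simp add: c_def)
    have "norm (of_real c *\<^sub>C T) < 1"
    proof -
      have "c * norm T < 1" using e ne by (simp add: c_def)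
      then show ?thesis using c by (simp add: norm_scaleC_blinfun)
    qed
    then have "norm (f (of_real c *\<^sub>C T)) \<le> 1"
      using unit[of "of_real c *\<^sub>C T"] AD(8) T by blast
    moreover have "f (of_real c *\<^sub>C T) = of_real c *\<^sub>C f T"
      using lin T by (simp add: clinear_on_def)
    ultimately have "c * norm (f T) \<le> 1" using c by (simp add: norm_scaleC_blinfun)
    then show "norm (f T) \<le> norm T + e" using ne by (simp add: c_def field_simps)
  qed
qed

section \<open>The reduced group C*-algebra\<close>

lemma Rep_left_regular: "Rep_ell2 (blinfun_apply (left_regular s) f) x = Rep_ell2 f (- s + x)"
  by (simp add: left_regular.rep_eq translate_ell2.rep_eq)

lemma clinear_op_left_regular: "clinear_op (left_regular s)"
  unfolding clinear_op_def by (intro allI ell2_eqI) (simp add: Rep_left_regular scaleC_ell2.rep_eq)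

lemma left_regular_add: "left_regular (s + t) = left_regular s o\<^sub>L left_regular t"
proof (intro blinfun_eqI ell2_eqI)
  fix f x
  have "- (s + t) + x = - t + (- s + x)" by (metis minus_add add.assoc)
  then show "Rep_ell2 (blinfun_apply (left_regular (s + t)) f) x
      = Rep_ell2 (blinfun_apply (left_regular s o\<^sub>L left_regular t) f) x"
    by (simp add: Rep_left_regular)
qed

lemma left_regular_0: "left_regular 0 = id_blinfun"
  by (intro blinfun_eqI ell2_eqI) (simp add: Rep_left_regular)

lemma norm_left_regular_apply: "norm (blinfun_apply (left_regular s) f) = norm f"
  by (simp add: left_regular.rep_eq norm_translate_ell2)

lemma adj_left_regular: "adj (left_regular s) = left_regular (- s)"
proof (rule adj_eqI)
  fix f g
  have "cinner (blinfun_apply (left_regular (- s)) f) g = (\<Sum>\<^sub>\<infinity>x. cnj (Rep_ell2 f (s + x)) * Rep_ell2 g x)"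
    by (simp add: cinner_ell2.rep_eq Rep_left_regular)
  also have "\<dots> = (\<Sum>\<^sub>\<infinity>x. cnj (Rep_ell2 f x) * Rep_ell2 g (- s + x))"
    by (rule infsum_reindex_bij_witness[where i = "\<lambda>x. - s + x" and j = "\<lambda>x. s + x"]) (auto simp: add.assoc[symmetric])
  also have "\<dots> = cinner f (blinfun_apply (left_regular s) g)"
    by (simp add: cinner_ell2.rep_eq Rep_left_regular)
  finally show "cinner (blinfun_apply (left_regular (- s)) f) g = cinner f (blinfun_apply (left_regular s) g)" .
qed

lemma clinear_op_cspan_left_regular: "T \<in> cspan (range left_regular) \<Longrightarrow> clinear_op T"
  by (induction rule: complex_vector.span_induct_alt)
    (auto intro: clinear_op_zero clinear_op_add clinear_op_scaleC clinear_op_left_regular)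

lemma compose_cspan_left_regular:
  assumes "S \<in> cspan (range left_regular)" "T \<in> cspan (range left_regular)"
  shows "S o\<^sub>L T \<in> cspan (range left_regular)"
  using assms(1)
proof (induction rule: complex_vector.span_induct_alt)
  case base
  have "0 o\<^sub>L T = 0" by (rule blinfun_eqI) simp
  then show ?case by (simp add: complex_vector.span_zero)
next
  case (step c S R)
  then obtain s where s: "S = left_regular s" by auto
  have "left_regular s o\<^sub>L T \<in> cspan (range left_regular)"
    using assms(2)
  proof (induction rule: complex_vector.span_induct_alt)
    case base
    have "left_regular s o\<^sub>L 0 = 0" by (rule blinfun_eqI) simp
    then show ?case by (simp add: complex_vector.span_zero)
  next
    case (step d T' T)
    then obtain t where t: "T' = left_regular t" by auto
    have "left_regular s o\<^sub>L (d *\<^sub>C T' + T) = d *\<^sub>C left_regular (s + t) + (left_regular s o\<^sub>L T)"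
      using clinear_op_left_regular[of s]
      by (intro blinfun_eqI) (simp add: t left_regular_add blinfun.add_left blinfun.add_right scaleC_blinfun.rep_eq clinear_op_def)
    then show ?case using step.IH
      by (simp add: complex_vector.span_add complex_vector.span_scale complex_vector.span_base)
  qed
  moreover have "(c *\<^sub>C S + R) o\<^sub>L T = c *\<^sub>C (left_regular s o\<^sub>L T) + (R o\<^sub>L T)"
    by (rule blinfun_eqI) (simp add: s blinfun.add_left scaleC_blinfun.rep_eq)
  ultimately show ?case using step
    by (simp add: complex_vector.span_add complex_vector.span_scale)
qed

lemma adj_cspan_left_regular:
  assumes "T \<in> cspan (range left_regular)"
  shows "adj T \<in> cspan (range left_regular)"
proof -
  have "clinear_op T \<and> adj T \<in> cspan (range left_regular)"
    using assms
  proof (induction rule: complex_vector.span_induct_alt)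
    case base
    show ?case by (simp add: adj_zero clinear_op_zero complex_vector.span_zero)
  next
    case (step c S R)
    then obtain s where s: "S = left_regular s" by auto
    then have S: "clinear_op S" "adj S \<in> cspan (range left_regular)"
      by (auto simp: clinear_op_left_regular adj_left_regular intro: complex_vector.span_base)
    then show ?case using step
      by (simp add: adj_add adj_scaleC clinear_op_add clinear_op_scaleC
          complex_vector.span_add complex_vector.span_scale)
  qed
  then show ?thesis by blast
qed

lemma bounded_linear_scaleC_blinfun: "bounded_linear (\<lambda>T :: 'h::chilbert_space \<Rightarrow>\<^sub>L 'h. c *\<^sub>C T)"
proof (rule bounded_linear_intro[where K = "cmod c"])
  show "c *\<^sub>C r *\<^sub>R x = r *\<^sub>R c *\<^sub>C x" for r and x :: "'h \<Rightarrow>\<^sub>L 'h"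
    by (metis mult.commute scaleC_of_real scaleC_scaleC)
qed (simp_all add: scaleC_add_right norm_scaleC_blinfun mult.commute)

lemma clinear_op_reduced_group_cstar: "T \<in> reduced_group_cstar \<Longrightarrow> clinear_op T"
  using closure_minimal[OF _ closed_clinear_op, of "cspan (range left_regular)"] clinear_op_cspan_left_regular
  unfolding reduced_group_cstar_def by blast

lemma closure_sequenceE:
  fixes x :: "'a::metric_space"
  assumes "x \<in> closure S"
  obtains X where "\<And>n. X n \<in> S" "X \<longlonglongrightarrow> x"
proof -
  have "\<exists>X. (\<forall>n. X n \<in> S) \<and> X \<longlonglongrightarrow> x" using assms by (simp only: closure_sequential)
  then obtain X where "(\<forall>n. X n \<in> S) \<and> X \<longlonglongrightarrow> x" ..
  then show ?thesis using that[of X] by simp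
qed

text \<open>The span of the group elements is a *-algebra, and the algebraic operations are continuous; for the
adjoint this is because it preserves the norm.\<close>

lemma cstar_algebra_reduced_group_cstar: "cstar_algebra (reduced_group_cstar :: ('g::group_add ell2 \<Rightarrow>\<^sub>L 'g ell2) set)"
proof -
  let ?V = "cspan (range left_regular) :: ('g ell2 \<Rightarrow>\<^sub>L 'g ell2) set"
  have A: "reduced_group_cstar = closure ?V" by (simp add: reduced_group_cstar_def)
  have "csubspace (closure ?V)"
  proof (rule complex_vector.subspaceI)
    show "0 \<in> closure ?V" using closure_subset complex_vector.span_zero by blast
    show "S + T \<in> closure ?V" if hS: "S \<in> closure ?V" and hT: "T \<in> closure ?V" for S T
    proof -
      obtain X where "\<And>n. X n \<in> ?V" "X \<longlonglongrightarrow> S"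
        using hS by (rule closure_sequenceE) (rule that)
      moreover obtain Y where "\<And>n. Y n \<in> ?V" "Y \<longlonglongrightarrow> T"
        using hT by (rule closure_sequenceE) (rule that)
      ultimately have "(\<lambda>n. X n + Y n) \<longlonglongrightarrow> S + T" "\<And>n. X n + Y n \<in> ?V"
        by (auto intro: tendsto_add complex_vector.span_add)
      then show ?thesis unfolding closure_sequential by (intro exI conjI allI)
    qed
    show "c *\<^sub>C T \<in> closure ?V" if hT: "T \<in> closure ?V" for c T
    proof -
      obtain Y where "\<And>n. Y n \<in> ?V" "Y \<longlonglongrightarrow> T"
        using hT by (rule closure_sequenceE) (rule that)
      then have "(\<lambda>n. c *\<^sub>C Y n) \<longlonglongrightarrow> c *\<^sub>C T" "\<And>n. c *\<^sub>C Y n \<in> ?V"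
        by (auto intro: bounded_linear.tendsto[OF bounded_linear_scaleC_blinfun] complex_vector.span_scale)
      then show ?thesis unfolding closure_sequential by (intro exI conjI allI)
    qed
  qed
  moreover have "S o\<^sub>L T \<in> closure ?V" if hS: "S \<in> closure ?V" and hT: "T \<in> closure ?V" for S T
  proof -
    obtain X where "\<And>n. X n \<in> ?V" "X \<longlonglongrightarrow> S"
      using hS by (rule closure_sequenceE) (rule that)
    moreover obtain Y where "\<And>n. Y n \<in> ?V" "Y \<longlonglongrightarrow> T"
      using hT by (rule closure_sequenceE) (rule that)
    ultimately have "(\<lambda>n. X n o\<^sub>L Y n) \<longlonglongrightarrow> (S o\<^sub>L T)" "\<And>n. X n o\<^sub>L Y n \<in> ?V"
      by (auto intro: bounded_bilinear.tendsto[OF bounded_bilinear_blinfun_compose] compose_cspan_left_regular)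
    then show ?thesis unfolding closure_sequential by (intro exI conjI allI)
  qed
  moreover have "adj T \<in> closure ?V" if hT: "T \<in> closure ?V" for T
  proof -
    obtain Y where Y: "\<And>n. Y n \<in> ?V" "Y \<longlonglongrightarrow> T"
      using hT by (rule closure_sequenceE) (rule that)
    have cT: "clinear_op T" using hT clinear_op_reduced_group_cstar A by blast
    have "norm (adj (Y n) - adj T) = norm (Y n - T)" for n
      using clinear_op_cspan_left_regular[OF Y(1), of n] cT
      by (simp add: norm_adj clinear_op_diff flip: adj_diff)
    then have "(\<lambda>n. adj (Y n)) \<longlonglongrightarrow> adj T"
      using Y(2) by (simp add: tendsto_iff dist_norm)
    moreover have "\<And>n. adj (Y n) \<in> ?V" using Y adj_cspan_left_regular by blast
    ultimately show ?thesis unfolding closure_sequential by (intro exI conjI allI)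
  qed
  ultimately show ?thesis
    unfolding cstar_algebra_def A
    using closed_closure clinear_op_reduced_group_cstar[unfolded reduced_group_cstar_def] by auto
qed

lemma left_regular_in_reduced_group_cstar: "left_regular s \<in> reduced_group_cstar"
  unfolding reduced_group_cstar_def
  by (rule subsetD[OF closure_subset complex_vector.span_base]) simp

lemma id_in_reduced_group_cstar: "id_blinfun \<in> reduced_group_cstar"
  using left_regular_in_reduced_group_cstar[of 0] by (simp add: left_regular_0)

lemma reduced_group_cstar_approx:
  assumes "T \<in> reduced_group_cstar" "e > 0"
  obtains S where "S \<in> cspan (range left_regular)" "norm (T - S) < e"
proof -
  have "\<exists>S\<in>cspan (range left_regular). dist S T < e"
    using assms closure_approachable[of T "cspan (range left_regular)"]
    by (simp add: reduced_group_cstar_def)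
  then obtain S where "S \<in> cspan (range left_regular)" "dist S T < e" ..
  then show ?thesis using that[of S] by (simp add: dist_norm norm_minus_commute)
qed

section \<open>The free shift\<close>

definition shift_letter :: "int \<times> bool \<Rightarrow> int \<times> bool" where
  "shift_letter l = (fst l + 1, snd l)"

lemma inv_shift_letter: "inv_letter (shift_letter l) = shift_letter (inv_letter l)"
  by (simp add: inv_letter_def shift_letter_def)

lemma shift_letter_eq_iff: "shift_letter l = shift_letter m \<longleftrightarrow> l = m"
  by (simp add: shift_letter_def prod_eq_iff)

lemma reduced_map_shift_letter: "reduced_word (map shift_letter w) = reduced_word w"
  by (induction w rule: reduced_word.induct) (simp_all add: inv_shift_letter shift_letter_eq_iff)

lift_definition shift_group :: "int free_group \<Rightarrow> int free_group" is "map shift_letter"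
  by (simp add: reduced_map_shift_letter)

lift_definition letter :: "'a \<times> bool \<Rightarrow> 'a free_group" is "\<lambda>l. [l]" by simp

lemma letter_True: "letter (a, True) = generator a"
  by transfer simp
lemma letter_False: "letter (a, False) = - generator a"
  by transfer (simp add: inv_letter_def)

lemma append_red_reduced: "reduced_word (v @ w) \<Longrightarrow> append_red v w = v @ w"
proof (induction v)
  case (Cons l v)
  then have "append_red v w = v @ w" by (auto dest: reduced_ConsD)
  then show ?case using Cons.prems by (cases "v @ w") auto
qed simp

lemma reduced_appendD1: "reduced_word (v @ w) \<Longrightarrow> reduced_word v"
  by (induction v rule: reduced_word.induct) auto

lemma reduced_appendD2: "reduced_word (v @ w) \<Longrightarrow> reduced_word w"
  by (induction v) (auto dest: reduced_ConsD)

lemma Abs_free_group_append: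
  assumes "reduced_word (v @ w)"
  shows "Abs_free_group (v @ w) = Abs_free_group v + Abs_free_group w"
  using assms reduced_appendD1[OF assms] reduced_appendD2[OF assms]
  by (simp add: plus_free_group.abs_eq eq_onp_def append_red_reduced)

lemma reduced_Rep_free_group: "reduced_word (Rep_free_group g)"
  using Rep_free_group[of g] by simp

lemma Rep_shift_group_power: "Rep_free_group ((shift_group ^^ k) g) = map (shift_letter ^^ k) (Rep_free_group g)"
  by (induction k) (auto simp: shift_group.rep_eq)

lemma shift_letter_power: "(shift_letter ^^ k) l = (fst l + int k, snd l)"
  by (induction k) (auto simp: shift_letter_def)

text \<open>The automorphism is only given on the generators. Being multiplicative, unital and
*-preserving it sends each group element to the shifted one, and contractivity carries estimates from
the span of the group elements over to the whole algebra.\<close>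

locale free_shift =
  fixes \<alpha> :: "(int free_group ell2 \<Rightarrow>\<^sub>L int free_group ell2) \<Rightarrow> (int free_group ell2 \<Rightarrow>\<^sub>L int free_group ell2)"
  assumes automorphism: "cstar_automorphism reduced_group_cstar \<alpha>"
    and shift_generators: "\<And>i. \<alpha> (left_regular (generator i)) = left_regular (generator (i + 1))"
begin

abbreviation "A \<equiv> (reduced_group_cstar :: (int free_group ell2 \<Rightarrow>\<^sub>L int free_group ell2) set)"

lemma maps: "T \<in> A \<Longrightarrow> \<alpha> T \<in> A"
  using automorphism unfolding cstar_automorphism_def bij_betw_def by blast

lemma hom: "star_hom A \<alpha>"
  using automorphism by (simp add: cstar_automorphism_def)

lemma mult: "S \<in> A \<Longrightarrow> T \<in> A \<Longrightarrow> \<alpha> (S o\<^sub>L T) = \<alpha> S o\<^sub>L \<alpha> T"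
  using hom by (simp add: star_hom_def)

text \<open>A surjective multiplicative map sends the unit to a unit of the image.\<close>

lemma unital: "\<alpha> id_blinfun = id_blinfun"
proof -
  obtain T where T: "T \<in> A" "\<alpha> T = id_blinfun"
    using automorphism id_in_reduced_group_cstar unfolding cstar_automorphism_def bij_betw_def by (metis imageE)
  have "\<alpha> id_blinfun o\<^sub>L \<alpha> T = \<alpha> (id_blinfun o\<^sub>L T)"
    using mult[OF id_in_reduced_group_cstar T(1)] by (rule sym)
  then show ?thesis by (simp add: T(2))
qed

lemma contractive: "T \<in> A \<Longrightarrow> norm (\<alpha> T) \<le> norm T"
  by (rule unital_star_hom_contractive[OF cstar_algebra_reduced_group_cstar id_in_reduced_group_cstar unital hom])
    (auto intro: clinear_op_reduced_group_cstar maps)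

lemma letter: "\<alpha> (left_regular (letter l)) = left_regular (letter (shift_letter l))"
proof (cases "snd l")
  case True
  then have "l = (fst l, True)" by (simp add: prod_eq_iff)
  then show ?thesis using shift_generators[of "fst l"] by (metis letter_True shift_letter_def fst_conv snd_conv)
next
  case False
  then have l: "l = (fst l, False)" by (simp add: prod_eq_iff)
  have "\<alpha> (left_regular (- generator (fst l))) = \<alpha> (adj (left_regular (generator (fst l))))"
    by (simp add: adj_left_regular)
  also have "\<dots> = adj (\<alpha> (left_regular (generator (fst l))))"
    using hom left_regular_in_reduced_group_cstar unfolding star_hom_def by blast
  also have "\<dots> = left_regular (- generator (fst l + 1))"
    by (simp add: shift_generators adj_left_regular)
  finally show ?thesis using l by (metis letter_False shift_letter_def fst_conv snd_conv)
qed

lemma word: "reduced_word w \<Longrightarrow> \<alpha> (left_regular (Abs_free_group w)) = left_regular (Abs_free_group (map shift_letter w))"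
proof (induction w)
  case Nil
  have "Abs_free_group [] = (0 :: int free_group)" by (simp add: zero_free_group_def)
  then show ?case by (simp add: left_regular_0 unital)
next
  case (Cons l w)
  have w: "reduced_word w" using Cons.prems by (rule reduced_ConsD)
  have 1: "Abs_free_group (l # w) = letter l + Abs_free_group w"
    using Abs_free_group_append[of "[l]" w] Cons.prems by (simp add: letter_def)
  have "reduced_word (map shift_letter (l # w))" using Cons.prems by (simp only: reduced_map_shift_letter)
  then have 2: "Abs_free_group (map shift_letter (l # w)) = letter (shift_letter l) + Abs_free_group (map shift_letter w)"
    using Abs_free_group_append[of "[shift_letter l]" "map shift_letter w"] by (simp add: letter_def)
  show ?case unfolding 1 2 left_regular_add
    by (simp add: mult left_regular_in_reduced_group_cstar letter Cons.IH[OF w])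
qed

lemma power_left_regular: "(\<alpha> ^^ k) (left_regular g) = left_regular ((shift_group ^^ k) g)"
proof (induction k)
  case (Suc k)
  have "\<alpha> (left_regular h) = left_regular (shift_group h)" for h
    using word[OF reduced_Rep_free_group, of h]
    by (simp add: Rep_free_group_inverse flip: shift_group.rep_eq)
  then show ?case using Suc by simp
qed simp

lemma power_maps: "T \<in> A \<Longrightarrow> (\<alpha> ^^ k) T \<in> A"
  by (induction k) (auto intro: maps)

lemma power_contractive: "T \<in> A \<Longrightarrow> norm ((\<alpha> ^^ k) T) \<le> norm T"
  by (induction k) (auto intro: order_trans[OF contractive[OF power_maps]])

lemma power_clinear: "clinear_on A (\<alpha> ^^ k)"
proof (induction k)
  case 0
  show ?case by (simp add: clinear_on_def)
next
  case (Suc k)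
  have "clinear_on A \<alpha>" using hom by (simp add: star_hom_def)
  then show ?case using Suc by (simp add: clinear_on_def power_maps)
qed

lemma power_diff: "S \<in> A \<Longrightarrow> T \<in> A \<Longrightarrow> (\<alpha> ^^ k) (S - T) = (\<alpha> ^^ k) S - (\<alpha> ^^ k) T"
  by (rule clinear_on_diff[OF cstar_algebraD(1)[OF cstar_algebra_reduced_group_cstar] power_clinear])

end

section \<open>Averages along the orbit of a group element\<close>

lemma norm_ell2_le:
  assumes "\<And>x. cmod (Rep_ell2 f x) \<le> cmod (Rep_ell2 g x)"
  shows "norm f \<le> norm g"
proof -
  have "(norm f)\<^sup>2 \<le> (norm g)\<^sup>2"
    unfolding norm_ell2_square using assms by (intro infsum_mono ell2_summable power_mono) auto
  then show ?thesis by (simp add: power2_le_iff_abs_le)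
qed

lemma orthogonal_disjoint_supports:
  assumes "\<And>x. Rep_ell2 f x = 0 \<or> Rep_ell2 g x = 0"
  shows "orthogonal f g"
proof -
  have "(\<lambda>x. cnj (Rep_ell2 f x) * Rep_ell2 g x) = (\<lambda>_. 0)"
    using assms by (intro ext) auto
  then show ?thesis by (simp add: orthogonal_def inner_ell2.rep_eq)
qed

lift_definition restrict_ell2 :: "'a set \<Rightarrow> 'a ell2 \<Rightarrow> 'a ell2" is "\<lambda>E f x. if x \<in> E then f x else 0"
  by (rule summable_on_comparison_test) auto

lemma sum_norm_restrict_disjoint_le:
  assumes I: "finite I" and disj: "\<And>i j. i \<in> I \<Longrightarrow> j \<in> I \<Longrightarrow> i \<noteq> j \<Longrightarrow> E i \<inter> E j = {}"
  shows "(\<Sum>n\<in>I. (norm (restrict_ell2 (E n) f))\<^sup>2) \<le> (norm f)\<^sup>2"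
proof -
  let ?p = "\<lambda>n. restrict_ell2 (E n) f"
  have pyth: "(\<Sum>n\<in>I. (norm (?p n))\<^sup>2) = (norm (\<Sum>n\<in>I. ?p n))\<^sup>2"
  proof (rule norm_sum_Pythagorean[OF I, symmetric])
    show "pairwise (\<lambda>i j. orthogonal (?p i) (?p j)) I"
    proof (rule pairwiseI)
      fix i j assume ij: "i \<in> I" "j \<in> I" "i \<noteq> j"
      then show "orthogonal (?p i) (?p j)"
        using disj[OF ij] by (intro orthogonal_disjoint_supports) (auto simp: restrict_ell2.rep_eq)
    qed
  qed
  have "norm (\<Sum>n\<in>I. ?p n) \<le> norm f"
  proof (rule norm_ell2_le)
    fix x
    show "cmod (Rep_ell2 (\<Sum>n\<in>I. ?p n) x) \<le> cmod (Rep_ell2 f x)"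
    proof (cases "\<exists>n\<in>I. x \<in> E n")
      case True
      then obtain m where m: "m \<in> I" "x \<in> E m" by blast
      have "(\<Sum>n\<in>I. Rep_ell2 (?p n) x) = (\<Sum>n\<in>I. if n = m then Rep_ell2 f x else 0)"
        using m disj by (intro sum.cong refl) (auto simp: restrict_ell2.rep_eq)
      then show ?thesis using m I by (simp add: Rep_ell2_sum)
    next
      case False
      then show ?thesis by (simp add: Rep_ell2_sum restrict_ell2.rep_eq)
    qed
  qed
  then show ?thesis unfolding pyth by (intro power_mono) auto
qed

text \<open>Let \<open>D n\<close> be the set of words with the same first letter as \<open>w n\<close>, and \<open>E n\<close> the set of words that
start with the inverse of the last letter of \<open>w n\<close>. Left multiplication by \<open>w n\<close> causes no
cancellation outside \<open>E n\<close>, hence maps the complement of \<open>E n\<close> into \<open>D n\<close>. The sets \<open>D n\<close> are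
disjoint, so the contributions from outside the sets \<open>E n\<close> are pairwise orthogonal. The sets \<open>E n\<close> are
disjoint too, so by the Cauchy-Schwarz inequality the norms of the parts of a vector inside them sum
to at most \<open>sqrt (card I)\<close> times its norm. Each half contributes \<open>sqrt (card I)\<close>.\<close>

lemma norm_sum_distinct_ends_le:
  fixes w :: "nat \<Rightarrow> 'a free_group" and c :: "nat \<Rightarrow> complex"
  assumes I: "finite I" and c: "\<And>n. n \<in> I \<Longrightarrow> cmod (c n) \<le> 1"
    and w: "\<And>n. n \<in> I \<Longrightarrow> w n \<noteq> 0"
    and hd: "inj_on (\<lambda>n. hd (Rep_free_group (w n))) I"
    and last: "inj_on (\<lambda>n. last (Rep_free_group (w n))) I"
  shows "norm (\<Sum>n\<in>I. c n *\<^sub>C left_regular (w n)) \<le> 2 * sqrt (real (card I))"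
proof (rule norm_blinfun_bound)
  fix f :: "'a free_group ell2"
  define D where "D n = {x. Rep_free_group x \<noteq> [] \<and> hd (Rep_free_group x) = hd (Rep_free_group (w n))}" for n
  define E where "E n = {x. Rep_free_group x \<noteq> [] \<and> hd (Rep_free_group x) = inv_letter (last (Rep_free_group (w n)))}" for n
  have wne: "Rep_free_group (w n) \<noteq> []" if "n \<in> I" for n
    using w[OF that] by (metis Rep_free_group_inject zero_free_group.rep_eq)
  have ED: "w n + x \<in> D n" if n: "n \<in> I" and x: "x \<notin> E n" for n x
  proof -
    have "reduced_word (v @ u)" if "reduced_word v" "reduced_word u" "v = [] \<or> u = [] \<or> hd u \<noteq> inv_letter (last v)"
      for v u :: "('a \<times> bool) list"
      using that by (induction v rule: reduced_word.induct) (cases u; auto)+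
    then have "reduced_word (Rep_free_group (w n) @ Rep_free_group x)"
      using x reduced_Rep_free_group by (auto simp: E_def)
    then have "Rep_free_group (w n + x) = Rep_free_group (w n) @ Rep_free_group x"
      by (simp add: plus_free_group.rep_eq append_red_reduced)
    then show ?thesis using wne[OF n] by (simp add: D_def)
  qed
  define p where "p n = restrict_ell2 (E n) f" for n
  define h where "h n = c n *\<^sub>C blinfun_apply (left_regular (w n)) (f - p n)" for n
  define k where "k n = c n *\<^sub>C blinfun_apply (left_regular (w n)) (p n)" for n
  have Rp: "Rep_ell2 (p n) x = (if x \<in> E n then Rep_ell2 f x else 0)" for n x
    by (simp add: p_def restrict_ell2.rep_eq)
  have split: "blinfun_apply (\<Sum>n\<in>I. c n *\<^sub>C left_regular (w n)) f = (\<Sum>n\<in>I. h n) + (\<Sum>n\<in>I. k n)"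
    by (simp add: blinfun.sum_left h_def k_def blinfun.diff_right scaleC_blinfun.rep_eq
        flip: sum.distrib scaleC_add_right)
  have nh: "norm (h n) \<le> norm f" if "n \<in> I" for n
  proof -
    have "norm (h n) = cmod (c n) * norm (f - p n)"
      by (simp add: h_def norm_scaleC norm_left_regular_apply)
    also have "\<dots> \<le> 1 * norm f"
      using c[OF that] by (intro mult_mono norm_ell2_le) (auto simp: minus_ell2.rep_eq Rp)
    finally show ?thesis by simp
  qed
  have hD: "Rep_ell2 (h n) x = 0" if "n \<in> I" "x \<notin> D n" for n x
  proof -
    have "- w n + x \<in> E n" using ED[OF that(1), of "- w n + x"] that(2) by auto
    then show ?thesis by (simp add: h_def scaleC_ell2.rep_eq Rep_left_regular minus_ell2.rep_eq Rp)
  qed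
  have "(norm (\<Sum>n\<in>I. h n))\<^sup>2 = (\<Sum>n\<in>I. (norm (h n))\<^sup>2)"
  proof (rule norm_sum_Pythagorean[OF I])
    show "pairwise (\<lambda>i j. orthogonal (h i) (h j)) I"
    proof (rule pairwiseI)
      fix i j assume ij: "i \<in> I" "j \<in> I" "i \<noteq> j"
      then have "D i \<inter> D j = {}" using hd by (auto simp: D_def inj_on_def)
      then show "orthogonal (h i) (h j)"
        using hD ij by (intro orthogonal_disjoint_supports) blast
    qed
  qed
  also have "\<dots> \<le> (\<Sum>n\<in>I. (norm f)\<^sup>2)" using nh by (intro sum_mono power_mono) auto
  finally have "(norm (\<Sum>n\<in>I. h n))\<^sup>2 \<le> (sqrt (real (card I)) * norm f)\<^sup>2"
    by (simp add: power_mult_distrib)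
  then have H: "norm (\<Sum>n\<in>I. h n) \<le> sqrt (real (card I)) * norm f"
    by (rule power2_le_imp_le) simp
  have disjE: "E i \<inter> E j = {}" if "i \<in> I" "j \<in> I" "i \<noteq> j" for i j
  proof -
    have "last (Rep_free_group (w i)) \<noteq> last (Rep_free_group (w j))"
      using last that by (auto simp: inj_on_def)
    then have "inv_letter (last (Rep_free_group (w i))) \<noteq> inv_letter (last (Rep_free_group (w j)))"
      by (metis inv_letter_inv_letter)
    then show ?thesis by (auto simp: E_def)
  qed
  have sp: "(\<Sum>n\<in>I. (norm (p n))\<^sup>2) \<le> (norm f)\<^sup>2"
    unfolding p_def by (rule sum_norm_restrict_disjoint_le[OF I disjE])
  have "norm (\<Sum>n\<in>I. k n) \<le> (\<Sum>n\<in>I. 1 * norm (p n))"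
    unfolding k_def using c
    by (intro sum_norm_le) (simp add: norm_scaleC norm_left_regular_apply mult_left_le_one_le)
  also have "\<dots> \<le> sqrt (real (card I)) * norm f"
  proof (rule power2_le_imp_le)
    have "(\<Sum>n\<in>I. 1 * norm (p n))\<^sup>2 \<le> (\<Sum>n\<in>I. 1\<^sup>2) * (\<Sum>n\<in>I. (norm (p n))\<^sup>2)"
      by (rule Cauchy_Schwarz_ineq_sum)
    also have "\<dots> \<le> real (card I) * (norm f)\<^sup>2" using sp by (simp add: mult_left_mono)
    finally show "(\<Sum>n\<in>I. 1 * norm (p n))\<^sup>2 \<le> (sqrt (real (card I)) * norm f)\<^sup>2"
      by (simp add: power_mult_distrib)
  qed simp
  finally have K: "norm (\<Sum>n\<in>I. k n) \<le> sqrt (real (card I)) * norm f" .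
  show "norm (blinfun_apply (\<Sum>n\<in>I. c n *\<^sub>C left_regular (w n)) f) \<le> 2 * sqrt (real (card I)) * norm f"
    unfolding split using norm_triangle_ineq[of "\<Sum>n\<in>I. h n" "\<Sum>n\<in>I. k n"] H K by linarith
qed simp

lemma clinear_on_sum:
  assumes A: "csubspace A" and f: "clinear_on A f" and T: "\<And>i. i \<in> I \<Longrightarrow> T i \<in> A"
  shows "f (\<Sum>i\<in>I. c i *\<^sub>C T i) = (\<Sum>i\<in>I. c i *\<^sub>C f (T i))"
  using T
proof (induction I rule: infinite_finite_induct)
  case (insert i I)
  have "(\<Sum>i\<in>I. c i *\<^sub>C T i) \<in> A" using insert A
    by (intro complex_vector.subspace_sum complex_vector.subspace_scale) auto
  moreover have "c i *\<^sub>C T i \<in> A" using insert A by (intro complex_vector.subspace_scale) auto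
  ultimately show ?case using insert f by (simp add: clinear_on_def)
next
  case empty
  have "f (0 *\<^sub>C 0) = 0 *\<^sub>C f 0" using f complex_vector.subspace_0[OF A] unfolding clinear_on_def by blast
  then show ?case by simp
next
  case (infinite I)
  have "f (0 *\<^sub>C 0) = 0 *\<^sub>C f 0" using f complex_vector.subspace_0[OF A] unfolding clinear_on_def by blast
  then show ?case using infinite by simp
qed

context free_shift
begin

lemma cspan_subset: "T \<in> cspan (range left_regular) \<Longrightarrow> T \<in> A"
  unfolding reduced_group_cstar_def using closure_subset by (rule subsetD)

text \<open>For \<open>g = 0\<close> the orbit is constant and the assumption on the mean of \<open>c\<close> applies. For \<open>g \<noteq> 0\<close> the
first letters of the shifted words are pairwise distinct, and so are the last ones, because the shift
moves every index by a different amount; the averages then have norm at most \<open>2 / sqrt N\<close>.\<close>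

lemma averages_left_regular_tendsto:
  assumes \<rho>: "is_state A \<rho>" and c: "\<And>n. cmod (c n) \<le> 1"
    and mean: "(\<lambda>N. 1 / of_nat N * (\<Sum>n=1..N. c n)) \<longlonglongrightarrow> 0"
  shows "(\<lambda>N. 1 / of_nat N * (\<Sum>n=1..N. c n * \<rho> ((\<alpha> ^^ n) (left_regular g)))) \<longlonglongrightarrow> 0"
proof (cases "g = 0")
  case True
  have "(\<alpha> ^^ n) (left_regular g) = id_blinfun" for n
    using unital by (induction n) (simp_all add: True left_regular_0)
  then have "(\<lambda>N. 1 / of_nat N * (\<Sum>n=1..N. c n * \<rho> ((\<alpha> ^^ n) (left_regular g))))
      = (\<lambda>N. (1 / of_nat N * (\<Sum>n=1..N. c n)) * \<rho> id_blinfun)"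
    by (simp add: sum_distrib_right mult.assoc)
  then show ?thesis using tendsto_mult_right[OF mean, of "\<rho> id_blinfun"]
    by (simp add: tendsto_mult_left_zero[OF mean])
next
  case False
  have lin: "clinear_on A \<rho>" and le: "\<And>T. T \<in> A \<Longrightarrow> cmod (\<rho> T) \<le> norm T"
    using \<rho> by (auto simp: is_state_def)
  have sub: "csubspace A" by (rule cstar_algebraD(1)[OF cstar_algebra_reduced_group_cstar])
  define w where "w n = (shift_group ^^ n) g" for n
  have ne: "Rep_free_group g \<noteq> []"
    using False by (metis Rep_free_group_inject zero_free_group.rep_eq)
  have inj: "inj_on (\<lambda>n. hd (Rep_free_group (w n))) I" "inj_on (\<lambda>n. last (Rep_free_group (w n))) I" for I
    using ne by (auto simp: inj_on_def w_def Rep_shift_group_power hd_map last_map shift_letter_power)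
  have w0: "w n \<noteq> 0" for n
  proof
    assume "w n = 0"
    then have "Rep_free_group (w n) = []" by (simp add: zero_free_group.rep_eq)
    then show False using ne by (simp add: w_def Rep_shift_group_power)
  qed
  have bound: "norm (1 / of_nat N * (\<Sum>n=1..N. c n * \<rho> ((\<alpha> ^^ n) (left_regular g)))) \<le> 2 / sqrt (real N)" if N: "N > 0" for N
  proof -
    let ?S = "\<Sum>n=1..N. c n *\<^sub>C left_regular (w n)"
    have "\<rho> ?S = (\<Sum>n=1..N. c n *\<^sub>C \<rho> (left_regular (w n)))"
      by (rule clinear_on_sum[OF sub lin left_regular_in_reduced_group_cstar])
    then have eq: "\<rho> ?S = (\<Sum>n=1..N. c n * \<rho> ((\<alpha> ^^ n) (left_regular g)))"
      by (simp add: power_left_regular w_def scaleC_complex_def)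
    have "?S \<in> A"
      by (intro complex_vector.subspace_sum[OF sub] complex_vector.subspace_scale[OF sub] left_regular_in_reduced_group_cstar)
    then have "cmod (\<rho> ?S) \<le> norm ?S" by (rule le)
    also have "\<dots> \<le> 2 * sqrt (real (card {1..N}))"
      by (rule norm_sum_distinct_ends_le) (use c w0 inj in auto)
    finally have "cmod (\<rho> ?S) \<le> 2 * sqrt (real N)" by simp
    then have "cmod (\<rho> ?S) / real N \<le> 2 * sqrt (real N) / real N" by (rule divide_right_mono) simp
    also have "\<dots> = 2 / sqrt (real N)" using N by (simp add: real_div_sqrt field_simps)
    finally show ?thesis unfolding eq[symmetric] by (simp add: norm_mult norm_divide)
  qed
  show ?thesis
  proof (rule Lim_null_comparison)
    show "\<forall>\<^sub>F N in sequentially. norm (1 / of_nat N * (\<Sum>n=1..N. c n * \<rho> ((\<alpha> ^^ n) (left_regular g)))) \<le> 2 / sqrt (real N)"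
      using eventually_gt_at_top[of 0] by eventually_elim (rule bound)
    show "(\<lambda>N. 2 / sqrt (real N)) \<longlonglongrightarrow> 0"
      by (intro tendsto_divide_0[OF tendsto_const] filterlim_at_top_imp_at_infinity
          filterlim_compose[OF sqrt_at_top filterlim_real_sequentially])
  qed
qed

text \<open>A state is linear and contractive, and so are the powers of \<open>\<alpha>\<close>. The averages at \<open>T\<close> and at an
approximation \<open>S\<close> of \<open>T\<close> in the span of the group elements therefore differ by at most \<open>norm (T - S)\<close>.\<close>

lemma averages_tendsto:
  assumes \<rho>: "is_state A \<rho>" and c: "\<And>n. cmod (c n) \<le> 1"
    and mean: "(\<lambda>N. 1 / of_nat N * (\<Sum>n=1..N. c n)) \<longlonglongrightarrow> 0" and T: "T \<in> A"
  shows "(\<lambda>N. 1 / of_nat N * (\<Sum>n=1..N. c n * \<rho> ((\<alpha> ^^ n) T))) \<longlonglongrightarrow> 0"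
proof -
  define M where "M N T = 1 / of_nat N * (\<Sum>n=1..N. c n * \<rho> ((\<alpha> ^^ n) T))" for N T
  have lin: "clinear_on A \<rho>" and le: "\<And>T. T \<in> A \<Longrightarrow> cmod (\<rho> T) \<le> norm T"
    using \<rho> by (auto simp: is_state_def)
  note AD = cstar_algebraD[OF cstar_algebra_reduced_group_cstar]
  have span: "(\<lambda>N. M N S) \<longlonglongrightarrow> 0" if "S \<in> cspan (range left_regular)" for S
  proof -
    have "S \<in> A \<and> (\<lambda>N. M N S) \<longlonglongrightarrow> 0"
      using that
    proof (induction rule: complex_vector.span_induct_alt)
      case base
      have "(\<alpha> ^^ n) 0 = 0" for n
        using power_diff[OF AD(9) AD(9), of n] by simp
      moreover have "\<rho> 0 = 0" using clinear_on_diff[OF AD(1) lin AD(9) AD(9)] by simp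
      ultimately show ?case using AD(9) by (simp add: M_def)
    next
      case (step d S R)
      then obtain g where g: "S = left_regular g" by auto
      then have S: "S \<in> A" by (simp add: left_regular_in_reduced_group_cstar)
      have R: "R \<in> A" using step by simp
      have "(\<alpha> ^^ n) (d *\<^sub>C S + R) = d *\<^sub>C (\<alpha> ^^ n) S + (\<alpha> ^^ n) R" for n
        using power_clinear[of n] S R AD(8) unfolding clinear_on_def by metis
      moreover have "\<rho> (d *\<^sub>C (\<alpha> ^^ n) S + (\<alpha> ^^ n) R) = d * \<rho> ((\<alpha> ^^ n) S) + \<rho> ((\<alpha> ^^ n) R)" for n
        using lin power_maps[OF S] power_maps[OF R] AD(8) unfolding clinear_on_def scaleC_complex_def by metis
      ultimately have "M N (d *\<^sub>C S + R) = d * M N S + M N R" for N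
        by (simp add: M_def distrib_left sum.distrib sum_distrib_left mult_ac)
      moreover have "(\<lambda>N. M N S) \<longlonglongrightarrow> 0"
        unfolding M_def g by (rule averages_left_regular_tendsto[OF \<rho> c mean])
      then have "(\<lambda>N. d * M N S + M N R) \<longlonglongrightarrow> d * 0 + 0"
        using step by (intro tendsto_intros) auto
      moreover have "d *\<^sub>C S + R \<in> A" by (intro AD(6) AD(8) S R)
      ultimately show ?case by simp
    qed
    then show ?thesis by blast
  qed
  have "(\<lambda>N. M N T) \<longlonglongrightarrow> 0"
  proof (rule LIMSEQ_I)
    fix e :: real assume e: "e > 0"
    then obtain S where S: "S \<in> cspan (range left_regular)" "norm (T - S) < e / 2"
      using reduced_group_cstar_approx[OF T, of "e / 2"] by auto
    then obtain N0 where N0: "\<And>N. N \<ge> N0 \<Longrightarrow> norm (M N S) < e / 2"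
      using LIMSEQ_D[OF span[OF S(1)], of "e / 2"] e by auto
    have SA: "S \<in> A" using S(1) by (rule cspan_subset)
    have diff: "norm (M N T - M N S) \<le> norm (T - S)" for N
    proof -
      have d: "\<rho> ((\<alpha> ^^ n) (T - S)) = \<rho> ((\<alpha> ^^ n) T) - \<rho> ((\<alpha> ^^ n) S)" for n
        using clinear_on_diff[OF AD(1) lin power_maps[OF T] power_maps[OF SA]] power_diff[OF T SA] by simp
      have eqn: "M N T - M N S = 1 / of_nat N * (\<Sum>n=1..N. c n * \<rho> ((\<alpha> ^^ n) (T - S)))"
        unfolding M_def d by (simp add: right_diff_distrib sum_subtractf)
      have bd: "norm (\<Sum>n=1..N. c n * \<rho> ((\<alpha> ^^ n) (T - S))) \<le> (\<Sum>n=1..N. 1 * norm (T - S))"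
      proof (rule sum_norm_le)
        fix n
        have TS: "T - S \<in> A" using T SA AD(7) by blast
        have "cmod (\<rho> ((\<alpha> ^^ n) (T - S))) \<le> norm (T - S)"
          using le[OF power_maps[OF TS]] power_contractive[OF TS] order_trans by blast
        then show "norm (c n * \<rho> ((\<alpha> ^^ n) (T - S))) \<le> 1 * norm (T - S)"
          unfolding norm_mult using c by (intro mult_mono) auto
      qed
      show ?thesis
      proof (cases "N = 0")
        case False
        then have "norm (\<Sum>n=1..N. c n * \<rho> ((\<alpha> ^^ n) (T - S))) / real N \<le> norm (T - S)"
          using bd by (simp add: divide_le_eq mult.commute)
        then show ?thesis unfolding eqn by (simp add: norm_mult norm_divide)
      next
        case True
        show ?thesis unfolding eqn using True by simp
      qed
    qed
    have "norm (M N T - 0) < e" if "N \<ge> N0" for N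
      using norm_triangle_ineq[of "M N T - M N S" "M N S"] diff[of N] N0[OF that] S(2) by simp
    then show "\<exists>N0. \<forall>N\<ge>N0. norm (M N T - 0) < e" by blast
  qed
  then show ?thesis unfolding M_def .
qed

lemma moebius_disjoint: "moebius_linearly_disjoint A \<alpha>"
  unfolding moebius_linearly_disjoint_def
proof (intro allI impI ballI)
  fix \<rho> T assume \<rho>: "is_state A \<rho>" and T: "T \<in> A"
  show "(\<lambda>N. 1 / of_nat N * (\<Sum>n = 1..N. of_int (moebius n) * \<rho> ((\<alpha> ^^ n) T))) \<longlonglongrightarrow> 0"
  proof (rule averages_tendsto[OF \<rho> _ _ T])
    show "cmod (of_int (moebius n)) \<le> 1" for n
      using abs_moebius_le_1[of n] by (simp flip: of_int_abs)
    have "(\<lambda>N. of_real ((\<Sum>n=1..N. real_of_int (moebius n)) / real N) :: complex) \<longlonglongrightarrow> of_real 0"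
      by (intro tendsto_of_real moebius_mean_tendsto)
    then show "(\<lambda>N. 1 / of_nat N * (\<Sum>n=1..N. of_int (moebius n) :: complex)) \<longlonglongrightarrow> 0"
      by simp
  qed
qed

end

section \<open>Matrix algebras and their rank\<close>

lift_definition restrict_op :: "'a set \<Rightarrow> 'a ell2 \<Rightarrow>\<^sub>L 'a ell2" is restrict_ell2
proof (rule bounded_linear_intro[where K = 1])
  fix E :: "'a set" and f g :: "'a ell2" and r :: real
  show "restrict_ell2 E (f + g) = restrict_ell2 E f + restrict_ell2 E g"
    by (rule ell2_eqI) (simp add: restrict_ell2.rep_eq plus_ell2.rep_eq)
  show "restrict_ell2 E (r *\<^sub>R f) = r *\<^sub>R restrict_ell2 E f"
    by (rule ell2_eqI) (simp add: restrict_ell2.rep_eq scaleR_ell2.rep_eq)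
  show "norm (restrict_ell2 E f) \<le> norm f * 1"
    by (simp add: norm_ell2_le restrict_ell2.rep_eq)
qed

lemma Rep_restrict_op: "Rep_ell2 (blinfun_apply (restrict_op E) f) x = (if x \<in> E then Rep_ell2 f x else 0)"
  by (simp add: restrict_op.rep_eq restrict_ell2.rep_eq)

lemma restrict_op_ket: "blinfun_apply (restrict_op E) (ket k) = (if k \<in> E then ket k else 0)"
  by (rule ell2_eqI) (simp add: Rep_restrict_op ket.rep_eq)

lemma clinear_op_restrict_op: "clinear_op (restrict_op E)"
  unfolding clinear_op_def by (intro allI ell2_eqI) (simp add: Rep_restrict_op scaleC_ell2.rep_eq)

lemma restrict_op_compose: "restrict_op E o\<^sub>L restrict_op F = restrict_op (E \<inter> F)"
  by (intro blinfun_eqI ell2_eqI) (simp add: Rep_restrict_op)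

lemma adj_restrict_op: "adj (restrict_op E) = restrict_op E"
proof (rule adj_eqI)
  fix f g
  have "(\<lambda>x. cnj (Rep_ell2 (blinfun_apply (restrict_op E) f) x) * Rep_ell2 g x)
      = (\<lambda>x. cnj (Rep_ell2 f x) * Rep_ell2 (blinfun_apply (restrict_op E) g) x)"
    by (auto simp: Rep_restrict_op)
  then show "cinner (blinfun_apply (restrict_op E) f) g = cinner f (blinfun_apply (restrict_op E) g)"
    by (simp add: cinner_ell2.rep_eq)
qed

text \<open>The algebra of \<open>d \<times> d\<close> matrices, as the operators that live on the first \<open>d\<close> coordinates.\<close>

definition corner :: "nat \<Rightarrow> (nat ell2 \<Rightarrow>\<^sub>L nat ell2) set" where
  "corner d = {T. clinear_op T \<and> restrict_op {..<d} o\<^sub>L T = T \<and> T o\<^sub>L restrict_op {..<d} = T}"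

lemma blinfun_compose_add_left: "(S + T) o\<^sub>L R = (S o\<^sub>L R) + (T o\<^sub>L R)"
  by (rule blinfun_eqI) (simp add: blinfun.add_left)
lemma blinfun_compose_add_right: "R o\<^sub>L (S + T) = (R o\<^sub>L S) + (R o\<^sub>L T)"
  by (rule blinfun_eqI) (simp add: blinfun.add_right blinfun.add_left)
lemma blinfun_compose_scaleC_left: "(c *\<^sub>C T) o\<^sub>L R = c *\<^sub>C (T o\<^sub>L R)"
  by (rule blinfun_eqI) (simp add: scaleC_blinfun.rep_eq)
lemma blinfun_compose_scaleC_right: "clinear_op R \<Longrightarrow> R o\<^sub>L (c *\<^sub>C T) = c *\<^sub>C (R o\<^sub>L T)"
  by (rule blinfun_eqI) (simp add: scaleC_blinfun.rep_eq clinear_op_def)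
lemma blinfun_compose_zero_left [simp]: "0 o\<^sub>L R = 0"
  by (rule blinfun_eqI) simp
lemma blinfun_compose_zero_right [simp]: "R o\<^sub>L 0 = 0"
  by (rule blinfun_eqI) simp

lemma blinfun_compose_assoc: "(R o\<^sub>L S) o\<^sub>L T = R o\<^sub>L (S o\<^sub>L T)"
  by (rule blinfun_eqI) simp

lemma continuous_on_compose_left: "continuous_on UNIV (\<lambda>T. R o\<^sub>L T)"
  by (rule bounded_linear.continuous_on[OF bounded_bilinear.bounded_linear_right[OF bounded_bilinear_blinfun_compose] continuous_on_id])
lemma continuous_on_compose_right: "continuous_on UNIV (\<lambda>T. T o\<^sub>L R)"
  by (rule bounded_linear.continuous_on[OF bounded_bilinear.bounded_linear_left[OF bounded_bilinear_blinfun_compose] continuous_on_id])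

lemma cstar_algebraI:
  assumes "\<And>T. T \<in> A \<Longrightarrow> clinear_op T" "0 \<in> A" "\<And>S T. S \<in> A \<Longrightarrow> T \<in> A \<Longrightarrow> S + T \<in> A"
    "\<And>c T. T \<in> A \<Longrightarrow> c *\<^sub>C T \<in> A" "closed A" "\<And>S T. S \<in> A \<Longrightarrow> T \<in> A \<Longrightarrow> S o\<^sub>L T \<in> A"
    "\<And>T. T \<in> A \<Longrightarrow> adj T \<in> A"
  shows "cstar_algebra A"
  unfolding cstar_algebra_def using assms by (auto intro: complex_vector.subspaceI)

text \<open>Passing to adjoints turns commutation with \<open>adj R\<close> into commutation with \<open>R\<close>; this is why \<open>X\<close> has to be
closed under adjoints.\<close>

lemma cstar_algebra_commutant:
  fixes A :: "('a ell2 \<Rightarrow>\<^sub>L 'a ell2) set"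
  assumes A: "cstar_algebra A" and X: "\<And>R. R \<in> X \<Longrightarrow> clinear_op R \<and> adj R \<in> X"
  shows "cstar_algebra {T \<in> A. \<forall>R\<in>X. T o\<^sub>L R = R o\<^sub>L T}" (is "cstar_algebra ?C")
proof (rule cstar_algebraI)
  note AD = cstar_algebraD[OF A]
  show "clinear_op T" if "T \<in> ?C" for T using that AD(3) by blast
  show "0 \<in> ?C" using AD(9) by simp
  show "S + T \<in> ?C" if "S \<in> ?C" "T \<in> ?C" for S T
    using that AD(6) by (simp add: blinfun_compose_add_left blinfun_compose_add_right)
  show "c *\<^sub>C T \<in> ?C" if "T \<in> ?C" for c T
    using that AD(8) X by (simp add: blinfun_compose_scaleC_left blinfun_compose_scaleC_right)
  show "S o\<^sub>L T \<in> ?C" if "S \<in> ?C" "T \<in> ?C" for S T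
  proof -
    have "(S o\<^sub>L T) o\<^sub>L R = R o\<^sub>L (S o\<^sub>L T)" if R: "R \<in> X" for R
    proof -
      have "S o\<^sub>L R = R o\<^sub>L S" "T o\<^sub>L R = R o\<^sub>L T" using \<open>S \<in> ?C\<close> \<open>T \<in> ?C\<close> R by auto
      then show ?thesis by (metis blinfun_compose_assoc)
    qed
    then show ?thesis using that AD(4) by simp
  qed
  show "adj T \<in> ?C" if T: "T \<in> ?C" for T
  proof -
    have "adj T o\<^sub>L R = R o\<^sub>L adj T" if R: "R \<in> X" for R
    proof -
      have cR: "clinear_op R" "clinear_op (adj R)" "adj R \<in> X" and cT: "clinear_op T"
        using X[OF R] AD(3) T clinear_op_adj by auto
      have "adj (adj R o\<^sub>L T) = adj (T o\<^sub>L adj R)" using T cR by auto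
      then show ?thesis using cR cT by (simp add: adj_compose adj_adj)
    qed
    then show ?thesis using T AD(5) by simp
  qed
  have "closed (\<Inter>R\<in>X. {T. T o\<^sub>L R = R o\<^sub>L T})"
    by (intro closed_INT ballI closed_Collect_eq continuous_on_compose_left continuous_on_compose_right)
  then have "closed (A \<inter> (\<Inter>R\<in>X. {T. T o\<^sub>L R = R o\<^sub>L T}))" using AD(2) by blast
  also have "A \<inter> (\<Inter>R\<in>X. {T. T o\<^sub>L R = R o\<^sub>L T}) = ?C" by auto
  finally show "closed ?C" .
qed

lemma cstar_algebra_corner: "cstar_algebra (corner d)"
proof (rule cstar_algebraI)
  let ?Q = "restrict_op {..<d}"
  show "clinear_op T" if "T \<in> corner d" for T using that by (simp add: corner_def)
  show "0 \<in> corner d" by (simp add: corner_def clinear_op_zero)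
  show "S + T \<in> corner d" if "S \<in> corner d" "T \<in> corner d" for S T
    using that by (simp add: corner_def clinear_op_add blinfun_compose_add_left blinfun_compose_add_right)
  show "c *\<^sub>C T \<in> corner d" if "T \<in> corner d" for c T
    using that by (simp add: corner_def clinear_op_scaleC blinfun_compose_scaleC_left blinfun_compose_scaleC_right clinear_op_restrict_op)
  show "S o\<^sub>L T \<in> corner d" if "S \<in> corner d" "T \<in> corner d" for S T
    using that unfolding corner_def by (simp add: clinear_op_compose) (metis blinfun_compose_assoc)
  show "adj T \<in> corner d" if T: "T \<in> corner d" for T
  proof -
    have c: "clinear_op T" using T by (simp add: corner_def)
    have "adj (T o\<^sub>L ?Q) = adj T" "adj (?Q o\<^sub>L T) = adj T" using T by (simp_all add: corner_def)
    then show ?thesis using c by (simp add: corner_def clinear_op_adj adj_compose clinear_op_restrict_op adj_restrict_op)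
  qed
  have "closed ({T. clinear_op T} \<inter> {T. ?Q o\<^sub>L T = T} \<inter> {T. T o\<^sub>L ?Q = T})"
    by (intro closed_Int closed_clinear_op closed_Collect_eq continuous_on_compose_left continuous_on_compose_right continuous_on_id)
  also have "{T. clinear_op T} \<inter> {T. ?Q o\<^sub>L T = T} \<inter> {T. T o\<^sub>L ?Q = T} = corner d"
    by (auto simp: corner_def)
  finally show "closed (corner d)" .
qed

lift_definition matrix_unit :: "nat \<Rightarrow> nat \<Rightarrow> nat ell2 \<Rightarrow>\<^sub>L nat ell2" is "\<lambda>i j f. cinner (ket j) f *\<^sub>C ket i"
proof (rule bounded_linear_intro[where K = "norm (ket j) * norm (ket i)" for i j])
  fix i j :: nat and f g :: "nat ell2" and r :: real
  show "cinner (ket j) (f + g) *\<^sub>C ket i = cinner (ket j) f *\<^sub>C ket i + cinner (ket j) g *\<^sub>C ket i"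
    by (simp add: cinner_add_right scaleC_add_left)
  show "cinner (ket j) (r *\<^sub>R f) *\<^sub>C ket i = r *\<^sub>R cinner (ket j) f *\<^sub>C ket i"
    by (simp add: cinner_scaleC_right scaleC_scaleC flip: scaleC_of_real)
  show "norm (cinner (ket j) f *\<^sub>C ket i) \<le> norm f * (norm (ket j) * norm (ket i))"
    using mult_right_mono[OF norm_cinner_le[of "ket j" f], of "norm (ket i)"] by (simp add: norm_scaleC mult_ac)
qed

lemma Rep_matrix_unit: "Rep_ell2 (blinfun_apply (matrix_unit i j) f) x = (if x = i then Rep_ell2 f j else 0)"
  by (simp add: matrix_unit.rep_eq scaleC_ell2.rep_eq ket.rep_eq cinner_ket)

lemma matrix_unit_in_corner: "i < d \<Longrightarrow> j < d \<Longrightarrow> matrix_unit i j \<in> corner d"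
  unfolding corner_def clinear_op_def
  by (auto intro!: blinfun_eqI ell2_eqI simp: Rep_matrix_unit Rep_restrict_op scaleC_ell2.rep_eq)

lemma corner_ket:
  assumes "T \<in> corner d"
  shows "k \<ge> d \<Longrightarrow> blinfun_apply T (ket k) = 0" "x \<ge> d \<Longrightarrow> Rep_ell2 (blinfun_apply T f) x = 0"
proof -
  have 1: "T = restrict_op {..<d} o\<^sub>L T" "T = T o\<^sub>L restrict_op {..<d}"
    using assms by (auto simp: corner_def)
  show "blinfun_apply T (ket k) = 0" if "k \<ge> d"
    using that by (subst 1(2)) (simp add: restrict_op_ket)
  show "Rep_ell2 (blinfun_apply T f) x = 0" if "x \<ge> d"
    using that by (subst 1(1)) (simp add: Rep_restrict_op)
qed

text \<open>The matrix units span.\<close>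

lemma fin_dim_corner: "fin_dim_cstar_algebra (corner d)"
proof -
  note CD = cstar_algebraD[OF cstar_algebra_corner[of d]]
  define S where "S = (\<lambda>(i, j). matrix_unit i j) ` ({..<d} \<times> {..<d})"
  have "cspan S \<subseteq> corner d"
    by (rule complex_vector.span_minimal[OF _ CD(1)]) (auto simp: S_def matrix_unit_in_corner)
  moreover have "T \<in> cspan S" if T: "T \<in> corner d" for T
  proof -
    have mem: "matrix_unit i j \<in> cspan S" if "i < d" "j < d" for i j
      using that by (intro complex_vector.span_base) (force simp: S_def)
    have "T = (\<Sum>i<d. \<Sum>j<d. Rep_ell2 (blinfun_apply T (ket j)) i *\<^sub>C matrix_unit i j)" (is "T = ?T'")
    proof (rule clinear_op_ext_ket)
      show "clinear_op T" by (rule CD(3)[OF T])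
      have "?T' \<in> corner d"
        by (intro complex_vector.subspace_sum[OF CD(1)] CD(8) matrix_unit_in_corner) auto
      then show "clinear_op ?T'" by (rule CD(3))
      fix k
      show "blinfun_apply T (ket k) = blinfun_apply ?T' (ket k)"
      proof (rule ell2_eqI)
        fix x
        have "Rep_ell2 (blinfun_apply ?T' (ket k)) x =
            (\<Sum>i<d. \<Sum>j<d. if x = i then if j = k then Rep_ell2 (blinfun_apply T (ket k)) x else 0 else 0)"
          unfolding blinfun.sum_left Rep_ell2_sum
          by (intro sum.cong refl) (auto simp: scaleC_blinfun.rep_eq scaleC_ell2.rep_eq Rep_matrix_unit ket.rep_eq)
        also have "\<dots> = (\<Sum>i<d. if x = i then \<Sum>j<d. if j = k then Rep_ell2 (blinfun_apply T (ket k)) x else 0 else 0)"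
          by (intro sum.cong refl) auto
        also have "\<dots> = (if x < d \<and> k < d then Rep_ell2 (blinfun_apply T (ket k)) x else 0)"
          by simp
        also have "\<dots> = Rep_ell2 (blinfun_apply T (ket k)) x"
          using corner_ket[OF T] by (auto simp: not_less)
        finally show "Rep_ell2 (blinfun_apply T (ket k)) x = Rep_ell2 (blinfun_apply ?T' (ket k)) x" by simp
      qed
    qed
    also have "?T' \<in> cspan S"
      by (intro complex_vector.span_sum complex_vector.span_scale mem) auto
    finally show ?thesis .
  qed
  ultimately have "corner d = cspan S" by blast
  moreover have "finite S" by (simp add: S_def)
  ultimately show ?thesis unfolding fin_dim_cstar_algebra_def using cstar_algebra_corner by blast
qed

text \<open>The diagonal matrices are the commutant of the diagonal matrix units. They are abelian, and any
abelian subalgebra that contains them commutes with the diagonal matrix units, hence lies in them.\<close>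

lemma has_rank_corner: "has_rank (corner d) d"
proof -
  let ?P = "\<lambda>i :: nat. restrict_op {i}"
  note CD = cstar_algebraD[OF cstar_algebra_corner[of d]]
  define D where "D = {T \<in> corner d. \<forall>R \<in> ?P ` {..<d}. T o\<^sub>L R = R o\<^sub>L T}"
  have csD: "cstar_algebra D"
    unfolding D_def by (rule cstar_algebra_commutant[OF cstar_algebra_corner])
      (auto simp: clinear_op_restrict_op adj_restrict_op)
  have diag: "blinfun_apply T (ket k) = Rep_ell2 (blinfun_apply T (ket k)) k *\<^sub>C ket k" if T: "T \<in> D" for T k
  proof (cases "k < d")
    case True
    have "blinfun_apply T (ket k) = blinfun_apply (T o\<^sub>L ?P k) (ket k)" by (simp add: restrict_op_ket)
    also have "T o\<^sub>L ?P k = ?P k o\<^sub>L T" using T True by (auto simp: D_def)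
    also have "blinfun_apply (?P k o\<^sub>L T) (ket k) = Rep_ell2 (blinfun_apply T (ket k)) k *\<^sub>C ket k"
      by (rule ell2_eqI) (simp add: Rep_restrict_op scaleC_ell2.rep_eq ket.rep_eq)
    finally show ?thesis .
  next
    case False
    then show ?thesis using corner_ket(1)[of T d k] T by (simp add: D_def)
  qed
  have cD: "clinear_op T" if "T \<in> D" for T using that CD(3) by (simp add: D_def)
  have PD: "?P i \<in> D" if "i < d" for i
  proof -
    have "{..<d} \<inter> {i} = {i}" "{i} \<inter> {..<d} = {i}" using that by auto
    then have "?P i \<in> corner d" by (simp add: corner_def clinear_op_restrict_op restrict_op_compose)
    then show ?thesis by (auto simp: D_def restrict_op_compose Int_commute)
  qed
  have "S o\<^sub>L T = T o\<^sub>L S" if S: "S \<in> D" and T: "T \<in> D" for S T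
  proof (rule clinear_op_ext_ket)
    show "clinear_op (S o\<^sub>L T)" "clinear_op (T o\<^sub>L S)" using cD S T by (auto intro: clinear_op_compose)
    fix k
    show "blinfun_apply (S o\<^sub>L T) (ket k) = blinfun_apply (T o\<^sub>L S) (ket k)"
      using diag[OF S, of k] diag[OF T, of k] cD[OF S] cD[OF T]
      by (metis (no_types, lifting) blinfun_apply_blinfun_compose clinear_op_def scaleC_scaleC mult.commute)
  qed
  then have ab: "abelian_cstar_subalgebra (corner d) D"
    unfolding abelian_cstar_subalgebra_def using csD by (auto simp: D_def)
  have max: "maximal_abelian_cstar_subalgebra (corner d) D"
    unfolding maximal_abelian_cstar_subalgebra_def
  proof (intro conjI allI impI ab)
    fix D' assume D': "abelian_cstar_subalgebra (corner d) D' \<and> D \<subseteq> D'"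
    have "T \<in> D" if "T \<in> D'" for T
      using D' that PD unfolding abelian_cstar_subalgebra_def D_def by blast
    then show "D' = D" using D' by blast
  qed
  let ?B = "?P ` {..<d}"
  have inj: "inj_on ?P {..<d}"
  proof (rule inj_onI)
    fix i j :: nat assume "?P i = ?P j"
    then have "Rep_ell2 (blinfun_apply (?P i) (ket i)) i = Rep_ell2 (blinfun_apply (?P j) (ket i)) i" by simp
    then show "i = j" by (simp add: Rep_restrict_op ket.rep_eq split: if_splits)
  qed
  have "\<not> complex_vector.dependent ?B"
  proof
    assume "complex_vector.dependent ?B"
    then obtain u where u: "\<exists>v\<in>?B. u v \<noteq> 0" "(\<Sum>v\<in>?B. u v *\<^sub>C v) = 0"
      using complex_vector.dependent_finite[of ?B] by auto
    have "u (?P i) = 0" if i: "i < d" for i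
    proof -
      have "0 = Rep_ell2 (blinfun_apply (\<Sum>v\<in>?B. u v *\<^sub>C v) (ket i)) i" using u(2) by simp
      also have "\<dots> = (\<Sum>j<d. if i = j then u (?P j) else 0)"
        unfolding sum.reindex[OF inj] o_def blinfun.sum_left Rep_ell2_sum
        by (intro sum.cong refl) (simp add: scaleC_blinfun.rep_eq scaleC_ell2.rep_eq Rep_restrict_op ket.rep_eq)
      also have "\<dots> = u (?P i)" using i by simp
      finally show ?thesis by simp
    qed
    then show False using u(1) by auto
  qed
  moreover have "D = cspan ?B"
  proof
    show "cspan ?B \<subseteq> D"
      by (rule complex_vector.span_minimal[OF _ cstar_algebraD(1)[OF csD]]) (auto simp: PD)
    show "D \<subseteq> cspan ?B"
    proof
      fix T assume T: "T \<in> D"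
      have "T = (\<Sum>i<d. Rep_ell2 (blinfun_apply T (ket i)) i *\<^sub>C ?P i)" (is "T = ?T'")
      proof (rule clinear_op_ext_ket[OF cD[OF T]])
        have "?T' \<in> D"
          by (intro complex_vector.subspace_sum[OF cstar_algebraD(1)[OF csD]] cstar_algebraD(8)[OF csD] PD) auto
        then show "clinear_op ?T'" by (rule cD)
        fix k
        have "blinfun_apply ?T' (ket k) = (\<Sum>i<d. if i = k then Rep_ell2 (blinfun_apply T (ket k)) k *\<^sub>C ket k else 0)"
          unfolding blinfun.sum_left by (intro sum.cong refl) (auto simp: scaleC_blinfun.rep_eq restrict_op_ket)
        also have "\<dots> = (if k < d then Rep_ell2 (blinfun_apply T (ket k)) k *\<^sub>C ket k else 0)" by simp
        also have "\<dots> = blinfun_apply T (ket k)"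
          using diag[OF T, of k] corner_ket(1)[of T d k] T by (auto simp: D_def)
        finally show "blinfun_apply T (ket k) = blinfun_apply ?T' (ket k)" by simp
      qed
      also have "?T' \<in> cspan ?B"
        by (intro complex_vector.span_sum complex_vector.span_scale complex_vector.span_base) auto
      finally show "T \<in> cspan ?B" .
    qed
  qed
  ultimately have "cdim D = card ?B"
    using complex_vector.dim_span_eq_card_independent by metis
  also have "\<dots> = d" using inj by (simp add: card_image)
  finally show ?thesis unfolding has_rank_def using max by blast
qed

text \<open>The bicommutant within \<open>B\<close> of the self-adjoint element \<open>X = T\<^sup>* T\<close> is abelian and contains \<open>X\<close>. If \<open>0\<close>
is a maximal abelian subalgebra, this bicommutant vanishes, so \<open>T\<^sup>* T = 0\<close> and \<open>T = 0\<close>.\<close>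

lemma has_rank_0_imp_trivial:
  assumes B: "fin_dim_cstar_algebra B" and r: "has_rank B 0" and T: "T \<in> B"
  shows "T = 0"
proof -
  have cs: "cstar_algebra B" using B by (simp add: fin_dim_cstar_algebra_def)
  note BD = cstar_algebraD[OF cs]
  obtain S where S: "finite S" "B = cspan S" using B by (auto simp: fin_dim_cstar_algebra_def)
  obtain D where D: "maximal_abelian_cstar_subalgebra B D" "cdim D = 0" using r by (auto simp: has_rank_def)
  have D0: "D \<subseteq> {0}"
  proof -
    have DB: "D \<subseteq> B" using D by (auto simp: maximal_abelian_cstar_subalgebra_def abelian_cstar_subalgebra_def)
    obtain b where b: "b \<subseteq> D" "\<not> complex_vector.dependent b" "D \<subseteq> cspan b" "card b = cdim D"
      using complex_vector.basis_exists[of D] by metis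
    have "finite b"
      using complex_vector.independent_span_bound[OF S(1) b(2)] b(1) DB S(2) by auto
    then have "b = {}" using b(4) D(2) by simp
    then show ?thesis using b(3) by simp
  qed
  define X where "X = adj T o\<^sub>L T"
  have X: "X \<in> B" using BD T by (simp add: X_def)
  have sa: "adj X = X" using BD(3)[OF T] by (simp add: X_def adj_compose adj_adj clinear_op_adj)
  \<comment> \<open>The commutant of \<open>X\<close> in \<open>B\<close>, then the commutant of that.\<close>
  define C where "C = {R \<in> B. \<forall>Y\<in>{X}. R o\<^sub>L Y = Y o\<^sub>L R}"
  define E where "E = {R \<in> B. \<forall>Y\<in>C. R o\<^sub>L Y = Y o\<^sub>L R}"
  have csC: "cstar_algebra C" unfolding C_def
    by (rule cstar_algebra_commutant[OF cs]) (use sa BD(3)[OF X] in auto)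
  have csE: "cstar_algebra E" unfolding E_def
    by (rule cstar_algebra_commutant[OF cs]) (use cstar_algebraD[OF csC] in auto)
  have XC: "X \<in> C" using X by (simp add: C_def)
  have EC: "E \<subseteq> C" using XC by (auto simp: E_def C_def)
  have XE: "X \<in> E" using X by (auto simp: E_def C_def)
  have abE: "abelian_cstar_subalgebra B E"
    unfolding abelian_cstar_subalgebra_def using csE EC by (auto simp: E_def)
  have "D \<subseteq> E" using D0 cstar_algebraD(9)[OF csE] by auto
  then have "E = D" using D(1) abE by (auto simp: maximal_abelian_cstar_subalgebra_def)
  then have X0: "X = 0" using XE D0 by auto
  show "T = 0"
  proof (rule blinfun_eqI)
    fix f
    have "cinner (blinfun_apply T f) (blinfun_apply T f) = cinner f (blinfun_apply X f)"
      using cinner_adj'[OF BD(3)[OF T]] by (simp add: X_def)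
    then have "norm (blinfun_apply T f) = 0" unfolding X0 cinner_self by simp
    then show "blinfun_apply T f = blinfun_apply 0 f" by simp
  qed
qed

section \<open>Compression to a finite set and block-diagonal amplification\<close>

text \<open>An injection of \<open>S\<close> into another index set induces a partial isometry and its adjoint. They
are set to zero when \<open>k\<close> is not injective on \<open>S\<close>, so that both are defined for all arguments.\<close>

lift_definition pull_ell2 :: "('a \<Rightarrow> 'b) \<Rightarrow> 'a set \<Rightarrow> 'b ell2 \<Rightarrow> 'a ell2"
  is "\<lambda>k S g a. if inj_on k S \<and> a \<in> S then g (k a) else 0"
proof -
  fix k :: "'a \<Rightarrow> 'b" and S and g :: "'b \<Rightarrow> complex"
  assume g: "(\<lambda>x. (cmod (g x))\<^sup>2) summable_on UNIV"
  show "(\<lambda>a. (cmod (if inj_on k S \<and> a \<in> S then g (k a) else 0))\<^sup>2) summable_on UNIV"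
  proof (cases "inj_on k S")
    case True
    have "(\<lambda>x. (cmod (g x))\<^sup>2) summable_on k ` S" using g by (rule summable_on_subset_banach) simp
    then have "(\<lambda>a. (cmod (g (k a)))\<^sup>2) summable_on S"
      using True by (simp add: summable_on_reindex o_def)
    also have "?this \<longleftrightarrow> ?thesis" using True by (intro summable_on_cong_neutral) auto
    finally show ?thesis .
  qed simp
qed

lift_definition push_ell2 :: "('a \<Rightarrow> 'b) \<Rightarrow> 'a set \<Rightarrow> 'a ell2 \<Rightarrow> 'b ell2"
  is "\<lambda>k S f b. if inj_on k S \<and> b \<in> k ` S then f (the_inv_into S k b) else 0"
proof -
  fix k :: "'a \<Rightarrow> 'b" and S and f :: "'a \<Rightarrow> complex"
  assume f: "(\<lambda>x. (cmod (f x))\<^sup>2) summable_on UNIV"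
  show "(\<lambda>b. (cmod (if inj_on k S \<and> b \<in> k ` S then f (the_inv_into S k b) else 0))\<^sup>2) summable_on UNIV"
  proof (cases "inj_on k S")
    case True
    have "(\<lambda>x. (cmod (f x))\<^sup>2) summable_on S" using f by (rule summable_on_subset_banach) simp
    also have "?this \<longleftrightarrow> (\<lambda>a. (cmod (f (the_inv_into S k (k a))))\<^sup>2) summable_on S"
      using True by (intro summable_on_cong) (simp add: the_inv_into_f_f)
    also have "\<dots> \<longleftrightarrow> (\<lambda>b. (cmod (f (the_inv_into S k b)))\<^sup>2) summable_on k ` S"
      using True by (simp add: summable_on_reindex o_def)
    also have "\<dots> \<longleftrightarrow> ?thesis" using True by (intro summable_on_cong_neutral) auto
    finally show ?thesis .
  qed (simp cong: if_cong)
qed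

lemma Rep_push_ell2: "inj_on k S \<Longrightarrow> a \<in> S \<Longrightarrow> Rep_ell2 (push_ell2 k S f) (k a) = Rep_ell2 f a"
  by (simp add: push_ell2.rep_eq the_inv_into_f_f)

lemma Rep_push_ell2_0: "b \<notin> k ` S \<Longrightarrow> Rep_ell2 (push_ell2 k S f) b = 0"
  by (simp add: push_ell2.rep_eq)

lemma norm_pull_ell2_le: "norm (pull_ell2 k S g) \<le> norm g"
proof (cases "inj_on k S")
  case True
  have "(norm (pull_ell2 k S g))\<^sup>2 = (\<Sum>\<^sub>\<infinity>a\<in>S. (cmod (Rep_ell2 g (k a)))\<^sup>2)"
    unfolding norm_ell2_square pull_ell2.rep_eq using True by (intro infsum_cong_neutral) auto
  also have "\<dots> = (\<Sum>\<^sub>\<infinity>b\<in>k ` S. (cmod (Rep_ell2 g b))\<^sup>2)"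
    using True by (simp add: infsum_reindex o_def)
  also have "\<dots> \<le> (norm g)\<^sup>2"
    unfolding norm_ell2_square by (intro infsum_mono2 ell2_summable) auto
  finally show ?thesis by (simp add: power2_le_iff_abs_le)
next
  case False
  then have "pull_ell2 k S g = 0" by (intro ell2_eqI) (simp add: pull_ell2.rep_eq)
  then show ?thesis by simp
qed

lemma norm_push_ell2_le: "norm (push_ell2 k S f) \<le> norm (restrict_ell2 S f)"
proof (cases "inj_on k S")
  case True
  have "(norm (push_ell2 k S f))\<^sup>2 = (\<Sum>\<^sub>\<infinity>b\<in>k ` S. (cmod (Rep_ell2 f (the_inv_into S k b)))\<^sup>2)"
    unfolding norm_ell2_square push_ell2.rep_eq using True by (intro infsum_cong_neutral) auto
  also have "\<dots> = (\<Sum>\<^sub>\<infinity>a\<in>S. (cmod (Rep_ell2 f (the_inv_into S k (k a))))\<^sup>2)"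
    using True by (simp add: infsum_reindex o_def)
  also have "\<dots> = (norm (restrict_ell2 S f))\<^sup>2"
    unfolding norm_ell2_square restrict_ell2.rep_eq using True
    by (intro infsum_cong_neutral) (auto simp: the_inv_into_f_f)
  finally show ?thesis by (simp add: power2_eq_iff_nonneg)
next
  case False
  then have "push_ell2 k S f = 0" by (intro ell2_eqI) (simp add: push_ell2.rep_eq)
  then show ?thesis by simp
qed

lemma norm_restrict_ell2_le: "norm (restrict_ell2 S f) \<le> norm f"
  by (rule norm_ell2_le) (simp add: restrict_ell2.rep_eq)

lemma cinner_push_ell2:
  assumes "inj_on k S"
  shows "cinner (push_ell2 k S f) g = cinner f (pull_ell2 k S g)"
proof -
  have "cinner (push_ell2 k S f) g = (\<Sum>\<^sub>\<infinity>b\<in>k ` S. cnj (Rep_ell2 f (the_inv_into S k b)) * Rep_ell2 g b)"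
    unfolding cinner_ell2.rep_eq push_ell2.rep_eq using assms by (intro infsum_cong_neutral) auto
  also have "\<dots> = (\<Sum>\<^sub>\<infinity>a\<in>S. cnj (Rep_ell2 f a) * Rep_ell2 g (k a))"
    using assms by (subst infsum_reindex) (auto simp: o_def the_inv_into_f_f intro!: infsum_cong)
  also have "\<dots> = cinner f (pull_ell2 k S g)"
    unfolding cinner_ell2.rep_eq pull_ell2.rep_eq using assms by (intro infsum_cong_neutral) auto
  finally show ?thesis .
qed

lemma push_ell2_add: "push_ell2 k S (f + g) = push_ell2 k S f + push_ell2 k S g"
  by (rule ell2_eqI) (simp add: push_ell2.rep_eq plus_ell2.rep_eq)
lemma pull_ell2_add: "pull_ell2 k S (f + g) = pull_ell2 k S f + pull_ell2 k S g"
  by (rule ell2_eqI) (simp add: pull_ell2.rep_eq plus_ell2.rep_eq)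
lemma push_ell2_scaleC: "push_ell2 k S (c *\<^sub>C f) = c *\<^sub>C push_ell2 k S f"
  by (rule ell2_eqI) (simp add: push_ell2.rep_eq scaleC_ell2.rep_eq)
lemma pull_ell2_scaleC: "pull_ell2 k S (c *\<^sub>C f) = c *\<^sub>C pull_ell2 k S f"
  by (rule ell2_eqI) (simp add: pull_ell2.rep_eq scaleC_ell2.rep_eq)

lift_definition pull_op :: "('a \<Rightarrow> 'b) \<Rightarrow> 'a set \<Rightarrow> 'b ell2 \<Rightarrow>\<^sub>L 'a ell2" is pull_ell2
proof (rule bounded_linear_intro[where K = 1])
  fix k :: "'a \<Rightarrow> 'b" and S and f g :: "'b ell2" and r :: real
  show "pull_ell2 k S (f + g) = pull_ell2 k S f + pull_ell2 k S g"
    by (rule pull_ell2_add)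
  show "pull_ell2 k S (r *\<^sub>R f) = r *\<^sub>R pull_ell2 k S f"
    by (simp add: pull_ell2_scaleC flip: scaleC_of_real)
  show "norm (pull_ell2 k S f) \<le> norm f * 1" by (simp add: norm_pull_ell2_le)
qed

lift_definition push_op :: "('a \<Rightarrow> 'b) \<Rightarrow> 'a set \<Rightarrow> 'a ell2 \<Rightarrow>\<^sub>L 'b ell2" is push_ell2
proof (rule bounded_linear_intro[where K = 1])
  fix k :: "'a \<Rightarrow> 'b" and S and f g :: "'a ell2" and r :: real
  show "push_ell2 k S (f + g) = push_ell2 k S f + push_ell2 k S g"
    by (rule push_ell2_add)
  show "push_ell2 k S (r *\<^sub>R f) = r *\<^sub>R push_ell2 k S f"
    by (simp add: push_ell2_scaleC flip: scaleC_of_real)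
  show "norm (push_ell2 k S f) \<le> norm f * 1"
    using order_trans[OF norm_push_ell2_le norm_restrict_ell2_le] by simp
qed

definition compress :: "(nat \<Rightarrow> 'a) \<Rightarrow> nat \<Rightarrow> ('a ell2 \<Rightarrow>\<^sub>L 'a ell2) \<Rightarrow> (nat ell2 \<Rightarrow>\<^sub>L nat ell2)" where
  "compress p d T = pull_op p {..<d} o\<^sub>L (T o\<^sub>L push_op p {..<d})"

lemma compress_apply: "blinfun_apply (compress p d T) f = pull_ell2 p {..<d} (blinfun_apply T (push_ell2 p {..<d} f))"
  by (simp add: compress_def pull_op.rep_eq push_op.rep_eq)

lemma clinear_op_compress: "clinear_op T \<Longrightarrow> clinear_op (compress p d T)"
  by (simp add: clinear_op_def compress_apply push_ell2_scaleC pull_ell2_scaleC)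

lemma compress_in_corner:
  assumes "clinear_op T" "inj_on p {..<d}"
  shows "compress p d T \<in> corner d"
  unfolding corner_def
proof (intro CollectI conjI clinear_op_compress assms blinfun_eqI)
  fix f
  have "push_ell2 p {..<d} (restrict_ell2 {..<d} f) = push_ell2 p {..<d} f"
  proof (rule ell2_eqI)
    fix b show "Rep_ell2 (push_ell2 p {..<d} (restrict_ell2 {..<d} f)) b = Rep_ell2 (push_ell2 p {..<d} f) b"
      using assms(2) by (cases "b \<in> p ` {..<d}") (auto simp: Rep_push_ell2 Rep_push_ell2_0 restrict_ell2.rep_eq)
  qed
  then show "blinfun_apply (compress p d T o\<^sub>L restrict_op {..<d}) f = blinfun_apply (compress p d T) f"
    by (simp add: compress_apply restrict_op.rep_eq)
  show "blinfun_apply (restrict_op {..<d} o\<^sub>L compress p d T) f = blinfun_apply (compress p d T) f"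
    by (rule ell2_eqI) (simp add: compress_apply Rep_restrict_op pull_ell2.rep_eq)
qed

lemma positive_matrixI_cinner:
  assumes "positive_matrix n X"
    and "\<And>\<xi>. \<exists>\<eta>. (\<Sum>i<n. \<Sum>j<n. cinner (\<xi> i) (blinfun_apply (Y i j) (\<xi> j)))
        = (\<Sum>i<n. \<Sum>j<n. cinner (\<eta> i) (blinfun_apply (X i j) (\<eta> j)))"
  shows "positive_matrix n Y"
  unfolding positive_matrix_def
proof
  fix \<xi>
  obtain \<eta> where "(\<Sum>i<n. \<Sum>j<n. cinner (\<xi> i) (blinfun_apply (Y i j) (\<xi> j)))
      = (\<Sum>i<n. \<Sum>j<n. cinner (\<eta> i) (blinfun_apply (X i j) (\<eta> j)))"
    using assms(2)[of \<xi>] ..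
  then show "(\<Sum>i<n. \<Sum>j<n. cinner (\<xi> i) (blinfun_apply (Y i j) (\<xi> j))) \<in> \<real>\<^sub>\<ge>\<^sub>0"
    using assms(1) by (simp add: positive_matrix_def)
qed

text \<open>Compression is \<open>T \<mapsto> V\<^sup>* T V\<close> for a partial isometry \<open>V\<close>; positivity of a matrix of operators is
preserved because its quadratic form is evaluated at the vectors \<open>V \<xi>\<close>.\<close>

lemma ccp_map_compress:
  assumes A: "\<And>T. T \<in> A \<Longrightarrow> clinear_op T" and p: "inj_on p {..<d}"
  shows "ccp_map A (corner d) (compress p d)"
  unfolding ccp_map_def completely_positive_def
proof (intro conjI ballI allI impI)
  show "clinear_on A (compress p d)"
    unfolding clinear_on_def compress_def
    by (auto intro!: blinfun_eqI simp: blinfun.add_left blinfun.add_right scaleC_blinfun.rep_eq pull_op.rep_eq pull_ell2_add pull_ell2_scaleC)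
  fix n X assume X: "(\<forall>i<n. \<forall>j<n. X i j \<in> A) \<and> positive_matrix n X"
  then have "positive_matrix n X" by blast
  then show "positive_matrix n (\<lambda>i j. compress p d (X i j))"
  proof (rule positive_matrixI_cinner)
    fix \<xi> :: "nat \<Rightarrow> nat ell2"
    show "\<exists>\<eta>. (\<Sum>i<n. \<Sum>j<n. cinner (\<xi> i) (blinfun_apply (compress p d (X i j)) (\<xi> j)))
        = (\<Sum>i<n. \<Sum>j<n. cinner (\<eta> i) (blinfun_apply (X i j) (\<eta> j)))"
      by (intro exI[of _ "\<lambda>i. push_ell2 p {..<d} (\<xi> i)"]) (simp add: compress_apply cinner_push_ell2[OF p])
  qed
next
  fix T assume T: "T \<in> A"
  show "compress p d T \<in> corner d" by (rule compress_in_corner[OF A[OF T] p])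
  show "norm (compress p d T) \<le> norm T"
  proof (rule norm_blinfun_bound)
    fix f :: "nat ell2"
    have "norm (blinfun_apply (compress p d T) f) \<le> norm (blinfun_apply T (push_ell2 p {..<d} f))"
      unfolding compress_apply by (rule norm_pull_ell2_le)
    also have "\<dots> \<le> norm T * norm (push_ell2 p {..<d} f)" by (rule norm_blinfun)
    also have "\<dots> \<le> norm T * norm f"
      by (intro mult_left_mono order_trans[OF norm_push_ell2_le norm_restrict_ell2_le]) simp
    finally show "norm (blinfun_apply (compress p d T) f) \<le> norm T * norm f" .
  qed simp
qed

lemma has_sum_nonneg_Reals:
  fixes f :: "'c \<Rightarrow> complex"
  assumes "(f has_sum s) S" "\<And>x. x \<in> S \<Longrightarrow> f x \<in> \<real>\<^sub>\<ge>\<^sub>0"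
  shows "s \<in> \<real>\<^sub>\<ge>\<^sub>0"
proof -
  have re_im: "((\<lambda>x. Re (f x)) has_sum Re s) S" "((\<lambda>x. Im (f x)) has_sum Im s) S"
    using assms(1) by (rule has_sum_Re, rule has_sum_Im)
  have "Re (f x) \<ge> 0" "Im (f x) = 0" if "x \<in> S" for x
    using assms(2)[OF that] by (auto simp: complex_nonneg_Reals_iff)
  note pos = this
  have "((\<lambda>x. Im (f x)) has_sum 0) S" using pos(2) by (rule has_sum_0)
  then have "Im s = 0" using re_im(2) has_sum_unique by metis
  moreover have "Re s \<ge> 0" by (rule has_sum_nonneg[OF re_im(1) pos(1)])
  ultimately show ?thesis by (simp add: complex_nonneg_Reals_iff)
qed

lemma has_sum_finite_sum:
  fixes f :: "'i \<Rightarrow> 'c \<Rightarrow> complex"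
  assumes "\<And>i. i \<in> I \<Longrightarrow> (f i has_sum s i) S"
  shows "((\<lambda>x. \<Sum>i\<in>I. f i x) has_sum (\<Sum>i\<in>I. s i)) S"
  using assms by (induction I rule: infinite_finite_induct) (auto intro: has_sum_add)

text \<open>The index set is partitioned into the fibres of \<open>r\<close>, and \<open>k\<close> identifies each fibre with a set of
numbers. An operator on \<open>\<ell>\<^sup>2(\<nat>)\<close> then acts simultaneously on all the blocks: this is
\<open>X \<mapsto> W\<^sup>* (X \<otimes> 1) W\<close> for the isometry \<open>W\<close> that sends the basis vector at \<open>t\<close> to the one at
\<open>(k t, r t)\<close>. The tensor product is avoided by working on one fibre at a time.\<close>

locale blocks =
  fixes r :: "'a \<Rightarrow> 'r" and k :: "'a \<Rightarrow> nat"
  assumes inj: "inj_on k {s. r s = b}"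
begin

abbreviation fibre :: "'r \<Rightarrow> 'a set" where "fibre b \<equiv> {s. r s = b}"

abbreviation inflate_fun :: "(nat ell2 \<Rightarrow>\<^sub>L nat ell2) \<Rightarrow> 'a ell2 \<Rightarrow> 'a \<Rightarrow> complex" where
  "inflate_fun X f t \<equiv> Rep_ell2 (blinfun_apply X (push_ell2 k (fibre (r t)) f)) (k t)"

lemma sum_inflate_le:
  assumes F: "finite F"
  shows "(\<Sum>t\<in>F. (cmod (inflate_fun X f t))\<^sup>2) \<le> (norm X * norm f)\<^sup>2"
proof -
  let ?g = "\<lambda>b. pull_ell2 k (fibre b) (blinfun_apply X (push_ell2 k (fibre b) f))"
  have "(\<Sum>t\<in>F. (cmod (inflate_fun X f t))\<^sup>2) = (\<Sum>b\<in>r ` F. \<Sum>t | t \<in> F \<and> r t = b. (cmod (inflate_fun X f t))\<^sup>2)"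
    by (rule sum.image_gen[OF F])
  also have "\<dots> \<le> (\<Sum>b\<in>r ` F. (norm X)\<^sup>2 * (norm (restrict_ell2 (fibre b) f))\<^sup>2)"
  proof (rule sum_mono)
    fix b
    have "(\<Sum>t | t \<in> F \<and> r t = b. (cmod (inflate_fun X f t))\<^sup>2) = (\<Sum>t | t \<in> F \<and> r t = b. (cmod (Rep_ell2 (?g b) t))\<^sup>2)"
      using inj by (intro sum.cong refl) (auto simp: pull_ell2.rep_eq)
    also have "\<dots> \<le> (norm (?g b))\<^sup>2" using F by (intro sum_le_norm_ell2_square) auto
    also have "\<dots> \<le> (norm X * norm (restrict_ell2 (fibre b) f))\<^sup>2"
      by (intro power_mono order_trans[OF norm_pull_ell2_le] order_trans[OF norm_blinfun] mult_left_mono norm_push_ell2_le) auto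
    finally show "(\<Sum>t | t \<in> F \<and> r t = b. (cmod (inflate_fun X f t))\<^sup>2) \<le> (norm X)\<^sup>2 * (norm (restrict_ell2 (fibre b) f))\<^sup>2"
      by (simp add: power_mult_distrib)
  qed
  also have "\<dots> = (norm X)\<^sup>2 * (\<Sum>b\<in>r ` F. (norm (restrict_ell2 (fibre b) f))\<^sup>2)"
    by (simp add: sum_distrib_left)
  also have "\<dots> \<le> (norm X)\<^sup>2 * (norm f)\<^sup>2"
    using F by (intro mult_left_mono sum_norm_restrict_disjoint_le) auto
  finally show ?thesis by (simp add: power_mult_distrib)
qed

lemma inflate_summable: "(\<lambda>t. (cmod (inflate_fun X f t))\<^sup>2) summable_on UNIV"
  using sum_inflate_le by (intro nonneg_bdd_above_summable_on bdd_aboveI2[where M = "(norm X * norm f)\<^sup>2"]) auto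

definition inflate :: "(nat ell2 \<Rightarrow>\<^sub>L nat ell2) \<Rightarrow> ('a ell2 \<Rightarrow>\<^sub>L 'a ell2)" where
  "inflate X = Blinfun (\<lambda>f. Abs_ell2 (inflate_fun X f))"

lemma Rep_Abs_inflate: "Rep_ell2 (Abs_ell2 (inflate_fun X f)) = inflate_fun X f"
  using inflate_summable by (intro Abs_ell2_inverse) simp

lemma norm_inflate_fun_le: "norm (Abs_ell2 (inflate_fun X f)) \<le> norm X * norm f"
proof -
  have "(norm (Abs_ell2 (inflate_fun X f)))\<^sup>2 \<le> (norm X * norm f)\<^sup>2"
    unfolding norm_ell2_square Rep_Abs_inflate using sum_inflate_le inflate_summable
    by (intro infsum_le_finite_sums) auto
  then show ?thesis by (simp add: power2_le_iff_abs_le)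
qed

lemma bounded_linear_inflate: "bounded_linear (\<lambda>f. Abs_ell2 (inflate_fun X f))"
proof (rule bounded_linear_intro[where K = "norm X"])
  show "Abs_ell2 (inflate_fun X (f + g)) = Abs_ell2 (inflate_fun X f) + Abs_ell2 (inflate_fun X g)" for f g
    by (rule ell2_eqI, unfold Rep_Abs_inflate plus_ell2.rep_eq)
      (simp add: push_ell2_add blinfun.add_right plus_ell2.rep_eq)
  show "Abs_ell2 (inflate_fun X (c *\<^sub>R f)) = c *\<^sub>R Abs_ell2 (inflate_fun X f)" for c f
  proof (rule ell2_eqI, unfold Rep_Abs_inflate scaleR_ell2.rep_eq)
    fix t
    have "push_ell2 k S (c *\<^sub>R f) = c *\<^sub>R push_ell2 k S f" for S
      by (simp add: push_ell2_scaleC flip: scaleC_of_real)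
    then show "inflate_fun X (c *\<^sub>R f) t = of_real c * inflate_fun X f t"
      by (simp add: blinfun.scaleR_right scaleR_ell2.rep_eq)
  qed
  show "norm (Abs_ell2 (inflate_fun X f)) \<le> norm f * norm X" for f
    using norm_inflate_fun_le[of X f] by (simp add: mult.commute)
qed

lemma Rep_inflate: "Rep_ell2 (blinfun_apply (inflate X) f) t = inflate_fun X f t"
  by (simp add: inflate_def bounded_linear_Blinfun_apply[OF bounded_linear_inflate] Rep_Abs_inflate)

lemma norm_inflate_le: "norm (inflate X) \<le> norm X"
  by (rule norm_blinfun_bound)
    (simp_all add: inflate_def bounded_linear_Blinfun_apply[OF bounded_linear_inflate] norm_inflate_fun_le)

lemma clinear_op_inflate: "clinear_op X \<Longrightarrow> clinear_op (inflate X)"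
  unfolding clinear_op_def
  by (intro allI ell2_eqI) (simp add: Rep_inflate push_ell2_scaleC scaleC_ell2.rep_eq)

lemma clinear_on_inflate: "clinear_on B inflate"
  unfolding clinear_on_def
  by (auto intro!: blinfun_eqI ell2_eqI
      simp: Rep_inflate blinfun.add_left plus_ell2.rep_eq scaleC_blinfun.rep_eq scaleC_ell2.rep_eq)

text \<open>Summing the inner product fibre by fibre. This is the source of complete positivity: the quadratic
form of an amplified matrix of operators is a sum of values of the quadratic form of that matrix.\<close>

lemma cinner_inflate_has_sum:
  "((\<lambda>b. cinner (push_ell2 k (fibre b) f) (blinfun_apply X (push_ell2 k (fibre b) g))) has_sum
      cinner f (blinfun_apply (inflate X) g)) UNIV"
proof -
  let ?h = "\<lambda>t. cnj (Rep_ell2 f t) * inflate_fun X g t"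
  have sm: "(\<lambda>t. cnj (Rep_ell2 f1 t) * Rep_ell2 f2 t) summable_on S" for f1 f2 :: "'a ell2" and S
    using square_summable_prod[of "Rep_ell2 f1" "Rep_ell2 f2"] Rep_ell2[of f1] Rep_ell2[of f2]
    by (auto intro: summable_on_subset_banach)
  have "(?h has_sum cinner f (blinfun_apply (inflate X) g)) UNIV"
    using has_sum_infsum[OF sm[of f "blinfun_apply (inflate X) g" UNIV]]
    by (simp add: cinner_ell2.rep_eq Rep_inflate)
  also have "?this \<longleftrightarrow> ((\<lambda>(b, t). ?h t) has_sum cinner f (blinfun_apply (inflate X) g)) (Sigma UNIV fibre)"
    by (rule has_sum_reindex_bij_witness[where j = "\<lambda>t. (r t, t)" and i = snd]) auto
  finally show ?thesis
  proof (rule has_sum_SigmaD)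
    fix b
    let ?g = "pull_ell2 k (fibre b) (blinfun_apply X (push_ell2 k (fibre b) g))"
    have "((\<lambda>t. cnj (Rep_ell2 f t) * Rep_ell2 ?g t) has_sum cinner f ?g) UNIV"
      using has_sum_infsum[OF sm[of f ?g UNIV]] by (simp add: cinner_ell2.rep_eq)
    also have "?this \<longleftrightarrow> (?h has_sum cinner f ?g) (fibre b)"
      using inj by (intro has_sum_cong_neutral) (auto simp: pull_ell2.rep_eq)
    finally show "((\<lambda>t. (case (b, t) of (b, t) \<Rightarrow> ?h t)) has_sum
        cinner (push_ell2 k (fibre b) f) (blinfun_apply X (push_ell2 k (fibre b) g))) (fibre b)"
      by (simp add: cinner_push_ell2[OF inj])
  qed
qed

lemma completely_positive_inflate: "completely_positive B inflate"
  unfolding completely_positive_def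
proof (intro conjI allI impI clinear_on_inflate)
  fix n X assume "(\<forall>i<n. \<forall>j<n. X i j \<in> B) \<and> positive_matrix n X"
  then have X: "positive_matrix n X" by blast
  show "positive_matrix n (\<lambda>i j. inflate (X i j))"
    unfolding positive_matrix_def
  proof
    fix \<xi> :: "nat \<Rightarrow> 'a ell2"
    let ?p = "\<lambda>b i. push_ell2 k (fibre b) (\<xi> i)"
    have "((\<lambda>b. \<Sum>i<n. \<Sum>j<n. cinner (?p b i) (blinfun_apply (X i j) (?p b j))) has_sum
        (\<Sum>i<n. \<Sum>j<n. cinner (\<xi> i) (blinfun_apply (inflate (X i j)) (\<xi> j)))) UNIV"
      by (intro has_sum_finite_sum cinner_inflate_has_sum)
    then show "(\<Sum>i<n. \<Sum>j<n. cinner (\<xi> i) (blinfun_apply (inflate (X i j)) (\<xi> j))) \<in> \<real>\<^sub>\<ge>\<^sub>0"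
      by (rule has_sum_nonneg_Reals) (use X in \<open>auto simp: positive_matrix_def\<close>)
  qed
qed

lemma ccp_map_inflate:
  assumes "\<And>T. T \<in> B \<Longrightarrow> clinear_op T"
  shows "ccp_map B {T. clinear_op T} inflate"
  unfolding ccp_map_def using assms completely_positive_inflate clinear_op_inflate norm_inflate_le by blast

end

lemma ccp_map_average:
  fixes f :: "'i \<Rightarrow> ('h::chilbert_space \<Rightarrow>\<^sub>L 'h) \<Rightarrow> ('k::chilbert_space \<Rightarrow>\<^sub>L 'k)"
  assumes I: "finite I" "I \<noteq> {}" and f: "\<And>i. i \<in> I \<Longrightarrow> ccp_map A {T. clinear_op T} (f i)"
  shows "ccp_map A {T. clinear_op T} (\<lambda>T. of_real (1 / real (card I)) *\<^sub>C (\<Sum>i\<in>I. f i T))"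
  unfolding ccp_map_def completely_positive_def
proof (intro conjI allI impI ballI)
  define c where "c = 1 / real (card I)"
  have c: "c > 0" using I by (simp add: c_def card_gt_0_iff)
  show "clinear_on A (\<lambda>T. of_real (1 / real (card I)) *\<^sub>C (\<Sum>i\<in>I. f i T))"
    unfolding clinear_on_def
  proof (intro conjI ballI allI)
    have lin: "clinear_on A (f i)" if "i \<in> I" for i
      using f[OF that] by (simp add: ccp_map_def completely_positive_def)
    fix S T assume ST: "S \<in> A" "T \<in> A"
    have "(\<Sum>i\<in>I. f i (S + T)) = (\<Sum>i\<in>I. f i S) + (\<Sum>i\<in>I. f i T)"
      unfolding sum.distrib[symmetric] using lin ST by (intro sum.cong refl) (simp add: clinear_on_def)
    then show "of_real (1 / real (card I)) *\<^sub>C (\<Sum>i\<in>I. f i (S + T))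
        = of_real (1 / real (card I)) *\<^sub>C (\<Sum>i\<in>I. f i S) + of_real (1 / real (card I)) *\<^sub>C (\<Sum>i\<in>I. f i T)"
      by (simp only: scaleC_add_right)
  next
    have lin: "clinear_on A (f i)" if "i \<in> I" for i
      using f[OF that] by (simp add: ccp_map_def completely_positive_def)
    fix z T assume T: "T \<in> A"
    have "(\<Sum>i\<in>I. f i (z *\<^sub>C T)) = z *\<^sub>C (\<Sum>i\<in>I. f i T)"
      unfolding complex_vector.scale_sum_right using lin T by (intro sum.cong refl) (simp add: clinear_on_def)
    then show "of_real (1 / real (card I)) *\<^sub>C (\<Sum>i\<in>I. f i (z *\<^sub>C T))
        = z *\<^sub>C of_real (1 / real (card I)) *\<^sub>C (\<Sum>i\<in>I. f i T)"
      by (simp only: scaleC_scaleC mult.commute)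
  qed
  show "positive_matrix n (\<lambda>a b. of_real (1 / real (card I)) *\<^sub>C (\<Sum>i\<in>I. f i (X a b)))"
    if X: "(\<forall>i<n. \<forall>j<n. X i j \<in> A) \<and> positive_matrix n X" for n X
    unfolding positive_matrix_def
  proof
    fix \<xi> :: "nat \<Rightarrow> 'k"
    have pos: "(\<Sum>a<n. \<Sum>b<n. cinner (\<xi> a) (blinfun_apply (f i (X a b)) (\<xi> b))) \<in> \<real>\<^sub>\<ge>\<^sub>0" if "i \<in> I" for i
      using f[OF that] X unfolding ccp_map_def completely_positive_def positive_matrix_def by blast
    have "(\<Sum>a<n. \<Sum>b<n. cinner (\<xi> a) (blinfun_apply (of_real (1 / real (card I)) *\<^sub>C (\<Sum>i\<in>I. f i (X a b))) (\<xi> b)))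
        = (\<Sum>a<n. \<Sum>b<n. \<Sum>i\<in>I. of_real c * cinner (\<xi> a) (blinfun_apply (f i (X a b)) (\<xi> b)))"
      unfolding c_def[symmetric]
      by (simp add: scaleC_blinfun.rep_eq cinner_scaleC_right blinfun.sum_left cinner_sum_right sum_distrib_left)
    also have "\<dots> = (\<Sum>a<n. \<Sum>i\<in>I. \<Sum>b<n. of_real c * cinner (\<xi> a) (blinfun_apply (f i (X a b)) (\<xi> b)))"
      by (intro sum.cong refl sum.swap)
    also have "\<dots> = (\<Sum>i\<in>I. \<Sum>a<n. \<Sum>b<n. of_real c * cinner (\<xi> a) (blinfun_apply (f i (X a b)) (\<xi> b)))"
      by (rule sum.swap)
    also have "\<dots> = (\<Sum>i\<in>I. of_real c * (\<Sum>a<n. \<Sum>b<n. cinner (\<xi> a) (blinfun_apply (f i (X a b)) (\<xi> b))))"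
      by (simp add: sum_distrib_left)
    also have "\<dots> \<in> \<real>\<^sub>\<ge>\<^sub>0"
      using pos c by (intro has_sum_nonneg_Reals[OF has_sum_finite[OF I(1)]] nonneg_Reals_mult_I) auto
    finally show "(\<Sum>a<n. \<Sum>b<n. cinner (\<xi> a) (blinfun_apply (of_real (1 / real (card I)) *\<^sub>C (\<Sum>i\<in>I. f i (X a b))) (\<xi> b))) \<in> \<real>\<^sub>\<ge>\<^sub>0" .
  qed
  fix T assume T: "T \<in> A"
  have fT: "clinear_op (f i T)" "norm (f i T) \<le> norm T" if "i \<in> I" for i
    using f[OF that] T by (auto simp: ccp_map_def)
  have "clinear_op (\<Sum>i\<in>I. f i T)"
    using fT(1) by (induction I rule: infinite_finite_induct) (auto intro: clinear_op_zero clinear_op_add)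
  then show "of_real (1 / real (card I)) *\<^sub>C (\<Sum>i\<in>I. f i T) \<in> {T. clinear_op T}"
    by (simp add: clinear_op_scaleC)
  have "norm (\<Sum>i\<in>I. f i T) \<le> real (card I) * norm T"
    by (rule sum_norm_bound) (rule fT(2))
  then have "c * norm (\<Sum>i\<in>I. f i T) \<le> c * (real (card I) * norm T)"
    using c by (intro mult_left_mono) auto
  also have "\<dots> = norm T" using I by (simp add: c_def)
  finally show "norm (of_real (1 / real (card I)) *\<^sub>C (\<Sum>i\<in>I. f i T)) \<le> norm T"
    using c unfolding norm_scaleC_blinfun c_def[symmetric] by simp
qed

section \<open>Cutting the Cayley tree into finite blocks\<close>

text \<open>Fix a finite set \<open>I\<close> of generators. Call the length of the longest initial segment of a word with
letters in \<open>I\<close> its height; removing first letters from \<open>I\<close> descends in the Cayley graph. For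
each offset \<open>m < N\<close>, every word descends until its height plus \<open>m\<close> is a multiple of \<open>N\<close>, or until
its first letter is not in \<open>I\<close>. The word that is reached is its root, and the part removed is its stem,
of length less than \<open>N\<close>. The words with the same root form a block, and the stem is the position
inside the block. Hence all blocks embed into one finite set, the short words in \<open>I\<close>.\<close>

definition prefix_length :: "'a set \<Rightarrow> ('a \<times> bool) list \<Rightarrow> nat" where
  "prefix_length I w = length (takeWhile (\<lambda>l. fst l \<in> I) w)"

definition cut :: "'a set \<Rightarrow> nat \<Rightarrow> nat \<Rightarrow> ('a \<times> bool) list \<Rightarrow> nat" where
  "cut I N m w = min (prefix_length I w) ((prefix_length I w + m) mod N)"

definition root :: "'a set \<Rightarrow> nat \<Rightarrow> nat \<Rightarrow> 'a free_group \<Rightarrow> 'a free_group" where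
  "root I N m g = Abs_free_group (drop (cut I N m (Rep_free_group g)) (Rep_free_group g))"

definition stem :: "'a set \<Rightarrow> nat \<Rightarrow> nat \<Rightarrow> 'a free_group \<Rightarrow> 'a free_group" where
  "stem I N m g = Abs_free_group (take (cut I N m (Rep_free_group g)) (Rep_free_group g))"

abbreviation letters :: "'a free_group \<Rightarrow> 'a set" where
  "letters g \<equiv> fst ` set (Rep_free_group g)"

definition short_words :: "'a set \<Rightarrow> nat \<Rightarrow> 'a free_group set" where
  "short_words I N = {g. length (Rep_free_group g) < N \<and> letters g \<subseteq> I}"

lemma Rep_Abs_free_group: "reduced_word w \<Longrightarrow> Rep_free_group (Abs_free_group w) = w"
  by (rule Abs_free_group_inverse) simp

lemma reduced_take: "reduced_word w \<Longrightarrow> reduced_word (take n w)"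
  using reduced_appendD1[of "take n w" "drop n w"] by simp
lemma stem_plus_root: "stem I N m g + root I N m g = g"
proof -
  let ?w = "Rep_free_group g" and ?c = "cut I N m (Rep_free_group g)"
  have "Abs_free_group (take ?c ?w @ drop ?c ?w) = stem I N m g + root I N m g"
    unfolding stem_def root_def by (rule Abs_free_group_append) (simp add: reduced_Rep_free_group)
  then show ?thesis by (simp add: Rep_free_group_inverse)
qed

lemma stem_in_short_words:
  assumes "N > 0"
  shows "stem I N m g \<in> short_words I N"
proof -
  let ?w = "Rep_free_group g" and ?c = "cut I N m (Rep_free_group g)"
  have "?c \<le> (prefix_length I ?w + m) mod N" by (simp add: cut_def)
  also have "\<dots> < N" using assms by simp
  finally have "length (take ?c ?w) < N" by simp
  moreover have "set (take ?c ?w) \<subseteq> set (take (prefix_length I ?w) ?w)"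
    by (rule set_take_subset_set_take) (simp add: cut_def)
  then have "fst ` set (take ?c ?w) \<subseteq> I"
    unfolding prefix_length_def takeWhile_eq_take[symmetric] by (auto dest: set_takeWhileD)
  ultimately show ?thesis
    by (simp add: short_words_def stem_def Rep_Abs_free_group reduced_take reduced_Rep_free_group)
qed

lemma sum_powers_le: "(\<Sum>i\<le>n. q ^ i) \<le> (q + 1 :: nat) ^ n"
proof (induction n)
  case (Suc n)
  have "(\<Sum>i\<le>Suc n. q ^ i) = (\<Sum>i\<le>n. q ^ i) + q * q ^ n" by simp
  also have "\<dots> \<le> (q + 1) ^ n + q * (q + 1) ^ n"
    by (intro add_mono Suc mult_left_mono power_mono) auto
  also have "\<dots> = (q + 1) ^ Suc n" by simp
  finally show ?case .
qed simp

lemma card_short_words_le: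
  assumes I: "finite I"
  shows "finite (short_words I N)" "card (short_words I N) \<le> (2 * card I + 1) ^ N"
proof -
  let ?L = "{xs. set xs \<subseteq> I \<times> (UNIV :: bool set) \<and> length xs \<le> N}"
  have fin: "finite ?L" using I by (intro finite_lists_length_le) simp
  have sub: "Rep_free_group ` short_words I N \<subseteq> ?L"
    by (force simp: short_words_def)
  have inj: "inj_on Rep_free_group (short_words I N)"
    by (simp add: inj_on_def Rep_free_group_inject)
  show "finite (short_words I N)"
    using finite_imageD[OF finite_subset[OF sub fin] inj] .
  have "card (short_words I N) \<le> card ?L"
    using card_mono[OF fin sub] card_image[OF inj] by simp
  also have "\<dots> = (\<Sum>i\<le>N. (2 * card I) ^ i)"
    using I by (subst card_lists_length_le) (simp_all add: card_cartesian_product mult.commute)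
  also have "\<dots> \<le> (2 * card I + 1) ^ N" by (rule sum_powers_le)
  finally show "card (short_words I N) \<le> (2 * card I + 1) ^ N" .
qed

abbreviation root_word :: "'a set \<Rightarrow> nat \<Rightarrow> nat \<Rightarrow> ('a \<times> bool) list \<Rightarrow> ('a \<times> bool) list" where
  "root_word I N m w \<equiv> drop (cut I N m w) w"

lemma card_residue_le_1: "card {m. m < N \<and> (a + m) mod N = (b :: nat)} \<le> 1"
proof -
  let ?S = "{m. m < N \<and> (a + m) mod N = b}"
  have le: "m = m'" if "m \<in> ?S" "m' \<in> ?S" "m' \<le> m" for m m' :: nat
  proof -
    have "(a + m) mod N = (a + m') mod N" using that by simp
    then have "N dvd (a + m) - (a + m')" using that(3) mod_eq_dvd_iff_nat[of "a + m'" "a + m" N] by simp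
    then have "N dvd m - m'" by simp
    moreover have "m - m' < N" using that(1) by auto
    ultimately have "m - m' = 0" using dvd_imp_le[of N "m - m'"] by linarith
    then show ?thesis using that(3) by simp
  qed
  have "m = m'" if "m \<in> ?S" "m' \<in> ?S" for m m'
    using le[OF that] le[OF that(2,1)] nat_le_linear[of m m'] by blast
  moreover have "finite ?S" by simp
  ultimately have "card ?S \<le> Suc 0" using card_le_Suc0_iff_eq[of ?S] by blast
  then show ?thesis by simp
qed

text \<open>An additional first letter in \<open>I\<close> raises the height by one. The root changes only when that step
starts a new level, that is, for the one offset \<open>m\<close> at which the height plus \<open>m\<close> is \<open>N - 1\<close> modulo \<open>N\<close>.\<close>

lemma card_roots_Cons_le:
  assumes "fst l \<in> I" "N > 0"
  shows "card {m. m < N \<and> root_word I N m (l # w) \<noteq> root_word I N m w} \<le> 1"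
proof -
  have "root_word I N m (l # w) = root_word I N m w" if "(prefix_length I w + m) mod N \<noteq> N - 1" for m
  proof -
    let ?p = "prefix_length I w"
    have pl: "prefix_length I (l # w) = Suc ?p" using assms by (simp add: prefix_length_def)
    have "Suc ((?p + m) mod N) \<noteq> N" using that by auto
    then have "(Suc ?p + m) mod N = Suc ((?p + m) mod N)" by (simp add: mod_Suc)
    then have "cut I N m (l # w) = Suc (cut I N m w)" by (simp add: cut_def pl)
    then show ?thesis by simp
  qed
  then have "{m. m < N \<and> root_word I N m (l # w) \<noteq> root_word I N m w} \<subseteq> {m. m < N \<and> (prefix_length I w + m) mod N = N - 1}"
    by blast
  then have "card {m. m < N \<and> root_word I N m (l # w) \<noteq> root_word I N m w} \<le> card {m. m < N \<and> (prefix_length I w + m) mod N = N - 1}"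
    by (intro card_mono) auto
  then show ?thesis using card_residue_le_1[of N "prefix_length I w" "N - 1"] by linarith
qed

text \<open>Multiplication by a letter either prepends it or removes its inverse; both change the root for at
most one offset. So a product of letters separates two words for at most as many offsets as it has
letters.\<close>

lemma card_roots_append_red_le:
  assumes "fst ` set v \<subseteq> I" "N > 0"
  shows "card {m. m < N \<and> root_word I N m (append_red v w) \<noteq> root_word I N m w} \<le> length v"
  using assms(1)
proof (induction v)
  case (Cons l v)
  let ?u = "append_red v w"
  have l: "fst l \<in> I" "fst (inv_letter l) \<in> I" using Cons.prems by (auto simp: inv_letter_def)
  have "card {m. m < N \<and> root_word I N m (cons_red l ?u) \<noteq> root_word I N m ?u} \<le> 1"
  proof (cases "\<exists>u'. ?u = inv_letter l # u'")
    case True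
    then obtain u' where u': "?u = inv_letter l # u'" by blast
    then have "cons_red l ?u = u'" by simp
    then show ?thesis using card_roots_Cons_le[OF l(2) assms(2), of u'] u' by (simp add: eq_commute)
  next
    case False
    then have "cons_red l ?u = l # ?u" by (cases ?u) auto
    then show ?thesis using card_roots_Cons_le[OF l(1) assms(2), of ?u] by simp
  qed
  moreover have "card {m. m < N \<and> root_word I N m ?u \<noteq> root_word I N m w} \<le> length v"
    using Cons by auto
  moreover have "{m. m < N \<and> root_word I N m (append_red (l # v) w) \<noteq> root_word I N m w} \<subseteq>
      {m. m < N \<and> root_word I N m (cons_red l ?u) \<noteq> root_word I N m ?u} \<union>
      {m. m < N \<and> root_word I N m ?u \<noteq> root_word I N m w}" by auto
  then have "card {m. m < N \<and> root_word I N m (append_red (l # v) w) \<noteq> root_word I N m w} \<le>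
      card ({m. m < N \<and> root_word I N m (cons_red l ?u) \<noteq> root_word I N m ?u} \<union>
      {m. m < N \<and> root_word I N m ?u \<noteq> root_word I N m w})"
    by (intro card_mono) auto
  ultimately show ?case
    using card_Un_le[of "{m. m < N \<and> root_word I N m (cons_red l ?u) \<noteq> root_word I N m ?u}"
        "{m. m < N \<and> root_word I N m ?u \<noteq> root_word I N m w}"] by simp
qed simp

lemma card_roots_plus_le:
  assumes "letters g \<subseteq> I" "N > 0"
  shows "card {m. m < N \<and> root I N m (g + x) \<noteq> root I N m x} \<le> length (Rep_free_group g)"
proof -
  have "{m. m < N \<and> root I N m (g + x) \<noteq> root I N m x} \<subseteq>
      {m. m < N \<and> root_word I N m (append_red (Rep_free_group g) (Rep_free_group x)) \<noteq> root_word I N m (Rep_free_group x)}"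
    by (auto simp: root_def plus_free_group.rep_eq)
  then have "card {m. m < N \<and> root I N m (g + x) \<noteq> root I N m x} \<le>
      card {m. m < N \<and> root_word I N m (append_red (Rep_free_group g) (Rep_free_group x)) \<noteq> root_word I N m (Rep_free_group x)}"
    by (intro card_mono) auto
  also have "\<dots> \<le> length (Rep_free_group g)" by (rule card_roots_append_red_le[OF assms])
  finally show ?thesis .
qed

text \<open>A group element acts on positions inside a block exactly as on the group, as long as it does
not leave the block: the matrix entry between two positions depends only on their quotient.
What is lost are the entries between different blocks.\<close>

lemma Rep_inflate_compress_left_regular:
  fixes r :: "'g::group_add \<Rightarrow> 'g" and p :: "nat \<Rightarrow> 'g"
  assumes bl: "blocks r k" and p: "inj_on p {..<d}" and k: "\<And>t. k t < d" and dec: "\<And>t. p (k t) + r t = t"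
  shows "Rep_ell2 (blinfun_apply (blocks.inflate r k (compress p d (left_regular g))) f) t
    = (if r (- g + t) = r t then Rep_ell2 f (- g + t) else 0)"
proof -
  interpret blocks r k by (rule bl)
  let ?h = "push_ell2 k (fibre (r t)) f" and ?D = "{..<d}"
  define x where "x = - g + p (k t)"
  have "Rep_ell2 (blinfun_apply (inflate (compress p d (left_regular g))) f) t = Rep_ell2 (push_ell2 p ?D ?h) x"
    using k[of t] p by (simp add: Rep_inflate compress_apply pull_ell2.rep_eq Rep_left_regular x_def)
  also have "\<dots> = (if r (- g + t) = r t then Rep_ell2 f (- g + t) else 0)"
  proof -
    have xt: "x + r t = - g + t" unfolding x_def using dec[of t] by (metis add.assoc)
    show ?thesis
    proof (cases "r (- g + t) = r t")
      case True
      have "p (k (- g + t)) + r t = x + r t" using dec[of "- g + t"] True xt by simp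
      then have x: "x = p (k (- g + t))" by simp
      have "Rep_ell2 (push_ell2 p ?D ?h) x = Rep_ell2 ?h (k (- g + t))"
        unfolding x using k p by (intro Rep_push_ell2) auto
      also have "\<dots> = Rep_ell2 f (- g + t)" using True by (intro Rep_push_ell2 inj) simp
      finally show ?thesis using True by simp
    next
      case False
      have "Rep_ell2 (push_ell2 p ?D ?h) x = 0"
      proof (cases "x \<in> p ` ?D")
        case True
        then obtain i where i: "i < d" "x = p i" by auto
        have "i \<notin> k ` fibre (r t)"
        proof
          assume "i \<in> k ` fibre (r t)"
          then obtain s where s: "r s = r t" "i = k s" by auto
          have "s = - g + t" using dec[of s] s i(2) xt by simp
          then show False using s(1) False by simp
        qed
        then show ?thesis using i p by (simp add: Rep_push_ell2 Rep_push_ell2_0)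
      qed (rule Rep_push_ell2_0)
      then show ?thesis using False by simp
    qed
  qed
  finally show ?thesis .
qed

text \<open>For a single offset the blocks lose some matrix entries completely. Averaging over the \<open>N\<close> offsets
multiplies the entry of \<open>g\<close> at \<open>t\<close> by the proportion of offsets that keep both ends in one block, which
differs from \<open>1\<close> by at most the length of \<open>g\<close> divided by \<open>N\<close>. The matrix size is the number of short
words, which for fixed \<open>N\<close> is polynomial in the number of generators.\<close>

lemma free_group_block_approximation:
  fixes I :: "'a set"
  assumes I: "finite I" and N: "N > 0" and A: "\<And>T. T \<in> A \<Longrightarrow> clinear_op T"
  shows "\<exists>\<phi> \<psi>. ccp_map A (corner (card (short_words I N))) \<phi>
      \<and> ccp_map (corner (card (short_words I N))) {T. clinear_op T} \<psi>
      \<and> (\<forall>g :: 'a free_group. letters g \<subseteq> I \<longrightarrow>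
          norm (\<psi> (\<phi> (left_regular g)) - left_regular g) \<le> real (length (Rep_free_group g)) / real N)"
proof -
  let ?F = "short_words I N" and ?d = "card (short_words I N)"
  obtain p where p: "bij_betw p {..<?d} ?F"
    using ex_bij_betw_nat_finite[OF card_short_words_le(1)[OF I, of N]] by (auto simp: lessThan_atLeast0)
  have inj: "inj_on p {..<?d}" using p by (simp add: bij_betw_def)
  define k where "k m t = the_inv_into {..<?d} p (stem I N m t)" for m t
  have pk: "p (k m t) = stem I N m t" for m t
    unfolding k_def by (rule f_the_inv_into_f_bij_betw[OF p]) (simp add: stem_in_short_words[OF N])
  have "k m t \<in> {..<?d}" for m t
    using bij_betwE[OF bij_betw_the_inv_into[OF p]] stem_in_short_words[OF N, of I m t]
    unfolding k_def by blast
  then have kd: "k m t < ?d" for m t by blast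
  have dec: "p (k m t) + root I N m t = t" for m t
    unfolding pk by (rule stem_plus_root)
  have bl: "blocks (root I N m) (k m)" for m
  proof
    show "inj_on (k m) {s. root I N m s = b}" for b
      by (rule inj_onI) (metis dec mem_Collect_eq)
  qed
  define \<phi> where "\<phi> = compress p ?d"
  define \<psi> where "\<psi> = (\<lambda>X. of_real (1 / real (card {..<N})) *\<^sub>C (\<Sum>m<N. blocks.inflate (root I N m) (k m) X))"
  have 1: "ccp_map A (corner ?d) \<phi>" unfolding \<phi>_def by (rule ccp_map_compress[OF A inj])
  have 2: "ccp_map (corner ?d) {T. clinear_op T} \<psi>"
    unfolding \<psi>_def using N
    by (intro ccp_map_average blocks.ccp_map_inflate[OF bl]) (auto simp: corner_def)
  have 3: "norm (\<psi> (\<phi> (left_regular g)) - left_regular g) \<le> real (length (Rep_free_group g)) / real N"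
    if g: "letters g \<subseteq> I" for g
  proof (rule norm_blinfun_bound)
    fix f :: "'a free_group ell2"
    let ?L = "real (length (Rep_free_group g)) / real N"
    have "norm (blinfun_apply (\<psi> (\<phi> (left_regular g)) - left_regular g) f)
        \<le> norm (of_real ?L *\<^sub>C blinfun_apply (left_regular g) f)"
    proof (rule norm_ell2_le)
      fix t
      define x where "x = - g + t"
      \<comment> \<open>\<open>G\<close> and \<open>B\<close> are the offsets that keep and lose this entry.\<close>
      define G where "G = {m. m < N \<and> root I N m x = root I N m t}"
      define B where "B = {m. m < N \<and> root I N m t \<noteq> root I N m x}"
      have "card B \<le> length (Rep_free_group g)"
        using card_roots_plus_le[OF g N, of x] by (simp add: B_def x_def)
      have "G \<union> B = {..<N}" "G \<inter> B = {}" "finite G" "finite B" by (auto simp: G_def B_def)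
      then have cGB: "card G + card B = N" by (metis card_Un_disjoint card_lessThan)
      have "Rep_ell2 (blinfun_apply (\<psi> (\<phi> (left_regular g))) f) t
          = of_real (1 / real N) * (\<Sum>m<N. if root I N m x = root I N m t then Rep_ell2 f x else 0)"
        unfolding \<psi>_def \<phi>_def x_def
        by (simp add: scaleC_blinfun.rep_eq scaleC_ell2.rep_eq blinfun.sum_left Rep_ell2_sum
            Rep_inflate_compress_left_regular[OF bl inj kd dec])
      also have "(\<Sum>m<N. if root I N m x = root I N m t then Rep_ell2 f x else 0) = (\<Sum>m\<in>G. Rep_ell2 f x)"
        by (rule sum.mono_neutral_cong_right) (auto simp: G_def)
      also have "of_real (1 / real N) * (\<Sum>m\<in>G. Rep_ell2 f x) = of_real (real (card G) / real N) * Rep_ell2 f x"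
        by simp
      finally have "Rep_ell2 (blinfun_apply (\<psi> (\<phi> (left_regular g)) - left_regular g) f) t
          = of_real (real (card G) / real N - 1) * Rep_ell2 f x"
        by (simp add: blinfun.diff_left minus_ell2.rep_eq Rep_left_regular x_def left_diff_distrib)
      also have "real (card G) / real N - 1 = - (real (card B) / real N)"
      proof -
        have "real (card G) = real N - real (card B)" using cGB by linarith
        then show ?thesis using N by (simp add: diff_divide_distrib)
      qed
      finally have "cmod (Rep_ell2 (blinfun_apply (\<psi> (\<phi> (left_regular g)) - left_regular g) f) t)
          = real (card B) / real N * cmod (Rep_ell2 f x)"
        by (simp only: norm_mult norm_of_real) simp
      also have "\<dots> \<le> ?L * cmod (Rep_ell2 f x)"
        using \<open>card B \<le> _\<close> by (intro mult_right_mono divide_right_mono) auto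
      also have "\<dots> = cmod (Rep_ell2 (of_real ?L *\<^sub>C blinfun_apply (left_regular g) f) t)"
        unfolding scaleC_ell2.rep_eq Rep_left_regular x_def norm_mult norm_of_real by simp
      finally show "cmod (Rep_ell2 (blinfun_apply (\<psi> (\<phi> (left_regular g)) - left_regular g) f) t)
          \<le> cmod (Rep_ell2 (of_real ?L *\<^sub>C blinfun_apply (left_regular g) f) t)" .
    qed
    also have "\<dots> = ?L * norm f"
      unfolding norm_scaleC norm_of_real norm_left_regular_apply by simp
    finally show "norm (blinfun_apply (\<psi> (\<phi> (left_regular g)) - left_regular g) f) \<le> ?L * norm f" .
  qed simp
  show ?thesis using 1 2 3 by blast
qed

section \<open>The entropy of the free shift\<close>

lemma log_enat_mono: "a \<le> b \<Longrightarrow> log_enat a \<le> log_enat b"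
  by (cases a; cases b) (auto simp: log_enat_def)

context free_shift
begin

lemma letters_shift_power: "letters ((shift_group ^^ k) g) = (\<lambda>j. j + int k) ` letters g"
  by (auto simp: Rep_shift_group_power shift_letter_power image_image)

text \<open>Shifting a word changes its letters but not its length. An element of the span is therefore
approximated with an error \<open>C / N\<close> that is the same along its whole orbit, provided that \<open>I\<close> contains
the shifted letters.\<close>

lemma cspan_uniform_approximation:
  assumes "S \<in> cspan (range left_regular)"
  shows "\<exists>J C. finite J \<and> 0 \<le> C \<and> (\<forall>k \<Theta> I N. clinear_on A \<Theta> \<longrightarrow>
      (\<forall>g. letters g \<subseteq> I \<longrightarrow> norm (\<Theta> (left_regular g) - left_regular g) \<le> real (length (Rep_free_group g)) / real N) \<longrightarrow>
      (\<lambda>j. j + int k) ` J \<subseteq> I \<longrightarrow> norm (\<Theta> ((\<alpha> ^^ k) S) - (\<alpha> ^^ k) S) \<le> C / real (N :: nat))"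
    (is "\<exists>J C. ?P S J C")
proof -
  note AD = cstar_algebraD[OF cstar_algebra_reduced_group_cstar]
  have "S \<in> A \<and> (\<exists>J C. ?P S J C)"
    using assms
  proof (induction rule: complex_vector.span_induct_alt)
    case base
    have "(\<alpha> ^^ k) 0 = 0" for k using power_diff[OF AD(9) AD(9), of k] by simp
    moreover have "\<Theta> 0 = 0" if "clinear_on A \<Theta>" for \<Theta> :: "_ \<Rightarrow> int free_group ell2 \<Rightarrow>\<^sub>L int free_group ell2"
      using clinear_on_diff[OF AD(1) that AD(9) AD(9)] by simp
    ultimately have "?P 0 {} 0" by simp
    then show ?case using AD(9) by blast
  next
    case (step c S R)
    then obtain g where g: "S = left_regular g" by auto
    obtain J C where JC: "?P R J C" using step by blast
    have R: "R \<in> A" using step by blast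
    have S: "S \<in> A" by (simp add: g left_regular_in_reduced_group_cstar)
    let ?L = "real (length (Rep_free_group g))"
    have "?P (c *\<^sub>C S + R) (letters g \<union> J) (cmod c * ?L + C)"
    proof (intro conjI allI impI)
      show "finite (letters g \<union> J)" "0 \<le> cmod c * ?L + C" using JC by auto
      fix k \<Theta> I and N :: nat
      assume \<Theta>: "clinear_on A \<Theta>"
        and ap: "\<forall>g. letters g \<subseteq> I \<longrightarrow> norm (\<Theta> (left_regular g) - left_regular g) \<le> real (length (Rep_free_group g)) / real N"
        and sub: "(\<lambda>j. j + int k) ` (letters g \<union> J) \<subseteq> I"
      let ?S = "(\<alpha> ^^ k) S" and ?R = "(\<alpha> ^^ k) R"
      have \<alpha>: "(\<alpha> ^^ k) (c *\<^sub>C S + R) = c *\<^sub>C ?S + ?R"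
        using power_clinear[of k] S R AD(8) unfolding clinear_on_def by metis
      have "\<Theta> (c *\<^sub>C ?S + ?R) = c *\<^sub>C \<Theta> ?S + \<Theta> ?R"
        using \<Theta> power_maps[OF S] power_maps[OF R] AD(8) unfolding clinear_on_def by metis
      then have eq: "\<Theta> ((\<alpha> ^^ k) (c *\<^sub>C S + R)) - (\<alpha> ^^ k) (c *\<^sub>C S + R) = c *\<^sub>C (\<Theta> ?S - ?S) + (\<Theta> ?R - ?R)"
        unfolding \<alpha> by (simp add: complex_vector.scale_right_diff_distrib)
      have "letters ((shift_group ^^ k) g) \<subseteq> I"
        unfolding letters_shift_power using sub by auto
      then have "norm (\<Theta> (left_regular ((shift_group ^^ k) g)) - left_regular ((shift_group ^^ k) g))
          \<le> real (length (Rep_free_group ((shift_group ^^ k) g))) / real N"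
        using ap by blast
      then have "norm (\<Theta> ?S - ?S) \<le> ?L / real N"
        unfolding g power_left_regular by (simp add: Rep_shift_group_power)
      then have "cmod c * norm (\<Theta> ?S - ?S) \<le> cmod c * (?L / real N)"
        by (rule mult_left_mono) simp
      then have "norm (c *\<^sub>C (\<Theta> ?S - ?S)) \<le> cmod c * (?L / real N)"
        by (simp only: norm_scaleC_blinfun)
      moreover have "norm (\<Theta> ?R - ?R) \<le> C / real N"
        using JC \<Theta> ap sub by (simp add: image_Un)
      ultimately show "norm (\<Theta> ((\<alpha> ^^ k) (c *\<^sub>C S + R)) - (\<alpha> ^^ k) (c *\<^sub>C S + R)) \<le> (cmod c * ?L + C) / real N"
        unfolding eq using norm_triangle_ineq[of "c *\<^sub>C (\<Theta> ?S - ?S)" "\<Theta> ?R - ?R"]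
        by (simp add: add_divide_distrib)
    qed
    moreover have "c *\<^sub>C S + R \<in> A" by (intro AD(6) AD(8) S R)
    ultimately show ?case by blast
  qed
  then show ?thesis by blast
qed

text \<open>Choose \<open>N\<close> once, depending on \<open>\<Omega>\<close> and \<open>\<delta>\<close> only. The first \<open>n\<close> shifts of finitely many words use at
most \<open>c * n\<close> generators, so the rank grows polynomially in \<open>n\<close>.\<close>

lemma rcp_orbit_le:
  assumes \<Omega>: "finite \<Omega>" "\<Omega> \<subseteq> A" and \<delta>: "\<delta> > 0"
  shows "\<exists>c N. \<forall>n. rcp A (\<lambda>T. T) (\<Union>k<n. (\<alpha> ^^ k) ` \<Omega>) \<delta> \<le> enat ((2 * (c * n) + 1) ^ N)"
proof -
  note AD = cstar_algebraD[OF cstar_algebra_reduced_group_cstar]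
  have "\<forall>a\<in>\<Omega>. \<exists>S. S \<in> cspan (range left_regular) \<and> norm (a - S) < \<delta> / 3"
    using \<Omega> \<delta> by (meson reduced_group_cstar_approx divide_pos_pos subsetD zero_less_numeral)
  then obtain S where S: "\<And>a. a \<in> \<Omega> \<Longrightarrow> S a \<in> cspan (range left_regular)" "\<And>a. a \<in> \<Omega> \<Longrightarrow> norm (a - S a) < \<delta> / 3"
    by (metis (no_types))
  have SA: "S a \<in> A" if "a \<in> \<Omega>" for a using S(1)[OF that] by (rule cspan_subset)
  define P where "P T J C \<longleftrightarrow> finite J \<and> 0 \<le> C \<and> (\<forall>k \<Theta> I N. clinear_on A \<Theta> \<longrightarrow>
      (\<forall>g. letters g \<subseteq> I \<longrightarrow> norm (\<Theta> (left_regular g) - left_regular g) \<le> real (length (Rep_free_group g)) / real N) \<longrightarrow>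
      (\<lambda>j. j + int k) ` J \<subseteq> I \<longrightarrow> norm (\<Theta> ((\<alpha> ^^ k) T) - (\<alpha> ^^ k) T) \<le> C / real (N :: nat))"
    for T :: "int free_group ell2 \<Rightarrow>\<^sub>L int free_group ell2" and J :: "int set" and C :: real
  have "\<forall>a\<in>\<Omega>. \<exists>J C. P (S a) J C"
    using cspan_uniform_approximation[OF S(1)] unfolding P_def by blast
  then obtain J C where JC: "\<And>a. a \<in> \<Omega> \<Longrightarrow> P (S a) (J a) (C a)"
    by (metis (no_types))
  define J' where "J' = (\<Union>a\<in>\<Omega>. J a)"
  define C' where "C' = (\<Sum>a\<in>\<Omega>. C a)"
  have finJ: "finite J'" using \<Omega>(1) JC by (auto simp: J'_def P_def)
  have CC: "C a \<le> C'" if "a \<in> \<Omega>" for a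
    unfolding C'_def using \<Omega>(1) JC that by (intro member_le_sum) (auto simp: P_def)
  obtain N0 :: nat where N0: "3 * C' / \<delta> < real N0" using reals_Archimedean2 by blast
  \<comment> \<open>Approximating by the span, applying the maps and returning cost a third of \<open>\<delta>\<close> each.\<close>
  define N where "N = Suc N0"
  have N: "N > 0" "C' / real N < \<delta> / 3"
    using N0 \<delta> by (auto simp: N_def field_simps)
  have "rcp A (\<lambda>T. T) (\<Union>k<n. (\<alpha> ^^ k) ` \<Omega>) \<delta> \<le> enat ((2 * (card J' * n) + 1) ^ N)" for n
  proof -
    define I where "I = (\<lambda>(j, k). j + int k) ` (J' \<times> {..<n})"
    have I: "finite I" using finJ by (simp add: I_def)
    have cI: "card I \<le> card J' * n"
      unfolding I_def using card_image_le[of "J' \<times> {..<n}" "\<lambda>(j, k). j + int k"] finJ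
      by (simp add: card_cartesian_product)
    let ?d = "card (short_words I N)"
    obtain \<phi> \<psi> where \<phi>: "ccp_map A (corner ?d) \<phi>" and \<psi>: "ccp_map (corner ?d) {T. clinear_op T} \<psi>"
      and ap: "\<And>g. letters g \<subseteq> I \<Longrightarrow> norm (\<psi> (\<phi> (left_regular g)) - left_regular g) \<le> real (length (Rep_free_group g)) / real N"
      using free_group_block_approximation[OF I N(1), of A] AD(3) by blast
    have \<phi>B: "\<phi> T \<in> corner ?d" "norm (\<phi> T) \<le> norm T" if "T \<in> A" for T
      using \<phi> that by (auto simp: ccp_map_def)
    have \<psi>n: "norm (\<psi> T) \<le> norm T" if "T \<in> corner ?d" for T
      using \<psi> that by (auto simp: ccp_map_def)
    have lin: "clinear_on A (\<lambda>T. \<psi> (\<phi> T))"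
    proof -
      have "clinear_on A \<phi>" "clinear_on (corner ?d) \<psi>"
        using \<phi> \<psi> by (auto simp: ccp_map_def completely_positive_def)
      then show ?thesis using \<phi>B(1) by (simp add: clinear_on_def)
    qed
    have close: "norm (\<psi> (\<phi> ((\<alpha> ^^ k) a)) - (\<alpha> ^^ k) a) < \<delta>" if k: "k < n" and a: "a \<in> \<Omega>" for k a
    proof -
      have aA: "a \<in> A" using a \<Omega> by blast
      let ?x = "(\<alpha> ^^ k) a" and ?y = "(\<alpha> ^^ k) (S a)"
      have xA: "?x \<in> A" and yA: "?y \<in> A" using power_maps aA SA[OF a] by auto
      have "(\<lambda>j. j + int k) ` J a \<subseteq> I" using a k by (force simp: I_def J'_def)
      then have "norm (\<psi> (\<phi> ?y) - ?y) \<le> C a / real N"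
        using JC[OF a] lin ap unfolding P_def by blast
      also have "\<dots> \<le> C' / real N" using CC[OF a] by (simp add: divide_right_mono)
      finally have 1: "norm (\<psi> (\<phi> ?y) - ?y) < \<delta> / 3" using N(2) by linarith
      have "?x - ?y = (\<alpha> ^^ k) (a - S a)" using power_diff[OF aA SA[OF a]] by simp
      then have "norm (?x - ?y) \<le> norm (a - S a)" using power_contractive[OF AD(7)[OF aA SA[OF a]]] by simp
      then have 2: "norm (?x - ?y) < \<delta> / 3" using S(2)[OF a] by simp
      have xy: "?x - ?y \<in> A" using AD(7) xA yA by blast
      have "\<psi> (\<phi> ?x) - \<psi> (\<phi> ?y) = \<psi> (\<phi> (?x - ?y))"
        using clinear_on_diff[OF AD(1) lin xA yA] by simp
      then have "norm (\<psi> (\<phi> ?x) - \<psi> (\<phi> ?y)) \<le> norm (?x - ?y)"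
        using \<psi>n[OF \<phi>B(1)[OF xy]] \<phi>B(2)[OF xy] by simp
      then have 3: "norm (\<psi> (\<phi> ?x) - \<psi> (\<phi> ?y)) < \<delta> / 3" using 2 by simp
      have "\<psi> (\<phi> ?x) - ?x = (\<psi> (\<phi> ?x) - \<psi> (\<phi> ?y)) + (\<psi> (\<phi> ?y) - ?y) - (?x - ?y)" by simp
      then have "norm (\<psi> (\<phi> ?x) - ?x) \<le> norm ((\<psi> (\<phi> ?x) - \<psi> (\<phi> ?y)) + (\<psi> (\<phi> ?y) - ?y)) + norm (?x - ?y)"
        by (simp only: norm_triangle_ineq4)
      also have "\<dots> \<le> norm (\<psi> (\<phi> ?x) - \<psi> (\<phi> ?y)) + norm (\<psi> (\<phi> ?y) - ?y) + norm (?x - ?y)"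
        by (intro add_right_mono norm_triangle_ineq)
      finally have "norm (\<psi> (\<phi> ?x) - ?x) \<le> norm (\<psi> (\<phi> ?x) - \<psi> (\<phi> ?y)) + norm (\<psi> (\<phi> ?y) - ?y) + norm (?x - ?y)" .
      then show ?thesis using 1 2 3 by linarith
    qed
    have "(\<phi>, \<psi>, corner ?d) \<in> CPA A (\<lambda>T. T) (\<Union>k<n. (\<alpha> ^^ k) ` \<Omega>) \<delta>"
      unfolding CPA_def using fin_dim_corner \<phi> \<psi> close by auto
    then have "rcp A (\<lambda>T. T) (\<Union>k<n. (\<alpha> ^^ k) ` \<Omega>) \<delta> \<le> enat ?d"
      unfolding rcp_def using has_rank_corner by (intro Inf_lower) blast
    also have "?d \<le> (2 * card I + 1) ^ N" by (rule card_short_words_le(2)[OF I])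
    also have "\<dots> \<le> (2 * (card J' * n) + 1) ^ N" using cI by (intro power_mono) auto
    finally show ?thesis by simp
  qed
  then show ?thesis by blast
qed

lemma ht_fin_delta_le_0:
  assumes \<Omega>: "finite \<Omega>" "\<Omega> \<subseteq> A" and \<delta>: "\<delta> > 0"
  shows "ht_fin_delta A (\<lambda>T. T) \<alpha> \<Omega> \<delta> \<le> 0"
proof -
  obtain c N where le: "\<And>n. rcp A (\<lambda>T. T) (\<Union>k<n. (\<alpha> ^^ k) ` \<Omega>) \<delta> \<le> enat ((2 * (c * n) + 1) ^ N)"
    using rcp_orbit_le[OF assms] by blast
  define K where "K = real (2 * c + 1)"
  define u where "u n = real N * (ln K / real n + ln (real n) / real n)" for n :: nat
  have "u \<longlonglongrightarrow> real N * (0 + 0)"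
    unfolding u_def by (intro tendsto_intros lim_const_over_n lim_ln_over_n)
  then have "(\<lambda>n. ereal (u n)) \<longlonglongrightarrow> 0" by (simp add: zero_ereal_def)
  then have lim: "limsup (\<lambda>n. ereal (u n)) = 0" by (intro lim_imp_Limsup) auto
  have "limsup (\<lambda>n. ereal (1 / real n) * log_enat (rcp A (\<lambda>T. T) (\<Union>k<n. (\<alpha> ^^ k) ` \<Omega>) \<delta>)) \<le> limsup (\<lambda>n. ereal (u n))"
  proof (rule Limsup_mono)
    show "\<forall>\<^sub>F n in sequentially. ereal (1 / real n) * log_enat (rcp A (\<lambda>T. T) (\<Union>k<n. (\<alpha> ^^ k) ` \<Omega>) \<delta>) \<le> ereal (u n)"
      using eventually_gt_at_top[of 0]
    proof eventually_elim
      case (elim n)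
      have "log_enat (rcp A (\<lambda>T. T) (\<Union>k<n. (\<alpha> ^^ k) ` \<Omega>) \<delta>) \<le> log_enat (enat ((2 * (c * n) + 1) ^ N))"
        by (rule log_enat_mono[OF le])
      also have "\<dots> = ereal (real N * ln (real (2 * (c * n) + 1)))"
        by (simp add: log_enat_def ln_realpow)
      also have "\<dots> \<le> ereal (real N * (ln K + ln (real n)))"
      proof -
        have "real (2 * (c * n) + 1) \<le> K * real n" using elim by (simp add: K_def algebra_simps)
        then have "ln (real (2 * (c * n) + 1)) \<le> ln (K * real n)" by (subst ln_le_cancel_iff) (use elim in \<open>auto simp: K_def intro!: add_pos_nonneg\<close>)
        also have "\<dots> = ln K + ln (real n)" using elim by (intro ln_mult_pos) (auto simp: K_def)
        finally show ?thesis by (simp add: mult_left_mono)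
      qed
      finally have "ereal (1 / real n) * log_enat (rcp A (\<lambda>T. T) (\<Union>k<n. (\<alpha> ^^ k) ` \<Omega>) \<delta>)
          \<le> ereal (1 / real n) * ereal (real N * (ln K + ln (real n)))"
        by (intro ereal_mult_left_mono) auto
      also have "\<dots> = ereal (u n)" by (simp add: u_def add_divide_distrib distrib_left)
      finally show ?case .
    qed
  qed
  then show ?thesis unfolding ht_fin_delta_def lim .
qed

text \<open>The entropy could only be negative through ranks equal to \<open>0\<close>, whose logarithm is \<open>-\<infinity>\<close>. An algebra of
rank \<open>0\<close> is trivial, and maps through it cannot approximate the unit to within \<open>1 / 2\<close>.\<close>

lemma ht_fin_delta_unit_ge_0: "ht_fin_delta A (\<lambda>T. T) \<alpha> {id_blinfun} (1 / 2) \<ge> 0"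
  unfolding ht_fin_delta_def
proof (rule le_Limsup)
  show "\<forall>\<^sub>F n in sequentially. 0 \<le> ereal (1 / real n) * log_enat (rcp A (\<lambda>T. T) (\<Union>k<n. (\<alpha> ^^ k) ` {id_blinfun}) (1 / 2))"
    using eventually_gt_at_top[of 0]
  proof eventually_elim
    case (elim n)
    let ?\<Omega> = "\<Union>k<n. (\<alpha> ^^ k) ` {id_blinfun}"
    have id\<Omega>: "id_blinfun \<in> ?\<Omega>" using elim by (intro UN_I[of 0]) auto
    have "1 \<le> rcp A (\<lambda>T. T) ?\<Omega> (1 / 2)"
      unfolding rcp_def
    proof (rule Inf_greatest)
      fix x assume "x \<in> {enat r | \<phi> \<psi> B r. (\<phi>, \<psi>, B) \<in> CPA A (\<lambda>T. T) ?\<Omega> (1 / 2) \<and> has_rank B r}"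
      then obtain \<phi> \<psi> B r where x: "x = enat r" and cpa: "(\<phi>, \<psi>, B) \<in> CPA A (\<lambda>T. T) ?\<Omega> (1 / 2)" and r: "has_rank B r"
        by blast
      have "fin_dim_cstar_algebra B \<and> ccp_map A B \<phi> \<and> ccp_map B {T. clinear_op T} \<psi>
          \<and> (\<forall>a\<in>?\<Omega>. norm (\<psi> (\<phi> a) - a) < 1 / 2)"
        using cpa unfolding CPA_def mem_Collect_eq prod.case .
      then have B: "fin_dim_cstar_algebra B" and \<phi>: "ccp_map A B \<phi>" and \<psi>: "ccp_map B {T. clinear_op T} \<psi>"
        and all: "\<forall>a\<in>?\<Omega>. norm (\<psi> (\<phi> a) - a) < 1 / 2"
        by blast+
      have close: "norm (\<psi> (\<phi> id_blinfun) - id_blinfun) < 1 / 2"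
        using all id\<Omega> by blast
      have "r \<noteq> 0"
      proof
        assume "r = 0"
        have \<phi>B: "\<phi> id_blinfun \<in> B" using \<phi> id_in_reduced_group_cstar by (auto simp: ccp_map_def)
        then have "\<phi> id_blinfun = 0" using has_rank_0_imp_trivial[OF B] r \<open>r = 0\<close> by blast
        then have "norm (\<psi> (\<phi> id_blinfun)) \<le> 0" using \<psi> \<phi>B by (auto simp: ccp_map_def)
        then have "norm (id_blinfun :: int free_group ell2 \<Rightarrow>\<^sub>L int free_group ell2) < 1 / 2"
          using close by simp
        moreover have "norm (ket 0 :: int free_group ell2) \<le> norm (id_blinfun :: int free_group ell2 \<Rightarrow>\<^sub>L int free_group ell2) * norm (ket 0 :: int free_group ell2)"
          using norm_blinfun[of id_blinfun "ket 0"] by simp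
        moreover have "norm (ket 0 :: int free_group ell2) > 0"
        proof -
          have "ket 0 \<noteq> (0 :: int free_group ell2)"
          proof
            assume "ket 0 = (0 :: int free_group ell2)"
            then have "Rep_ell2 (ket 0 :: int free_group ell2) 0 = 0" by simp
            then show False by (simp add: ket.rep_eq)
          qed
          then show ?thesis by simp
        qed
        ultimately show False by (simp add: mult_le_cancel_right2 not_le)
      qed
      then show "1 \<le> x" by (simp add: x one_enat_def)
    qed
    then have "log_enat 1 \<le> log_enat (rcp A (\<lambda>T. T) ?\<Omega> (1 / 2))" by (rule log_enat_mono)
    then have "0 \<le> log_enat (rcp A (\<lambda>T. T) ?\<Omega> (1 / 2))" by (simp add: log_enat_def one_enat_def zero_ereal_def)
    then show ?case by (intro ereal_0_le_mult) simp_all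
  qed
qed simp

lemma entropy_zero: "ht A \<alpha> = 0"
proof (rule antisym)
  show "ht A \<alpha> \<le> 0"
    unfolding ht_def ht_rep_def ht_fin_def using ht_fin_delta_le_0 by (intro SUP_least) auto
  have "0 \<le> ht_fin_delta A (\<lambda>T. T) \<alpha> {id_blinfun} (1 / 2)" by (rule ht_fin_delta_unit_ge_0)
  also have "\<dots> \<le> ht_fin A (\<lambda>T. T) \<alpha> {id_blinfun}"
    unfolding ht_fin_def by (rule SUP_upper) simp
  also have "\<dots> \<le> ht A \<alpha>"
    unfolding ht_def ht_rep_def by (rule SUP_upper) (simp add: id_in_reduced_group_cstar)
  finally show "0 \<le> ht A \<alpha>" .
qed

end

theorem proposition6p1:
  fixes \<alpha> :: "(int free_group ell2 \<Rightarrow>\<^sub>L int free_group ell2) \<Rightarrow>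
      (int free_group ell2 \<Rightarrow>\<^sub>L int free_group ell2)"
  assumes "cstar_automorphism reduced_group_cstar \<alpha>"
    and "\<And>i. \<alpha> (left_regular (generator i)) = left_regular (generator (i + 1))"
  shows "moebius_linearly_disjoint reduced_group_cstar \<alpha> \<and> ht reduced_group_cstar \<alpha> = 0"
proof -
  interpret free_shift \<alpha> using assms by unfold_locales
  show ?thesis using moebius_disjoint entropy_zero by blast
qed

end
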